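(* Let $A$ be a C*-algebra and let $a,b\in A^+$ be positive elements of $A$. The following are true. (i) $\tau(a)\leq \tau(b)$ for all $\tau\in T(A)$ if and only if for every $\epsilon>0$ there is $\delta>0$ such that $(a-\epsilon)_+\preceq (b-\delta)_+$. (ii) $\tau(a)=\tau(b)$ for all $\tau\in T(A)$ if and only if $a\sim b$.
   Context: $A^+$ denotes the set of positive elements of the C*-algebra $A$. A trace on $A$ is a map $\tau\colon A^+\to[0,\infty]$ that is additive, homogeneous with respect to nonnegative real scalars (with $0\cdot\infty=0$, so $\tau(0)=0$), and satisfies $\tau(xx^* )=\tau(x^*x)$ for all $x\in A$. $T(A)$ denotes the set of lower semicontinuous traces on $A$ (lower semicontinuous with respect to the norm topology on $A^+$); traces are not assumed to be bounded or densely finite. For $a,b\in A^+$: $a\sim b$ ($a$ is Cuntz-Pedersen equivalent to $b$) means that there are $x_i\in A$, $i\in\mathbb{N}$, such that $a=\sum_{i=1}^\infty x_ix_i^*$ and $b=\sum_{i=1}^\infty x_i^*x_i$ (norm-convergent series). $a\preceq b$ ($a$ is Cuntz-Pedersen smaller than $b$) means that there is $a'\in A^+$ with $a\sim a'\leq b$. The relations $\sim$ and $\preceq$ are transitive. For $a\in A^+$ and $\epsilon>0$, $(a-\epsilon)_+$ denotes the element of $A^+$ obtained by applying the function $t\mapsto\max(t-\epsilon,0)$ to $a$ by continuous functional calculus. *)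

theory Defs
  imports "HOL-Analysis.Analysis"
begin

text \<open>C*-algebras over the complex numbers. A unit is not required, and the zero algebra is allowed.\<close>

class cstar_algebra = real_normed_algebra + banach +
  fixes scaleC :: "complex \<Rightarrow> 'a \<Rightarrow> 'a" (infixr "*\<^sub>C" 75)
    and star :: "'a \<Rightarrow> 'a" ("_\<^sup>\<star>" [1000] 1000)
  assumes scaleC_add_right: "c *\<^sub>C (x + y) = c *\<^sub>C x + c *\<^sub>C y"
    and scaleC_add_left: "(c + d) *\<^sub>C x = c *\<^sub>C x + d *\<^sub>C x"
    and scaleC_scaleC: "c *\<^sub>C d *\<^sub>C x = (c * d) *\<^sub>C x"
    and scaleR_scaleC: "r *\<^sub>R x = complex_of_real r *\<^sub>C x"
    and mult_scaleC_left: "(c *\<^sub>C x) * y = c *\<^sub>C (x * y)"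
    and mult_scaleC_right: "x * (c *\<^sub>C y) = c *\<^sub>C (x * y)"
    and norm_scaleC: "norm (c *\<^sub>C x) = cmod c * norm x"
    and star_add: "(x + y)\<^sup>\<star> = x\<^sup>\<star> + y\<^sup>\<star>"
    and star_scaleC: "(c *\<^sub>C x)\<^sup>\<star> = cnj c *\<^sub>C x\<^sup>\<star>"
    and star_mult: "(x * y)\<^sup>\<star> = y\<^sup>\<star> * x\<^sup>\<star>"
    and star_star: "(x\<^sup>\<star>)\<^sup>\<star> = x"
    and cstar_identity: "norm (x\<^sup>\<star> * x) = (norm x)\<^sup>2"

text \<open>
  The spectrum of \<open>a\<close> in the unitization \<open>A \<oplus> \<complex>1\<close>: the element \<open>z1 - a\<close> is invertible iff there is
  \<open>w1 + b\<close> with \<open>(z1 - a)(w1 + b) = zw1 + (zb - wa - ab) = 1\<close>, and likewise for the other product.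
  With this convention \<open>0\<close> always belongs to the spectrum (also if \<open>A\<close> happens to be unital), which
  affects neither positivity nor the functional calculus for functions vanishing at \<open>0\<close>.
\<close>

definition spectrum :: "'a::cstar_algebra \<Rightarrow> complex set" where
  "spectrum a = {z. \<not> (\<exists>w b. z * w = 1 \<and>
     z *\<^sub>C b - w *\<^sub>C a - a * b = 0 \<and> z *\<^sub>C b - w *\<^sub>C a - b * a = 0)}"

definition positives :: "'a::cstar_algebra set" where
  "positives = {a. a\<^sup>\<star> = a \<and> spectrum a \<subseteq> {z. Im z = 0 \<and> 0 \<le> Re z}}"

text \<open>
  Continuous functional calculus without unit: \<open>f(a)\<close> is the image of \<open>f\<close> under the contractive
  *-homomorphism \<open>\<Phi>\<close> from the continuous functions on the spectrum of \<open>a\<close> vanishing at \<open>0\<close> into \<open>A\<close>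
  that maps the identity function to \<open>a\<close>. For self-adjoint (even normal) \<open>a\<close> it exists and is unique.
  Functions on the spectrum are represented by total functions; the contractivity clause, applied to
  \<open>f - g\<close> with bound \<open>0\<close>, makes \<open>\<Phi> f\<close> depend on the values of \<open>f\<close> on the spectrum only.
\<close>

definition cont_vanishing :: "complex set \<Rightarrow> (complex \<Rightarrow> complex) set" where
  "cont_vanishing S = {f. continuous_on S f \<and> f 0 = 0}"

definition is_functional_calculus ::
    "'a::cstar_algebra \<Rightarrow> ((complex \<Rightarrow> complex) \<Rightarrow> 'a) \<Rightarrow> bool" where
  "is_functional_calculus a \<Phi> \<longleftrightarrow>
     (\<forall>f\<in>cont_vanishing (spectrum a). \<forall>g\<in>cont_vanishing (spectrum a).
        \<Phi> (\<lambda>z. f z + g z) = \<Phi> f + \<Phi> g \<and> \<Phi> (\<lambda>z. f z * g z) = \<Phi> f * \<Phi> g) \<and>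
     (\<forall>f\<in>cont_vanishing (spectrum a).
        (\<forall>c. \<Phi> (\<lambda>z. c * f z) = c *\<^sub>C \<Phi> f) \<and> \<Phi> (\<lambda>z. cnj (f z)) = (\<Phi> f)\<^sup>\<star> \<and>
        (\<forall>K. (\<forall>z\<in>spectrum a. cmod (f z) \<le> K) \<longrightarrow> norm (\<Phi> f) \<le> K)) \<and>
     \<Phi> (\<lambda>z. z) = a"

definition functional_calculus :: "(complex \<Rightarrow> complex) \<Rightarrow> 'a::cstar_algebra \<Rightarrow> 'a" where
  "functional_calculus f a = (THE y. \<exists>\<Phi>. is_functional_calculus a \<Phi> \<and> y = \<Phi> f)"

text \<open>\<open>(a - \<epsilon>)\<^sub>+\<close>; meant for positive \<open>a\<close>, whose spectrum is real, and \<open>\<epsilon> > 0\<close>.\<close>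

definition cut_down :: "'a::cstar_algebra \<Rightarrow> real \<Rightarrow> 'a" where
  "cut_down a \<epsilon> = functional_calculus (\<lambda>z. complex_of_real (max (Re z - \<epsilon>) 0)) a"

text \<open>
  Traces are maps on the positive elements only; they are represented by total functions whose
  values elsewhere are irrelevant. Note that \<open>0 * \<infinity> = 0\<close> in \<^typ>\<open>ennreal\<close>.
\<close>

definition is_trace :: "('a::cstar_algebra \<Rightarrow> ennreal) \<Rightarrow> bool" where
  "is_trace \<tau> \<longleftrightarrow>
     (\<forall>a\<in>positives. \<forall>b\<in>positives. \<tau> (a + b) = \<tau> a + \<tau> b) \<and>
     (\<forall>a\<in>positives. \<forall>r\<ge>0. \<tau> (r *\<^sub>R a) = ennreal r * \<tau> a) \<and>
     (\<forall>x. \<tau> (x * x\<^sup>\<star>) = \<tau> (x\<^sup>\<star> * x))"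

definition lsc_on :: "'a::topological_space set \<Rightarrow> ('a \<Rightarrow> ennreal) \<Rightarrow> bool" where
  "lsc_on S f \<longleftrightarrow> (\<forall>t. closedin (top_of_set S) {x\<in>S. f x \<le> t})"

definition lsc_traces :: "('a::cstar_algebra \<Rightarrow> ennreal) set" where
  "lsc_traces = {\<tau>. is_trace \<tau> \<and> lsc_on positives \<tau>}"

definition cp_equiv :: "'a::cstar_algebra \<Rightarrow> 'a \<Rightarrow> bool" (infix "\<sim>\<^sub>C\<^sub>P" 50) where
  "a \<sim>\<^sub>C\<^sub>P b \<longleftrightarrow>
     (\<exists>x :: nat \<Rightarrow> 'a. (\<lambda>i. x i * (x i)\<^sup>\<star>) sums a \<and> (\<lambda>i. (x i)\<^sup>\<star> * x i) sums b)"

definition cp_le :: "'a::cstar_algebra \<Rightarrow> 'a \<Rightarrow> bool" (infix "\<preceq>\<^sub>C\<^sub>P" 50) where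
  "a \<preceq>\<^sub>C\<^sub>P b \<longleftrightarrow> (\<exists>a'\<in>positives. a \<sim>\<^sub>C\<^sub>P a' \<and> b - a' \<in> positives)"

end

theory Submission
  imports Defs "HOL-Computational_Algebra.Fundamental_Theorem_Algebra"
begin

text \<open>
  Let \<open>\<tau>(a) \<le> \<tau>(b)\<close> for all lower semicontinuous traces. Every trace \<open>\<tau>\<close>, semicontinuous or not, has the
  lower semicontinuous regularization \<open>\<tau>'(x) = sup \<tau>((x - \<epsilon>)\<^sub>+)\<close>, so \<open>\<tau>((a - \<epsilon>)\<^sub>+) \<le> \<tau>'(a) \<le> \<tau>'(b) \<le> \<tau>(b)\<close>
  for all traces \<open>\<tau>\<close>. Traces are the additive and homogeneous functionals on positive elements
  that are monotone for Cuntz-Pedersen comparison by finite sums, and a Hahn-Banach argument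
  (\<open>fin_cp_le_of_traces\<close>) shows that they detect comparison up to a factor: \<open>(a - \<epsilon>)\<^sub>+ \<preceq> tb\<close> for every \<open>t > 1\<close>. The factor is removed
  by the elementary inequality \<open>(x - \<epsilon>)\<^sub>+ \<le> (1 - \<eta>)x\<close>, with \<open>\<eta> > 0\<close> depending on \<open>\<parallel>x\<parallel>\<close>
  (\<open>cut_down_pos_le_scaleR\<close>), and a comparison \<open>x \<preceq> y\<close> always implies \<open>(x - \<epsilon>)\<^sub>+ \<preceq> (y - \<delta>)\<^sub>+\<close> for some
  \<open>\<delta> > 0\<close> (\<open>fin_cp_le_cut_down\<close>). This is the nontrivial half of the first part; the converse holds
  because lower semicontinuous traces respect Cuntz-Pedersen equivalence and \<open>(a - \<epsilon>)\<^sub>+ \<rightarrow> a\<close>.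

  Let now \<open>\<tau>(a) = \<tau>(b)\<close> for all lower semicontinuous traces. By the first part \<open>(a - \<epsilon>)\<^sub>+\<close> is equivalent to
  an element below some \<open>(b - \<delta>)\<^sub>+\<close>. Remove these two equivalent parts. The same inequality
  \<open>(x - \<epsilon>)\<^sub>+ \<le> (1 - \<eta>)x\<close> shows that a proportion of \<open>a\<close> and of \<open>b\<close> remains; therefore the remainders
  again agree on all lower semicontinuous traces, also on those that are infinite on the removed part
  (\<open>trace_eq_split\<close>). The remainder of \<open>a\<close> has norm at most \<open>\<epsilon>\<close>. Exchanging the roles of \<open>a\<close> and \<open>b\<close>
  and letting \<open>\<epsilon>\<close> tend to zero exhausts both elements by equivalent pieces.

  All comparisons are carried out with finite sums. Their two basic properties are a Riesz
  refinement (\<open>interpolation\<close>), which makes the relation transitive, and \<open>(a - \<epsilon>)\<^sub>+ \<preceq> s\<close> whenever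
  \<open>\<parallel>a - s\<parallel> < \<epsilon>\<close> (\<open>cut_down_fin_cp_le_near\<close>). They rest on the continuous functional calculus and on the
  positivity of \<open>x\<^sup>\<star>x\<close>, which are developed in a unitization of the algebra.
\<close>

section \<open>Complex scalars and the involution\<close>

lemma scaleC_zero_right [simp]: "c *\<^sub>C (0::'a::cstar_algebra) = 0"
  using scaleC_add_right[of c "0::'a" 0] by simp

lemma scaleC_zero_left [simp]: "0 *\<^sub>C (x::'a::cstar_algebra) = 0"
  using scaleC_add_left[of 0 0 x] by simp

lemma scaleC_minus_right [simp]: "c *\<^sub>C (- x) = - (c *\<^sub>C (x::'a::cstar_algebra))"
  using scaleC_add_right[of c x "- x"] by (simp add: eq_neg_iff_add_eq_0 add.commute)

lemma scaleC_minus_left [simp]: "(- c) *\<^sub>C x = - (c *\<^sub>C (x::'a::cstar_algebra))"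
  using scaleC_add_left[of c "- c" x] by (simp add: eq_neg_iff_add_eq_0 add.commute)

lemma scaleC_diff_right: "c *\<^sub>C (x - y) = c *\<^sub>C x - c *\<^sub>C (y::'a::cstar_algebra)"
  using scaleC_add_right[of c x "- y"] by simp

lemma scaleC_diff_left: "(c - d) *\<^sub>C x = c *\<^sub>C x - d *\<^sub>C (x::'a::cstar_algebra)"
  using scaleC_add_left[of c "- d" x] by simp

lemma scaleC_one [simp]: "1 *\<^sub>C x = (x::'a::cstar_algebra)"
  using scaleR_scaleC[of 1 x] by simp

lemma scaleC_scaleC' [simp]: "c *\<^sub>C d *\<^sub>C x = (c * d) *\<^sub>C (x::'a::cstar_algebra)"
  by (rule scaleC_scaleC)

lemma scaleC_of_real: "complex_of_real r *\<^sub>C x = r *\<^sub>R (x::'a::cstar_algebra)"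
  by (simp add: scaleR_scaleC)

lemma star_zero [simp]: "(0::'a::cstar_algebra)\<^sup>\<star> = 0"
  using star_add[of "0::'a" 0] by simp

lemma star_minus [simp]: "(- x)\<^sup>\<star> = - ((x::'a::cstar_algebra)\<^sup>\<star>)"
  using star_add[of x "- x"] by (simp add: eq_neg_iff_add_eq_0 add.commute)

lemma star_diff: "(x - y)\<^sup>\<star> = x\<^sup>\<star> - (y::'a::cstar_algebra)\<^sup>\<star>"
  using star_add[of x "- y"] by simp

lemma star_scaleR: "(r *\<^sub>R x)\<^sup>\<star> = r *\<^sub>R (x::'a::cstar_algebra)\<^sup>\<star>"
  by (simp add: scaleR_scaleC star_scaleC)

declare star_star [simp]

lemma norm_star [simp]: "norm (x\<^sup>\<star>) = norm (x::'a::cstar_algebra)"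
proof -
  have le: "norm y \<le> norm (y\<^sup>\<star>)" for y :: 'a
  proof (cases "y = 0")
    case False
    have "norm y * norm y \<le> norm (y\<^sup>\<star>) * norm y"
      using norm_mult_ineq[of "y\<^sup>\<star>" y] cstar_identity[of y] by (simp add: power2_eq_square)
    then show ?thesis using False by simp
  qed simp
  show ?thesis using le[of x] le[of "x\<^sup>\<star>"] by simp
qed

lemma cstar_identity': "norm (x * x\<^sup>\<star>) = (norm (x::'a::cstar_algebra))\<^sup>2"
  using cstar_identity[of "x\<^sup>\<star>"] by simp

lemma bounded_linear_star: "bounded_linear (star :: 'a::cstar_algebra \<Rightarrow> 'a)"
  by (rule bounded_linear_intro[of _ 1]) (simp_all add: star_add star_scaleR)

lemmas tendsto_star [tendsto_intros] = bounded_linear.tendsto[OF bounded_linear_star]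

section \<open>The unitization\<close>

lemma bounded_linear_affine_mult:
  "bounded_linear (\<lambda>x. l *\<^sub>C x + a * (x::'a::cstar_algebra))"
proof (rule bounded_linear_intro[of _ "cmod l + norm a"])
  fix x :: 'a
  show "norm (l *\<^sub>C x + a * x) \<le> norm x * (cmod l + norm a)"
    using norm_triangle_ineq[of "l *\<^sub>C x" "a * x"] norm_mult_ineq[of a x]
    by (simp add: norm_scaleC algebra_simps)
qed (simp_all add: scaleC_add_right algebra_simps scaleR_scaleC mult_scaleC_right mult.commute)

text \<open>
  If \<open>A\<close> has a unit \<open>e\<close>, the element \<open>1 - e\<close> of \<open>A \<oplus> \<complex>1\<close> acts as zero on \<open>A\<close>, so the operator norm
  on \<open>A\<close> is only a seminorm there. The maximum with the modulus of the scalar part is a C*-norm in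
  both cases: a scalar part of an element has modulus at most the operator norm when \<open>A\<close> has no unit,
  and \<open>A \<oplus> \<complex>1\<close> is the direct product of \<open>A\<close> and \<open>\<complex>\<close> when it has one.
\<close>

datatype 'a unitization = Unitized (scalar: complex) (elt: 'a)

definition op_norm :: "complex \<Rightarrow> 'a::cstar_algebra \<Rightarrow> real" where
  "op_norm l a = onorm (\<lambda>x. l *\<^sub>C x + a * x)"

lemma op_norm_nonneg: "0 \<le> op_norm l a"
  unfolding op_norm_def by (rule onorm_pos_le[OF bounded_linear_affine_mult])

lemma op_norm_bound: "norm (l *\<^sub>C x + a * x) \<le> op_norm l a * norm x"
  unfolding op_norm_def by (rule onorm[OF bounded_linear_affine_mult])

lemma op_norm_least: "0 \<le> b \<Longrightarrow> (\<And>x. norm (l *\<^sub>C x + a * x) \<le> b * norm x) \<Longrightarrow> op_norm l a \<le> b"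
  unfolding op_norm_def by (rule onorm_bound)

text \<open>Left multiplication is isometric: test it on the adjoint.\<close>

lemma op_norm_unitize: "op_norm 0 a = norm a"
proof (rule antisym)
  show "op_norm 0 a \<le> norm a"
    by (rule op_norm_least) (simp_all add: norm_mult_ineq)
  have "norm a * norm a \<le> op_norm 0 a * norm a"
    using op_norm_bound[of 0 "a\<^sup>\<star>" a] cstar_identity'[of a] by (simp add: power2_eq_square)
  then show "norm a \<le> op_norm 0 a" using op_norm_nonneg[of 0 a]
    by (cases "a = 0") auto
qed

lemma op_norm_scalar: "op_norm l 0 \<le> cmod l"
  by (rule op_norm_least) (simp_all add: norm_scaleC)

lemma op_norm_add: "op_norm (l + m) (a + b) \<le> op_norm l a + op_norm m b"
proof (rule op_norm_least)
  fix x
  have "(l + m) *\<^sub>C x + (a + b) * x = (l *\<^sub>C x + a * x) + (m *\<^sub>C x + b * x)"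
    by (simp add: scaleC_add_left algebra_simps)
  then show "norm ((l + m) *\<^sub>C x + (a + b) * x) \<le> (op_norm l a + op_norm m b) * norm x"
    using norm_triangle_ineq[of "l *\<^sub>C x + a * x" "m *\<^sub>C x + b * x"]
      op_norm_bound[of l x a] op_norm_bound[of m x b]
    by (simp only: distrib_right)
qed (simp add: op_norm_nonneg add_nonneg_nonneg)

lemma op_norm_scaleC: "op_norm (c * l) (c *\<^sub>C a) = cmod c * op_norm l a"
proof -
  have le: "op_norm (c * l) (c *\<^sub>C a) \<le> cmod c * op_norm l a" for c l and a :: 'a
  proof (rule op_norm_least)
    fix x
    have "(c * l) *\<^sub>C x + c *\<^sub>C a * x = c *\<^sub>C (l *\<^sub>C x + a * x)"
      by (simp add: scaleC_add_right mult_scaleC_left)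
    then show "norm ((c * l) *\<^sub>C x + c *\<^sub>C a * x) \<le> cmod c * op_norm l a * norm x"
      using mult_left_mono[OF op_norm_bound[of l x a], of "cmod c"]
      by (simp add: norm_scaleC mult.assoc)
  qed (simp add: op_norm_nonneg)
  show ?thesis
  proof (cases "c = 0")
    case True
    then show ?thesis using le[of c l a] op_norm_nonneg[of "c*l" "c *\<^sub>C a"] by simp
  next
    case False
    have "op_norm l a \<le> cmod (inverse c) * op_norm (c * l) (c *\<^sub>C a)"
      using le[of "inverse c" "c * l" "c *\<^sub>C a"] False by (simp add: mult.assoc[symmetric])
    then have "cmod c * op_norm l a \<le> cmod c * (cmod (inverse c) * op_norm (c * l) (c *\<^sub>C a))"
      by (rule mult_left_mono) simp
    also have "\<dots> = op_norm (c * l) (c *\<^sub>C a)"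
      using False by (simp add: mult.assoc[symmetric] norm_mult[symmetric])
    finally show ?thesis using le[of c l a] by simp
  qed
qed

lemma op_norm_mult: "op_norm (l * m) (l *\<^sub>C b + m *\<^sub>C a + a * b) \<le> op_norm l a * op_norm m b"
proof (rule op_norm_least)
  fix x
  have "(l * m) *\<^sub>C x + (l *\<^sub>C b + m *\<^sub>C a + a * b) * x
      = l *\<^sub>C (m *\<^sub>C x + b * x) + a * (m *\<^sub>C x + b * x)"
    by (simp add: scaleC_add_right algebra_simps mult_scaleC_left mult_scaleC_right)
  then have "norm ((l * m) *\<^sub>C x + (l *\<^sub>C b + m *\<^sub>C a + a * b) * x)
      \<le> op_norm l a * norm (m *\<^sub>C x + b * x)"
    by (simp add: op_norm_bound)
  also have "\<dots> \<le> op_norm l a * (op_norm m b * norm x)"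
    by (intro mult_left_mono op_norm_bound op_norm_nonneg)
  finally show "norm ((l * m) *\<^sub>C x + (l *\<^sub>C b + m *\<^sub>C a + a * b) * x)
      \<le> op_norm l a * op_norm m b * norm x" by (simp add: mult.assoc)
qed (simp add: op_norm_nonneg)

text \<open>
  Write \<open>y = (l + a)x\<close>. The C*-identity in \<open>A\<close> turns \<open>\<parallel>y\<parallel>\<^sup>2\<close> into \<open>\<parallel>x\<^sup>\<star> ((l + a)\<^sup>\<star>(l + a) x)\<parallel>\<close>, in which
  the operator norm of \<open>(l + a)\<^sup>\<star>(l + a)\<close> can be used; the other inequality of the C*-identity is then
  automatic.
\<close>

lemma op_norm_cstar:
  "(op_norm l a)\<^sup>2 \<le> op_norm (cnj l * l) (cnj l *\<^sub>C a + l *\<^sub>C a\<^sup>\<star> + a\<^sup>\<star> * a)"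
proof -
  let ?N = "op_norm (cnj l * l) (cnj l *\<^sub>C a + l *\<^sub>C a\<^sup>\<star> + a\<^sup>\<star> * a)"
  have "op_norm l a \<le> sqrt ?N"
  proof (rule op_norm_least)
    fix x
    let ?y = "l *\<^sub>C x + a * x"
    have "(norm ?y)\<^sup>2 = norm (?y\<^sup>\<star> * ?y)" by (simp add: cstar_identity)
    also have "?y\<^sup>\<star> * ?y = x\<^sup>\<star> * ((cnj l * l) *\<^sub>C x + (cnj l *\<^sub>C a + l *\<^sub>C a\<^sup>\<star> + a\<^sup>\<star> * a) * x)"
      by (simp add: star_add star_mult star_scaleC scaleC_add_right algebra_simps
          mult_scaleC_left mult_scaleC_right)
    also have "norm \<dots> \<le> norm x * (?N * norm x)"
      by (rule order_trans[OF norm_mult_ineq]) (simp add: mult_left_mono op_norm_bound)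
    also have "\<dots> = (sqrt ?N * norm x)\<^sup>2"
      by (simp add: power_mult_distrib op_norm_nonneg power2_eq_square)
    finally show "norm ?y \<le> sqrt ?N * norm x"
      by (rule power2_le_imp_le) (simp add: op_norm_nonneg)
  qed (simp add: op_norm_nonneg)
  then have "(op_norm l a)\<^sup>2 \<le> (sqrt ?N)\<^sup>2" by (intro power_mono op_norm_nonneg)
  then show ?thesis by (simp add: op_norm_nonneg)
qed

instantiation unitization :: (cstar_algebra) real_normed_algebra_1
begin

definition "0 = Unitized 0 0"
definition "1 = Unitized 1 0"
definition "x + y = Unitized (scalar x + scalar y) (elt x + elt y)"
definition "x - y = Unitized (scalar x - scalar y) (elt x - elt y)"
definition "- x = Unitized (- scalar x) (- elt x)"
definition "x * y = Unitized (scalar x * scalar y)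
  (scalar x *\<^sub>C elt y + scalar y *\<^sub>C elt x + elt x * elt y)"
definition "r *\<^sub>R x = Unitized (of_real r * scalar x) (r *\<^sub>R elt x)"
definition "norm x = max (cmod (scalar x)) (op_norm (scalar x) (elt x))"
definition "dist x y = norm (x - y :: 'a unitization)"
definition "sgn x = inverse (norm x) *\<^sub>R (x::'a unitization)"
definition "(uniformity :: ('a unitization \<times> 'a unitization) filter)
  = (INF e\<in>{0 <..}. principal {(x, y). dist x y < e})"
definition "open (U :: 'a unitization set)
  \<longleftrightarrow> (\<forall>x\<in>U. eventually (\<lambda>(x', y). x' = x \<longrightarrow> y \<in> U) uniformity)"

lemma unitization_sel [simp]:
  "scalar 0 = 0" "elt 0 = 0" "scalar 1 = 1" "elt 1 = 0"
  "scalar (x + y) = scalar x + scalar y" "elt (x + y) = elt x + elt y"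
  "scalar (x - y) = scalar x - scalar y" "elt (x - y) = elt x - elt y"
  "scalar (- x) = - scalar x" "elt (- x) = - elt x"
  "scalar (x * y) = scalar x * scalar y"
  "elt (x * y) = scalar x *\<^sub>C elt y + scalar y *\<^sub>C elt x + elt x * elt y"
  "scalar (r *\<^sub>R x) = of_real r * scalar x" "elt (r *\<^sub>R x) = r *\<^sub>R elt x"
  by (simp_all add: zero_unitization_def one_unitization_def plus_unitization_def
    minus_unitization_def uminus_unitization_def times_unitization_def scaleR_unitization_def)

lemma norm_unitization_ge:
  "cmod (scalar x) \<le> norm x" "op_norm (scalar x) (elt x) \<le> norm x" "0 \<le> norm (x :: 'a unitization)"
  by (simp_all add: norm_unitization_def le_max_iff_disj)

lemma norm_elt_le: "norm (elt x) \<le> 2 * norm (x :: 'a unitization)"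
proof -
  have "norm (elt x) = op_norm (scalar x + - scalar x) (elt x + 0)" by (simp add: op_norm_unitize)
  also have "\<dots> \<le> op_norm (scalar x) (elt x) + op_norm (- scalar x) (0::'a)" by (rule op_norm_add)
  also have "\<dots> \<le> norm x + norm x"
    using norm_unitization_ge[of x] op_norm_scalar[of "- scalar x", where 'a='a] by simp
  finally show ?thesis by simp
qed

lemma norm_le_scalar_elt: "norm (x :: 'a unitization) \<le> cmod (scalar x) + norm (elt x)"
  using op_norm_add[of "scalar x" 0 0 "elt x"] op_norm_scalar[of "scalar x", where 'a='a]
  by (simp add: norm_unitization_def op_norm_unitize)

instance
proof
  fix x y z :: "'a unitization" and r s :: real
  show "x + y + z = x + (y + z)" "x + y = y + x" "0 + x = x" "- x + x = 0" "x - y = x + - y"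
    "1 * x = x" "x * 1 = x" "(0::'a unitization) \<noteq> 1"
    by (simp_all add: unitization.expand add.assoc)
      (simp_all add: zero_unitization_def one_unitization_def plus_unitization_def add.commute)
  show "x * y * z = x * (y * z)" "(x + y) * z = x * z + y * z" "x * (y + z) = x * y + x * z"
    by (simp_all add: unitization.expand algebra_simps scaleC_add_right scaleC_add_left
        mult_scaleC_left mult_scaleC_right)
  show "r *\<^sub>R (x + y) = r *\<^sub>R x + r *\<^sub>R y" "(r + s) *\<^sub>R x = r *\<^sub>R x + s *\<^sub>R x"
    "r *\<^sub>R s *\<^sub>R x = (r * s) *\<^sub>R x" "1 *\<^sub>R x = x"
    by (simp_all add: unitization.expand algebra_simps)
  show "r *\<^sub>R x * y = r *\<^sub>R (x * y)" "x * r *\<^sub>R y = r *\<^sub>R (x * y)"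
    by (simp_all add: unitization.expand algebra_simps scaleR_scaleC scaleC_add_right
        mult_scaleC_left mult_scaleC_right)
  show "norm (r *\<^sub>R x) = \<bar>r\<bar> * norm x"
    by (simp add: norm_unitization_def norm_mult max_mult_distrib_left scaleR_scaleC op_norm_scaleC)
  show "(norm x = 0) = (x = 0)"
  proof
    assume "norm x = 0"
    then have "norm (elt x) = 0" "cmod (scalar x) = 0"
      using norm_elt_le[of x] norm_unitization_ge(1)[of x] by auto
    then show "x = 0" by (simp add: unitization.expand)
  next
    assume "x = 0"
    then show "norm x = 0" by (simp add: norm_unitization_def op_norm_unitize)
  qed
  show "norm (x + y) \<le> norm x + norm y"
    using norm_triangle_ineq[of "scalar x" "scalar y"]
      op_norm_add[of "scalar x" "scalar y" "elt x" "elt y"]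
    by (auto simp: norm_unitization_def max_def)
  show "norm (x * y) \<le> norm x * norm y"
  proof -
    have "op_norm (scalar x * scalar y) (elt (x * y))
        \<le> op_norm (scalar x) (elt x) * op_norm (scalar y) (elt y)"
      using op_norm_mult[of "scalar x" "scalar y" "elt y" "elt x"] by simp
    also have "\<dots> \<le> norm x * norm y"
      by (intro mult_mono norm_unitization_ge op_norm_nonneg)
    finally have "op_norm (scalar x * scalar y) (elt (x * y)) \<le> norm x * norm y" .
    moreover have "cmod (scalar x * scalar y) \<le> norm x * norm y"
      unfolding norm_mult by (intro mult_mono norm_unitization_ge norm_ge_zero)
    ultimately show ?thesis by (simp add: norm_unitization_def[of "x * y"])
  qed
  show "norm (1::'a unitization) = 1"
    using op_norm_scalar[of 1, where 'a='a] by (simp add: norm_unitization_def)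
qed (simp_all add: dist_unitization_def sgn_unitization_def uniformity_unitization_def open_unitization_def)

end

lemma bounded_linear_scalar: "bounded_linear (scalar :: 'a::cstar_algebra unitization \<Rightarrow> complex)"
  by (rule bounded_linear_intro[of _ 1]) (simp_all add: norm_unitization_ge scaleR_conv_of_real[where 'a=complex])

lemma bounded_linear_elt: "bounded_linear (elt :: 'a::cstar_algebra unitization \<Rightarrow> 'a)"
  by (rule bounded_linear_intro[of _ 2]) (simp_all add: norm_elt_le mult.commute[of _ 2])

instantiation unitization :: (cstar_algebra) cstar_algebra
begin

definition "c *\<^sub>C x = Unitized (c * scalar x) (c *\<^sub>C elt x)"
definition "x\<^sup>\<star> = Unitized (cnj (scalar x)) ((elt x)\<^sup>\<star>)"

lemma unitization_sel' [simp]: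
  "scalar (c *\<^sub>C x) = c * scalar x" "elt (c *\<^sub>C x) = c *\<^sub>C elt x"
  "scalar (x\<^sup>\<star>) = cnj (scalar x)" "elt (x\<^sup>\<star>) = (elt x)\<^sup>\<star>"
  by (simp_all add: scaleC_unitization_def star_unitization_def)

instance
proof
  fix x y :: "'a unitization" and r :: real and c d :: complex
  show "c *\<^sub>C (x + y) = c *\<^sub>C x + c *\<^sub>C y" "(c + d) *\<^sub>C x = c *\<^sub>C x + d *\<^sub>C x"
    "c *\<^sub>C d *\<^sub>C x = (c * d) *\<^sub>C x" "r *\<^sub>R x = complex_of_real r *\<^sub>C x"
    "(c *\<^sub>C x) * y = c *\<^sub>C (x * y)" "x * (c *\<^sub>C y) = c *\<^sub>C (x * y)"
    by (simp_all add: unitization.expand algebra_simps scaleR_scaleC scaleC_add_right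
        scaleC_add_left mult_scaleC_left mult_scaleC_right)
  show "(x + y)\<^sup>\<star> = x\<^sup>\<star> + y\<^sup>\<star>" "(c *\<^sub>C x)\<^sup>\<star> = cnj c *\<^sub>C x\<^sup>\<star>" "(x * y)\<^sup>\<star> = y\<^sup>\<star> * x\<^sup>\<star>" "(x\<^sup>\<star>)\<^sup>\<star> = x"
    by (simp_all add: unitization.expand star_add star_scaleC star_mult algebra_simps)
  show "norm (c *\<^sub>C x) = cmod c * norm x"
    by (simp add: norm_unitization_def norm_mult op_norm_scaleC max_mult_distrib_left)
  show "norm (x\<^sup>\<star> * x) = (norm x)\<^sup>2"
  proof (rule antisym)
    have ge: "(norm y)\<^sup>2 \<le> norm (y\<^sup>\<star> * y)" for y :: "'a unitization"
    proof -
      have "(op_norm (scalar y) (elt y))\<^sup>2 \<le> norm (y\<^sup>\<star> * y)"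
        using op_norm_cstar[of "scalar y" "elt y"] norm_unitization_ge(2)[of "y\<^sup>\<star> * y"]
        by (simp add: mult.commute)
      moreover have "(cmod (scalar y))\<^sup>2 \<le> norm (y\<^sup>\<star> * y)"
        using norm_unitization_ge(1)[of "y\<^sup>\<star> * y"] by (simp add: norm_mult power2_eq_square)
      ultimately show ?thesis by (simp add: norm_unitization_def[of y] max_def)
    qed
    then show "(norm x)\<^sup>2 \<le> norm (x\<^sup>\<star> * x)" .
    have "(x\<^sup>\<star>)\<^sup>\<star> = x" by (simp add: unitization.expand)
    then have "norm (x\<^sup>\<star>) * norm (x\<^sup>\<star>) \<le> norm x * norm (x\<^sup>\<star>)"
      using ge[of "x\<^sup>\<star>"] norm_mult_ineq[of x "x\<^sup>\<star>"] by (simp add: power2_eq_square)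
    then have "norm (x\<^sup>\<star>) \<le> norm x"
      using norm_ge_zero[of "x\<^sup>\<star>"] norm_ge_zero[of x] by (cases "norm (x\<^sup>\<star>) = 0") auto
    then show "norm (x\<^sup>\<star> * x) \<le> (norm x)\<^sup>2"
      unfolding power2_eq_square
      by (intro order_trans[OF norm_mult_ineq] mult_right_mono norm_ge_zero)
  qed
next
  fix X :: "nat \<Rightarrow> 'a unitization"
  assume X: "Cauchy X"
  obtain l where l: "(\<lambda>n. scalar (X n)) \<longlonglongrightarrow> l"
    using bounded_linear.Cauchy[OF bounded_linear_scalar X] Cauchy_convergent convergent_def by blast
  obtain a where a: "(\<lambda>n. elt (X n)) \<longlonglongrightarrow> a"
    using bounded_linear.Cauchy[OF bounded_linear_elt X] Cauchy_convergent convergent_def by blast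
  have "(\<lambda>n. norm (scalar (X n) - l) + norm (elt (X n) - a)) \<longlonglongrightarrow> 0"
    using tendsto_add[OF tendsto_norm_zero tendsto_norm_zero, of "\<lambda>n. scalar (X n) - l" _ "\<lambda>n. elt (X n) - a"]
      l a by (simp add: LIM_zero_iff)
  then have "(\<lambda>n. X n - Unitized l a) \<longlonglongrightarrow> 0"
    by (rule Lim_null_comparison[rotated])
      (use norm_le_scalar_elt[of "X _ - Unitized l a"] in \<open>auto intro!: always_eventually\<close>)
  then show "convergent X" unfolding convergent_def LIM_zero_iff by blast
qed

end

class unital_cstar_algebra = cstar_algebra + real_normed_algebra_1

instance unitization :: (cstar_algebra) unital_cstar_algebra ..

section \<open>Invertibility and the spectrum in unital algebras\<close>

lemma star_one [simp]: "(1::'a::unital_cstar_algebra)\<^sup>\<star> = 1"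
proof -
  have "(1::'a)\<^sup>\<star> = 1\<^sup>\<star> * (1\<^sup>\<star>)\<^sup>\<star>" by simp
  also have "\<dots> = (1\<^sup>\<star> * 1)\<^sup>\<star>" by (simp only: star_mult)
  finally show ?thesis by simp
qed

lemma star_power: "(x ^ n)\<^sup>\<star> = ((x::'a::unital_cstar_algebra)\<^sup>\<star>) ^ n"
  by (induction n) (simp_all add: star_mult power_commutes)

lemma power_scaleC: "(c *\<^sub>C x) ^ n = c ^ n *\<^sub>C (x::'a::unital_cstar_algebra) ^ n"
  by (induction n) (simp_all add: mult_scaleC_left mult_scaleC_right mult.commute)

definition regular :: "'a::unital_cstar_algebra \<Rightarrow> bool" where
  "regular x \<longleftrightarrow> (\<exists>y. x * y = 1 \<and> y * x = 1)"

definition rinv :: "'a::unital_cstar_algebra \<Rightarrow> 'a" where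
  "rinv x = (THE y. x * y = 1 \<and> y * x = 1)"

lemma left_right_inverse_eq: "z = y" if "x * y = 1" "z * x = (1::'a::unital_cstar_algebra)"
  using that by (metis mult.assoc mult_1_left mult_1_right)

lemma regularI: "x * y = 1 \<Longrightarrow> z * x = 1 \<Longrightarrow> regular x"
  unfolding regular_def using left_right_inverse_eq by metis

lemma rinv_eqI: "x * y = 1 \<Longrightarrow> y * x = 1 \<Longrightarrow> rinv x = y"
  unfolding rinv_def by (rule the_equality) (auto intro: left_right_inverse_eq)

lemma regular_rinv: "regular x \<Longrightarrow> x * rinv x = 1" "regular x \<Longrightarrow> rinv x * x = 1"
  using rinv_eqI unfolding regular_def by blast+

lemma regular_mult: "regular x \<Longrightarrow> regular y \<Longrightarrow> regular (x * y)"
  by (rule regularI[of _ "rinv y * rinv x" "rinv y * rinv x"])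
    (metis (no_types, lifting) mult.assoc mult_1_left mult_1_right regular_rinv)+

lemma regular_scaleC: "c \<noteq> 0 \<Longrightarrow> regular (c *\<^sub>C x) \<longleftrightarrow> regular x"
proof -
  have *: "regular (d *\<^sub>C y)" if "d \<noteq> 0" "regular y" for d and y :: 'a
    using that by (intro regularI[of _ "inverse d *\<^sub>C rinv y" "inverse d *\<^sub>C rinv y"])
      (simp_all add: mult_scaleC_left mult_scaleC_right regular_rinv)
  show "c \<noteq> 0 \<Longrightarrow> ?thesis" using *[of c x] *[of "inverse c" "c *\<^sub>C x"] by auto
qed

lemma neumann:
  fixes x :: "'a::unital_cstar_algebra"
  assumes "norm x < 1"
  shows "regular (1 - x)" and "norm (rinv (1 - x) - 1) \<le> norm x / (1 - norm x)"
proof -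
  let ?s = "\<Sum>n. x ^ n"
  have sm: "summable (\<lambda>n. x ^ n)" by (rule complete_algebra_summable_geometric[OF assms])
  have "?s = 1 + (\<Sum>n. x ^ Suc n)" using suminf_split_head[OF sm] by simp
  moreover have "(\<Sum>n. x ^ Suc n) = x * ?s" using suminf_mult[OF sm, of x] by simp
  moreover have "(\<Sum>n. x ^ Suc n) = ?s * x" using suminf_mult2[OF sm, of x] by (simp add: power_commutes)
  ultimately have *: "(1 - x) * ?s = 1" "?s * (1 - x) = 1" "?s = 1 + x * ?s" by (simp_all add: algebra_simps)
  then show "regular (1 - x)" by (blast intro: regularI)
  from *(3) have x: "?s - 1 = x * ?s" by (simp add: diff_eq_eq add.commute)
  have "norm ?s \<le> 1 + norm x * norm ?s"
    using norm_triangle_ineq[of 1 "x * ?s"] norm_mult_ineq[of x ?s] *(3) by simp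
  then have "norm ?s \<le> 1 / (1 - norm x)" using assms by (simp add: field_simps)
  then have "norm x * norm ?s \<le> norm x * (1 / (1 - norm x))" by (rule mult_left_mono) simp
  then have "norm (?s - 1) \<le> norm x / (1 - norm x)"
    unfolding x using norm_mult_ineq[of x ?s] by (simp add: mult.commute)
  then show "norm (rinv (1 - x) - 1) \<le> norm x / (1 - norm x)" using rinv_eqI[OF *(1,2)] by simp
qed

lemma regular_perturb:
  assumes "regular x" "norm d * norm (rinv x) < 1"
  shows "regular (x - d)"
proof -
  have "norm (d * rinv x) < 1" using norm_mult_ineq[of d "rinv x"] assms(2) by linarith
  then have "regular ((1 - d * rinv x) * x)" by (intro regular_mult neumann assms(1))
  moreover have "(1 - d * rinv x) * x = x - d"
    by (simp add: algebra_simps regular_rinv[OF assms(1)])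
  ultimately show ?thesis by simp
qed

definition spec :: "'a::unital_cstar_algebra \<Rightarrow> complex set" where
  "spec a = {z. \<not> regular (z *\<^sub>C 1 - a)}"

lemma spec_norm_le: "z \<in> spec a \<Longrightarrow> cmod z \<le> norm a"
proof (rule ccontr)
  assume z: "z \<in> spec a" and "\<not> cmod z \<le> norm a"
  then have n: "norm a < cmod z" "z \<noteq> 0" by auto
  then have n: "norm (inverse z *\<^sub>C a) < 1" "z \<noteq> 0"
    by (simp_all add: norm_scaleC norm_inverse norm_divide field_simps)
  have "z *\<^sub>C 1 - a = z *\<^sub>C (1 - inverse z *\<^sub>C a)" using n by (simp add: scaleC_diff_right)
  then have "regular (z *\<^sub>C 1 - a)" using neumann(1)[OF n(1)] n(2) regular_scaleC by metis
  then show False using z by (simp add: spec_def)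
qed

lemma compact_spec: "compact (spec a)"
proof -
  have "open (- spec a)"
    unfolding open_dist
  proof
    fix z assume z: "z \<in> - spec a"
    let ?R = "rinv (z *\<^sub>C 1 - a)"
    have r: "regular (z *\<^sub>C 1 - a)" using z by (simp add: spec_def)
    have "w \<in> - spec a" if "dist w z < 1 / (norm ?R + 1)" for w
    proof -
      have "norm ((z - w) *\<^sub>C (1::'a)) * norm ?R < 1"
      proof -
        have "0 < norm ?R + 1" by (simp add: add_nonneg_pos)
        then have "cmod (z - w) * (norm ?R + 1) < 1"
          using that by (simp add: pos_less_divide_eq dist_norm norm_minus_commute)
        then have "cmod (z - w) * norm ?R + cmod (z - w) < 1" by (simp only: distrib_left mult_1_right)
        then show ?thesis using norm_ge_zero[of "z - w"] by (simp add: norm_scaleC del: norm_ge_zero)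
      qed
      from regular_perturb[OF r this] show ?thesis
        by (simp add: spec_def scaleC_diff_left)
    qed
    then show "\<exists>e>0. \<forall>w. dist w z < e \<longrightarrow> w \<in> - spec a"
      by (intro exI[of _ "1 / (norm ?R + 1)"]) (auto intro: add_nonneg_pos)
  qed
  then have "closed (spec a)" by (simp add: closed_def)
  moreover have "bounded (spec a)" using spec_norm_le by (auto intro!: boundedI)
  ultimately show ?thesis by (simp add: compact_eq_bounded_closed)
qed

lemma resolvent_identity:
  assumes "regular x" "regular y"
  shows "rinv x - rinv y = rinv x * (y - x) * rinv y"
proof -
  have "rinv x * (y - x) * rinv y = rinv x * (y * rinv y) - (rinv x * x) * rinv y"
    by (simp only: left_diff_distrib right_diff_distrib mult.assoc)
  then show ?thesis by (simp add: regular_rinv assms)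
qed

text \<open>
  The partial fraction \<open>1/(1 - x\<^sup>2) = (1/(1 - x) + 1/(1 + x))/2\<close>, which is the doubling step of the
  argument for the spectral radius.
\<close>

lemma rinv_average:
  assumes "regular (1 - x)" "regular (1 + x)"
  shows "rinv ((1 - x) * (1 + x)) = (1/2) *\<^sub>R (rinv (1 - x) + rinv (1 + x))"
proof (rule rinv_eqI)
  let ?P = "rinv (1 - x)" and ?Q = "rinv (1 + x)"
  have comm: "(1 - x) * (1 + x) = (1 + x) * (1 - x)" by (simp add: algebra_simps)
  have "(1 + x) * ((1 - x) * ?P) = 1 + x" "(1 - x) * ((1 + x) * ?Q) = 1 - x"
    "(?P * (1 - x)) * (1 + x) = 1 + x" "(?Q * (1 + x)) * (1 - x) = 1 - x"
    by (simp_all only: regular_rinv[OF assms(1)] regular_rinv[OF assms(2)] mult_1_left mult_1_right)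
  then have "(1 - x) * (1 + x) * ?P = 1 + x" "(1 - x) * (1 + x) * ?Q = 1 - x"
    "?P * ((1 - x) * (1 + x)) = 1 + x" "?Q * ((1 - x) * (1 + x)) = 1 - x"
    by (metis comm mult.assoc)+
  then have "(1 - x) * (1 + x) * (?P + ?Q) = 2" "(?P + ?Q) * ((1 - x) * (1 + x)) = 2"
    by (simp_all only: distrib_left[of _ ?P] distrib_right[of ?P]) simp_all
  moreover have "(1/2) *\<^sub>R (2::'a) = 1"
    by (simp only: one_add_one[where 'a='a, symmetric] scaleR_add_right scaleR_add_left[symmetric]) simp
  ultimately show "(1 - x) * (1 + x) * ((1/2) *\<^sub>R (?P + ?Q)) = 1"
    "((1/2) *\<^sub>R (?P + ?Q)) * ((1 - x) * (1 + x)) = 1"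
    by (simp_all only: mult_scaleR_left mult_scaleR_right)
qed

text \<open>
  Let the resolvent \<open>u \<mapsto> (1 - ua)\<inverse>\<close> exist on a disc and be Lipschitz there. Then the inverses of
  \<open>1 - (ua)\<^sup>n\<close>, with \<open>n\<close> a power of two, exist too and satisfy the same radial estimate, uniformly in
  \<open>n\<close>: passing from \<open>n\<close> to \<open>2n\<close> replaces the inverse by an average of two inverses at points of the
  same modulus.
\<close>

lemma dyadic_resolvent:
  fixes a :: "'a::unital_cstar_algebra"
  assumes reg: "\<And>u. cmod u \<le> r \<Longrightarrow> regular (1 - u *\<^sub>C a)"
    and lip: "\<And>u v. cmod u \<le> r \<Longrightarrow> cmod v \<le> r \<Longrightarrow>
        norm (rinv (1 - u *\<^sub>C a) - rinv (1 - v *\<^sub>C a)) \<le> L * cmod (u - v)"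
    and s: "0 \<le> s" "s \<le> 1" and L: "0 \<le> L"
  shows "cmod u \<le> r \<Longrightarrow> regular (1 - (u *\<^sub>C a) ^ 2 ^ k) \<and>
      norm (rinv (1 - (u *\<^sub>C a) ^ 2 ^ k) - rinv (1 - ((of_real s * u) *\<^sub>C a) ^ 2 ^ k)) \<le> L * r * (1 - s)"
proof (induction k arbitrary: u)
  case 0
  have "u - of_real s * u = of_real (1 - s) * u" by (simp add: algebra_simps)
  then have c: "cmod (u - of_real s * u) = (1 - s) * cmod u"
    using s by (simp only: norm_mult norm_of_real)
  have su: "cmod (of_real s * u) \<le> r"
    using s 0 mult_left_le_one_le[of "cmod u" s] by (simp add: norm_mult)
  have "L * cmod (u - of_real s * u) \<le> L * ((1 - s) * r)"
    unfolding c using s 0 L by (intro mult_left_mono) auto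
  then show ?case using reg[OF 0] lip[OF 0 su] by (simp add: algebra_simps)
next
  case (Suc k)
  define \<zeta> where "\<zeta> = cis (pi / 2 ^ k)"
  have \<zeta>: "\<zeta> ^ 2 ^ k = -1" "cmod \<zeta> = 1" by (simp_all add: \<zeta>_def Complex.DeMoivre)
  have su: "cmod (of_real s * u) \<le> r"
    using s Suc.prems mult_left_le_one_le[of "cmod u" s] by (simp add: norm_mult)
  \<comment> \<open>averaging over the two square roots of \<open>x\<^sup>2\<close>\<close>
  have avg: "rinv (1 - (v *\<^sub>C a) ^ 2 ^ Suc k) =
      (1/2) *\<^sub>R (rinv (1 - (v *\<^sub>C a) ^ 2 ^ k) + rinv (1 - ((\<zeta> * v) *\<^sub>C a) ^ 2 ^ k))"
    and reg': "regular (1 - (v *\<^sub>C a) ^ 2 ^ Suc k)" if v: "cmod v \<le> r" for v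
  proof -
    let ?x = "(v *\<^sub>C a) ^ 2 ^ k"
    have m: "((\<zeta> * v) *\<^sub>C a) ^ 2 ^ k = - ?x"
      by (simp add: power_scaleC power_mult_distrib \<zeta>)
    have sq: "1 - (v *\<^sub>C a) ^ 2 ^ Suc k = (1 - ?x) * (1 + ?x)"
    proof -
      have "(v *\<^sub>C a) ^ 2 ^ Suc k = ?x * ?x" by (simp only: power_Suc mult_2 power_add)
      then show ?thesis by (simp add: algebra_simps del: power_Suc)
    qed
    have r1: "regular (1 - ?x)" using Suc.IH[OF v] by simp
    have r2: "regular (1 + ?x)" using Suc.IH[of "\<zeta> * v"] v m by (simp add: norm_mult \<zeta>)
    show "regular (1 - (v *\<^sub>C a) ^ 2 ^ Suc k)" unfolding sq by (rule regular_mult[OF r1 r2])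
    show "rinv (1 - (v *\<^sub>C a) ^ 2 ^ Suc k) =
      (1/2) *\<^sub>R (rinv (1 - (v *\<^sub>C a) ^ 2 ^ k) + rinv (1 - ((\<zeta> * v) *\<^sub>C a) ^ 2 ^ k))"
      unfolding sq m using rinv_average[OF r1 r2] by simp
  qed
  let ?R = "\<lambda>v. rinv (1 - (v *\<^sub>C a) ^ 2 ^ k)"
  have "rinv (1 - (u *\<^sub>C a) ^ 2 ^ Suc k) - rinv (1 - ((of_real s * u) *\<^sub>C a) ^ 2 ^ Suc k)
      = (1/2) *\<^sub>R ((?R u - ?R (of_real s * u)) + (?R (\<zeta> * u) - ?R (of_real s * (\<zeta> * u))))"
    unfolding avg[OF Suc.prems] avg[OF su] by (simp add: algebra_simps)
  also have "norm \<dots> \<le> (1/2) * (L * r * (1 - s) + L * r * (1 - s))"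
    unfolding norm_scaleR
    using Suc.IH[OF Suc.prems] Suc.IH[of "\<zeta> * u"] Suc.prems
    by (intro mult_mono norm_triangle_mono) (auto simp: norm_mult \<zeta>)
  finally show ?case using reg'[OF Suc.prems] by simp
qed

text \<open>
  Rickart's elementary route to the spectral radius formula, without holomorphic functions. If the
  spectrum missed the circle of radius \<open>\<parallel>a\<parallel>\<close>, the resolvent would be Lipschitz on the closed disc of
  radius \<open>r = 1/\<parallel>a\<parallel>\<close>. For \<open>s < 1\<close> the powers \<open>(sra)\<^sup>n\<close> tend to \<open>0\<close>, so \<open>(1 - (sra)\<^sup>n)\<inverse>\<close> is close to \<open>1\<close>;
  by the uniform radial estimate so is \<open>(1 - (ra)\<^sup>n)\<inverse>\<close>. This contradicts \<open>\<parallel>(ra)\<^sup>n\<parallel> = 1\<close>.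
\<close>

lemma spec_attains_norm:
  fixes a :: "'a::unital_cstar_algebra"
  assumes pw: "\<And>k. norm (a ^ 2 ^ k) = norm a ^ 2 ^ k" and "a \<noteq> 0"
  shows "\<exists>z\<in>spec a. cmod z = norm a"
proof (rule ccontr)
  assume no: "\<not> ?thesis"
  define r where "r = 1 / norm a"
  have r: "r > 0" "r * norm a = 1" using assms(2) by (auto simp: r_def)
  have reg: "regular (1 - u *\<^sub>C a)" if u: "cmod u \<le> r" for u
  proof (cases "u = 0")
    case False
    have "norm a \<le> cmod (inverse u)"
      using u False assms(2) by (simp add: r_def norm_inverse norm_divide field_simps)
    then have "inverse u \<notin> spec a" using spec_norm_le[of "inverse u" a] no by force
    then have "regular (u *\<^sub>C (inverse u *\<^sub>C 1 - a))"
      using False by (simp add: spec_def regular_scaleC)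
    then show ?thesis using False by (simp add: scaleC_diff_right)
  qed (auto intro: regularI[of _ 1 1])
  let ?G = "\<lambda>u. rinv (1 - u *\<^sub>C a)"
  have diff: "norm (?G u - ?G v) \<le> norm (?G u) * norm a * norm (?G v) * cmod (u - v)"
    if "cmod u \<le> r" "cmod v \<le> r" for u v
  proof -
    have "?G u - ?G v = (u - v) *\<^sub>C (?G u * a * ?G v)"
      unfolding resolvent_identity[OF reg[OF that(1)] reg[OF that(2)]]
      by (simp add: scaleC_diff_left[symmetric] mult_scaleC_left mult_scaleC_right)
    moreover have "norm (?G u * a * ?G v) \<le> norm (?G u) * norm a * norm (?G v)"
      by (rule order_trans[OF norm_mult_ineq]) (simp add: mult_right_mono norm_mult_ineq)
    ultimately show ?thesis
      using mult_left_mono[of "norm (?G u * a * ?G v)" "norm (?G u) * norm a * norm (?G v)" "cmod (u - v)"]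
      by (simp add: norm_scaleC mult.commute[of _ "cmod (u - v)"])
  qed
  have "continuous_on (cball 0 r) ?G"
    unfolding continuous_on_iff
  proof (intro ballI allI impI)
    fix v e assume v: "v \<in> cball (0::complex) r" and e: "(e::real) > 0"
    define M where "M = norm a * norm (?G v) + 1"
    have M: "M \<ge> 1" by (simp add: M_def)
    define d where "d = min (1 / (2 * M)) (e / (4 * M * (norm (?G v) + 1)))"
    have d: "d > 0" unfolding d_def using M e by (auto intro!: divide_pos_pos add_nonneg_pos mult_pos_pos)
    have "dist (?G u) (?G v) < e" if u: "u \<in> cball 0 r" "dist u v < d" for u
    proof -
      have *: "norm (?G u - ?G v) \<le> norm (?G u) * (M * cmod (u - v))"
      proof -
        have "norm (?G u) * norm a * norm (?G v) * cmod (u - v) = norm (?G u) * ((M - 1) * cmod (u - v))"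
          by (simp add: M_def)
        also have "\<dots> \<le> norm (?G u) * (M * cmod (u - v))"
          by (intro mult_left_mono mult_right_mono) auto
        finally show ?thesis using diff[of u v] u v by simp
      qed
      have h: "M * cmod (u - v) \<le> 1/2"
        using u(2) M by (simp add: d_def dist_norm field_simps)
      have "norm (?G u) \<le> norm (?G v) + norm (?G u - ?G v)"
        using norm_triangle_ineq[of "?G v" "?G u - ?G v"] by simp
      also have "norm (?G u - ?G v) \<le> norm (?G u) * (1/2)"
        by (rule order_trans[OF *]) (intro mult_left_mono h norm_ge_zero)
      finally have G: "norm (?G u) \<le> 2 * (norm (?G v) + 1)" by simp
      have "norm (?G u - ?G v) \<le> 2 * (norm (?G v) + 1) * (M * cmod (u - v))"
        by (rule order_trans[OF *]) (use G M in \<open>intro mult_right_mono, auto\<close>)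
      also have "\<dots> \<le> 2 * (norm (?G v) + 1) * (M * (e / (4 * M * (norm (?G v) + 1))))"
        using u(2) M by (intro mult_left_mono) (auto simp: d_def dist_norm)
      also have "\<dots> = e / 2"
      proof -
        have "norm (?G v) + 1 > 0" by (simp add: add_nonneg_pos)
        then show ?thesis using M by (simp add: divide_simps)
      qed
      finally show ?thesis using e by (simp add: dist_norm)
    qed
    then show "\<exists>d>0. \<forall>u\<in>cball 0 r. dist u v < d \<longrightarrow> dist (?G u) (?G v) < e" using d by blast
  qed
  then have "bounded (?G ` cball 0 r)"
    by (intro compact_imp_bounded compact_continuous_image compact_cball)
  then obtain C where C: "C > 0" "\<And>u. cmod u \<le> r \<Longrightarrow> norm (?G u) \<le> C"
    unfolding bounded_pos by (auto simp: dist_norm)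
  define L where "L = C * norm a * C"
  have L: "L > 0" using C assms(2) by (simp add: L_def)
  have lip: "norm (?G u - ?G v) \<le> L * cmod (u - v)" if "cmod u \<le> r" "cmod v \<le> r" for u v
    by (rule order_trans[OF diff[OF that]]) (unfold L_def, intro mult_right_mono mult_mono C that, use C in auto)
  define s where "s = max 0 (1 - 1 / (8 * L * r))"
  have s: "0 \<le> s" "s < 1" "L * r * (1 - s) \<le> 1/8"
    using L r(1) by (auto simp: s_def max_def field_simps)
  have "(\<lambda>n. s ^ n) \<longlonglongrightarrow> 0" using s by (intro LIMSEQ_power_zero) auto
  then have "eventually (\<lambda>n. s ^ n < 1/16) sequentially" by (rule order_tendstoD) simp
  then obtain N where N: "\<And>n. n \<ge> N \<Longrightarrow> s ^ n < 1/16" by (auto simp: eventually_sequentially)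
  define X where "X = (of_real r *\<^sub>C a) ^ 2 ^ N"
  define Y where "Y = ((of_real s * of_real r) *\<^sub>C a) ^ 2 ^ N"
  have nX: "norm X = 1"
    using r pw[of N] by (simp add: X_def power_scaleC norm_scaleC norm_power power_mult_distrib[symmetric])
  have "Y = of_real (s ^ 2 ^ N) *\<^sub>C X"
    by (simp add: X_def Y_def power_scaleC power_mult_distrib)
  then have nY: "norm Y < 1/16"
    using N[of "2 ^ N"] nX s(1) less_exp[of N] by (simp add: norm_scaleC norm_power)
  have dy: "regular (1 - X) \<and> norm (rinv (1 - X) - rinv (1 - Y)) \<le> L * r * (1 - s)"
    unfolding X_def Y_def
    by (rule dyadic_resolvent[OF reg lip]) (use s L r in auto)
  have "norm (rinv (1 - Y) - 1) \<le> norm Y / (1 - norm Y)" using nY by (intro neumann) simp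
  also have "\<dots> \<le> 1/8" using nY by (simp add: divide_simps)
  finally have Y1: "norm (rinv (1 - Y) - 1) \<le> 1/8" .
  have "norm (rinv (1 - X) - 1) \<le> norm (rinv (1 - X) - rinv (1 - Y)) + norm (rinv (1 - Y) - 1)"
    using norm_triangle_ineq[of "rinv (1 - X) - rinv (1 - Y)" "rinv (1 - Y) - 1"] by simp
  then have X1: "norm (rinv (1 - X) - 1) \<le> 1/4" using dy Y1 s(3) by linarith
  have "X = (1 - X) * (rinv (1 - X) - 1)"
    using dy by (simp add: right_diff_distrib regular_rinv)
  then have "norm X \<le> norm (1 - X) * norm (rinv (1 - X) - 1)" using norm_mult_ineq by metis
  also have "\<dots> \<le> 2 * (1/4)"
    using norm_triangle_ineq4[of 1 X] nX X1 by (intro mult_mono) auto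
  finally show False using nX by simp
qed

lemma norm_power_selfadjoint:
  fixes a :: "'a::unital_cstar_algebra"
  assumes "a\<^sup>\<star> = a" shows "norm (a ^ 2 ^ k) = norm a ^ 2 ^ k"
proof (induction k)
  case (Suc k)
  have "a ^ 2 ^ Suc k = (a ^ 2 ^ k)\<^sup>\<star> * a ^ 2 ^ k"
    by (simp add: star_power assms power_add[symmetric] mult_2)
  then show ?case using Suc by (simp add: cstar_identity power_mult[symmetric] mult.commute)
qed simp

lemma spec_selfadjoint_attains_norm:
  "a\<^sup>\<star> = a \<Longrightarrow> a \<noteq> 0 \<Longrightarrow> \<exists>z\<in>spec a. cmod z = norm (a::'a::unital_cstar_algebra)"
  by (rule spec_attains_norm) (auto intro: norm_power_selfadjoint)

lemma spec_zero: "0 \<in> spec (0::'a::unital_cstar_algebra)"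
  by (auto simp: spec_def regular_def)

lemma spec_selfadjoint_nonempty: "a\<^sup>\<star> = a \<Longrightarrow> spec (a::'a::unital_cstar_algebra) \<noteq> {}"
  using spec_selfadjoint_attains_norm[of a] spec_zero by (cases "a = 0") auto

lemma spec_shift: "z \<in> spec (a + w *\<^sub>C 1) \<longleftrightarrow> z - w \<in> spec a"
  by (simp add: spec_def scaleC_diff_left algebra_simps)

text \<open>
  Shifting by \<open>it\<close> moves a spectral value \<open>z\<close> to one of modulus at least \<open>\<bar>Im z + t\<bar>\<close>, while the
  C*-identity gives \<open>\<parallel>a + it\<parallel>\<^sup>2 \<le> \<parallel>a\<parallel>\<^sup>2 + t\<^sup>2\<close>. Letting \<open>t\<close> vary leaves no room for \<open>Im z \<noteq> 0\<close>.
\<close>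

lemma spec_selfadjoint_real:
  fixes a :: "'a::unital_cstar_algebra"
  assumes a: "a\<^sup>\<star> = a" and z: "z \<in> spec a"
  shows "Im z = 0"
proof (rule ccontr)
  assume im: "Im z \<noteq> 0"
  have bound: "(Im z + t)\<^sup>2 \<le> (norm a)\<^sup>2 + t\<^sup>2" for t :: real
  proof -
    let ?b = "a + (\<i> * of_real t) *\<^sub>C 1"
    have "z + \<i> * of_real t \<in> spec ?b" using z by (simp add: spec_shift)
    then have "(cmod (z + \<i> * of_real t))\<^sup>2 \<le> (norm ?b)\<^sup>2" by (intro power_mono spec_norm_le) auto
    also have "\<dots> = norm (?b\<^sup>\<star> * ?b)" by (simp add: cstar_identity)
    also have "?b\<^sup>\<star> * ?b = a * a + (t\<^sup>2) *\<^sub>R 1"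
      using a by (simp add: star_add star_scaleC algebra_simps mult_scaleC_left mult_scaleC_right
          scaleC_diff_right scaleC_add_right
          scaleC_of_real[symmetric] power2_eq_square)
    also have "norm \<dots> \<le> norm a * norm a + t\<^sup>2"
      using norm_triangle_ineq[of "a * a" "(t\<^sup>2) *\<^sub>R 1"] norm_mult_ineq[of a a] by simp
    finally have "(cmod (z + \<i> * of_real t))\<^sup>2 \<le> (norm a)\<^sup>2 + t\<^sup>2" by (simp add: power2_eq_square)
    moreover have "(cmod (z + \<i> * of_real t))\<^sup>2 = (Re z)\<^sup>2 + (Im z + t)\<^sup>2"
      by (simp add: cmod_power2)
    ultimately show ?thesis using zero_le_power2[of "Re z"] by linarith
  qed
  have "2 * Im z * t \<le> (norm a)\<^sup>2" for t
  proof -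
    have "(Im z)\<^sup>2 + 2 * Im z * t \<le> (norm a)\<^sup>2" using bound[of t] by (simp add: power2_sum)
    then show ?thesis using zero_le_power2[of "Im z"] by linarith
  qed
  from this[of "((norm a)\<^sup>2 + 1) / (2 * Im z)"] show False using im by simp
qed

section \<open>Polynomial and continuous functional calculus\<close>

definition peval :: "complex poly \<Rightarrow> 'a::unital_cstar_algebra \<Rightarrow> 'a" where
  "peval p a = fold_coeffs (\<lambda>c y. c *\<^sub>C 1 + a * y) p 0"

lemma peval_0 [simp]: "peval 0 a = 0" by (simp add: peval_def)

lemma peval_pCons [simp]: "peval (pCons c p) a = c *\<^sub>C 1 + a * peval p a"
  by (cases "p = 0 \<and> c = 0") (auto simp: peval_def)

lemma peval_add: "peval (p + q) a = peval p a + peval q a"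
  by (induction p q rule: poly_induct2) (simp_all add: scaleC_add_left algebra_simps)

lemma peval_smult: "peval (smult c p) a = c *\<^sub>C peval p a"
  by (induction p) (simp_all add: scaleC_add_right mult_scaleC_right)

lemma peval_diff: "peval (p - q) a = peval p a - peval q a"
  using peval_add[of p "- q" a] peval_smult[of "- 1" q a] by simp

lemma peval_mult: "peval (p * q) a = peval p a * peval q a"
  by (induction p) (simp_all add: peval_add peval_smult mult_scaleC_left distrib_right mult.assoc)

lemma peval_star: "a\<^sup>\<star> = a \<Longrightarrow> (peval p a)\<^sup>\<star> = peval (map_poly cnj p) a"
proof (induction p)
  case (pCons c p)
  have "a * peval q a = peval q a * a" for q
    using peval_mult[of "[:0,1:]" q a] peval_mult[of q "[:0,1:]" a] by (simp add: mult.commute)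
  then show ?case using pCons by (simp add: map_poly_pCons star_add star_mult star_scaleC)
qed simp

lemma poly_map_cnj: "poly (map_poly cnj p) z = cnj (poly p (cnj z))"
  by (induction p) (simp_all add: map_poly_pCons)

text \<open>
  Split \<open>p\<close> into linear factors; a product of regular elements is regular, so some factor \<open>a - z\<close> is
  not.
\<close>

lemma not_regular_peval:
  fixes p :: "complex poly"
  assumes "p \<noteq> 0" "\<not> regular (peval p a)"
  shows "\<exists>z\<in>spec a. poly p z = 0"
  using assms
proof (induction "degree p" arbitrary: p)
  case 0
  then obtain c where c: "p = [:c:]" using degree_eq_zeroE by metis
  with 0 have "regular (c *\<^sub>C (1::'a))" by (subst regular_scaleC) (auto intro: regularI[of _ 1 1])
  then show ?case using 0 c by simp
next
  case (Suc n)
  have "\<exists>z. poly p z = 0"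
    using fundamental_theorem_of_algebra[of p] Suc.hyps(2) constant_degree[of p] by simp
  then obtain z q where z: "poly p z = 0" and q: "p = [:- z, 1:] * q"
    using poly_eq_0_iff_dvd by (metis dvdE)
  show ?case
  proof (cases "z \<in> spec a")
    case False
    then have r: "regular (z *\<^sub>C 1 - a)" by (simp add: spec_def)
    have "regular (peval [:- z, 1:] a)"
      using r regular_scaleC[of "- 1" "z *\<^sub>C 1 - a"] by (simp add: algebra_simps)
    then have "\<not> regular (peval q a)"
      using Suc.prems(2) regular_mult unfolding q peval_mult by blast
    moreover have "q \<noteq> 0" using Suc.prems q by auto
    moreover from this have "n = degree q" using Suc.hyps(2) unfolding q by (subst (asm) degree_mult_eq) auto
    ultimately obtain w where "w \<in> spec a" "poly q w = 0" using Suc.hyps(1) by blast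
    then show ?thesis unfolding q by auto
  qed (use z in auto)
qed

lemma spec_peval: 
  fixes a :: "'a::unital_cstar_algebra"
  assumes "w \<in> spec (peval p a)" "spec a \<noteq> {}"
  shows "\<exists>z\<in>spec a. w = poly p z"
proof -
  have "\<not> regular (peval ([:w:] - p) a)" using assms by (simp add: spec_def peval_diff)
  then show ?thesis
    using not_regular_peval[of "[:w:] - p" a] assms(2) by (cases "[:w:] - p = 0") auto
qed

text \<open>
  By the C*-identity it is enough to treat the self-adjoint element \<open>p(a)\<^sup>\<star>p(a)\<close>, whose norm is attained
  on its spectrum, and the spectrum consists of values of \<open>\<bar>p\<bar>\<^sup>2\<close> on the spectrum of \<open>a\<close>.
\<close>

lemma norm_peval_le:
  fixes a :: "'a::unital_cstar_algebra"
  assumes a: "a\<^sup>\<star> = a" and K: "\<And>z. z \<in> spec a \<Longrightarrow> cmod (poly p z) \<le> K"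
  shows "norm (peval p a) \<le> K"
proof -
  \<comment> \<open>\<open>K\<close> is nonnegative because the spectrum is nonempty\<close>
  obtain z0 where "z0 \<in> spec a" using spec_selfadjoint_nonempty[OF a] by blast
  then have K0: "0 \<le> K" using K[of z0] norm_ge_zero[of "poly p z0"] by linarith
  let ?b = "peval (map_poly cnj p * p) a"
  have b: "?b = (peval p a)\<^sup>\<star> * peval p a" by (simp add: peval_mult peval_star[OF a])
  then have "?b\<^sup>\<star> = ?b" by (simp add: star_mult)
  have "norm ?b \<le> K\<^sup>2"
  proof (cases "?b = 0")
    case False
    then obtain w where w: "w \<in> spec ?b" "cmod w = norm ?b"
      using spec_selfadjoint_attains_norm[OF \<open>?b\<^sup>\<star> = ?b\<close>] by blast
    then obtain z where z: "z \<in> spec a" "w = poly (map_poly cnj p * p) z"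
      using spec_peval spec_selfadjoint_nonempty[OF a] by blast
    have "cnj z = z" using spec_selfadjoint_real[OF a z(1)] by (simp add: complex_eq_iff)
    then have "cmod w = (cmod (poly p z))\<^sup>2"
      by (simp add: z(2) poly_map_cnj norm_mult power2_eq_square)
    also have "\<dots> \<le> K\<^sup>2" by (intro power_mono K z(1)) auto
    finally show ?thesis using w(2) by simp
  qed simp
  then have "(norm (peval p a))\<^sup>2 \<le> K\<^sup>2" unfolding b cstar_identity .
  then show ?thesis using K0 by (rule power2_le_imp_le)
qed

lemma real_poly_as_complex_poly:
  assumes "real_polynomial_function g"
  shows "\<exists>q. \<forall>t. poly q (complex_of_real t) = of_real (g t)"
proof -
  obtain c n where "g = (\<lambda>x. \<Sum>i\<le>n. c i * x ^ i)"
    using assms real_polynomial_function_iff_sum by blast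
  then show ?thesis
    by (intro exI[of _ "\<Sum>i\<le>n. monom (of_real (c i)) i"]) (simp add: poly_sum poly_monom)
qed

lemma complex_poly_approximation:
  assumes K: "compact K" "\<And>z. z \<in> K \<Longrightarrow> Im z = 0" and f: "continuous_on K f" and e: "e > (0::real)"
  shows "\<exists>p. \<forall>z\<in>K. cmod (f z - poly p z) < e"
proof -
  have K_Re: "z = of_real (Re z)" if "z \<in> K" for z using K(2)[OF that] by (simp add: complex_eq_iff)
  have im: "complex_of_real ` Re ` K = K" using K_Re by (force simp: image_image)
  have S: "compact (Re ` K)" using K(1) by (intro compact_continuous_image continuous_intros)
  have c: "continuous_on (Re ` K) (\<lambda>t. f (of_real t))"
    by (rule continuous_on_compose2[OF f]) (use im in \<open>auto intro!: continuous_intros\<close>)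
  obtain g1 where g1: "real_polynomial_function g1" "\<And>t. t \<in> Re ` K \<Longrightarrow> \<bar>Re (f (of_real t)) - g1 t\<bar> < e/2"
    using Stone_Weierstrass_real_polynomial_function[OF S continuous_on_Re[OF c], of "e/2"] e by auto
  obtain g2 where g2: "real_polynomial_function g2" "\<And>t. t \<in> Re ` K \<Longrightarrow> \<bar>Im (f (of_real t)) - g2 t\<bar> < e/2"
    using Stone_Weierstrass_real_polynomial_function[OF S continuous_on_Im[OF c], of "e/2"] e by auto
  obtain q1 q2 where q: "\<And>t. poly q1 (complex_of_real t) = of_real (g1 t)"
    "\<And>t. poly q2 (complex_of_real t) = of_real (g2 t)"
    using real_poly_as_complex_poly g1(1) g2(1) by meson
  have "cmod (f z - poly (q1 + smult \<i> q2) z) < e" if z: "z \<in> K" for z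
  proof -
    let ?t = "Re z"
    have zt: "z = of_real ?t" by (rule K_Re[OF z])
    have "f z - poly (q1 + smult \<i> q2) z
        = of_real (Re (f z) - g1 ?t) + \<i> * of_real (Im (f z) - g2 ?t)"
      by (subst (2) zt) (simp add: q complex_eq_iff)
    also have "cmod \<dots> \<le> \<bar>Re (f z) - g1 ?t\<bar> + \<bar>Im (f z) - g2 ?t\<bar>"
      by (rule order_trans[OF norm_triangle_ineq]) (simp add: norm_mult del: of_real_diff)
    also have "\<dots> < e" using g1(2)[of ?t] g2(2)[of ?t] zt z by auto
    finally show ?thesis .
  qed
  then show ?thesis by blast
qed

text \<open>
  \<open>f(a)\<close> for self-adjoint \<open>a\<close>, described by its distances to all \<open>p(a)\<close> with \<open>p\<close> a polynomial. In this
  form neither existence nor uniqueness depends on the choice of an approximating sequence.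
\<close>

definition cfc :: "(complex \<Rightarrow> complex) \<Rightarrow> 'a::unital_cstar_algebra \<Rightarrow> 'a" where
  "cfc f a = (THE y. \<forall>p K. (\<forall>z\<in>spec a. cmod (f z - poly p z) \<le> K) \<longrightarrow> norm (y - peval p a) \<le> K)"

lemma poly_sequence:
  fixes a :: "'a::unital_cstar_algebra"
  assumes a: "a\<^sup>\<star> = a" and f: "continuous_on (spec a) f"
  shows "\<exists>p. uniform_limit (spec a) (\<lambda>n. poly (p n)) f sequentially"
proof -
  have "\<exists>p. \<forall>z\<in>spec a. cmod (f z - poly p z) < 1 / (n + 1)" for n :: nat
    by (rule complex_poly_approximation[OF compact_spec spec_selfadjoint_real[OF a] f]) simp_all
  then have "\<forall>n. \<exists>p. \<forall>z\<in>spec a. cmod (f z - poly p z) < 1 / (real n + 1)" by (simp add: add.commute)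
  then obtain p where p: "\<And>n z. z \<in> spec a \<Longrightarrow> cmod (f z - poly (p n) z) < 1 / (real n + 1)"
    unfolding choice_iff by blast
  have "uniform_limit (spec a) (\<lambda>n. poly (p n)) f sequentially"
    unfolding uniform_limit_sequentially_iff
  proof (intro allI impI)
    fix e :: real assume "e > 0"
    then obtain N where N: "inverse (real (Suc N)) < e" using reals_Archimedean by blast
    have "dist (poly (p n) z) (f z) < e" if "n \<ge> N" "z \<in> spec a" for n z
    proof -
      have "1 / (real n + 1) \<le> inverse (real (Suc N))" using that(1) by (simp add: field_simps)
      then show ?thesis using p[OF that(2), of n] N by (simp add: dist_norm norm_minus_commute)
    qed
    then show "\<exists>N. \<forall>n\<ge>N. \<forall>z\<in>spec a. dist (poly (p n) z) (f z) < e" by blast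
  qed
  then show ?thesis by (rule exI[of _ p])
qed

lemma norm_peval_diff_le:
  fixes a :: "'a::unital_cstar_algebra"
  assumes "a\<^sup>\<star> = a" "\<And>z. z \<in> spec a \<Longrightarrow> cmod (poly p z - poly q z) \<le> K"
  shows "norm (peval p a - peval q a) \<le> K"
  using norm_peval_le[of a "p - q" K] assms by (simp add: peval_diff)

lemma cfc_bound:
  fixes a :: "'a::unital_cstar_algebra"
  assumes a: "a\<^sup>\<star> = a" and f: "continuous_on (spec a) f"
    and K: "\<And>z. z \<in> spec a \<Longrightarrow> cmod (f z - poly p z) \<le> K"
  shows "norm (cfc f a - peval p a) \<le> K"
proof -
  obtain q where q: "uniform_limit (spec a) (\<lambda>n. poly (q n)) f sequentially"
    using poly_sequence[OF a f] by blast
  have near: "\<exists>N. \<forall>n\<ge>N. \<forall>z\<in>spec a. cmod (poly (q n) z - f z) < e" if "e > 0" for e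
    using q that by (simp add: uniform_limit_sequentially_iff dist_norm)
  have "Cauchy (\<lambda>n. peval (q n) a)"
    unfolding Cauchy_def
  proof (intro allI impI)
    fix e :: real assume e: "e > 0"
    then obtain N where N: "\<And>n z. n \<ge> N \<Longrightarrow> z \<in> spec a \<Longrightarrow> cmod (poly (q n) z - f z) < e/3"
      using near[of "e/3"] by auto
    have "norm (peval (q m) a - peval (q n) a) \<le> 2 * (e/3)" if "m \<ge> N" "n \<ge> N" for m n
    proof (rule norm_peval_diff_le[OF a])
      fix z assume z: "z \<in> spec a"
      show "cmod (poly (q m) z - poly (q n) z) \<le> 2 * (e/3)"
        using norm_triangle_ineq4[of "poly (q m) z - f z" "poly (q n) z - f z"]
          N[OF that(1) z] N[OF that(2) z] by simp
    qed
    then show "\<exists>N. \<forall>m\<ge>N. \<forall>n\<ge>N. dist (peval (q m) a) (peval (q n) a) < e"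
      using e by (intro exI[of _ N]) (force simp: dist_norm)
  qed
  then obtain y where y: "(\<lambda>n. peval (q n) a) \<longlonglongrightarrow> y" using Cauchy_convergent convergent_def by blast
  have yb: "norm (y - peval p a) \<le> K" if K: "\<And>z. z \<in> spec a \<Longrightarrow> cmod (f z - poly p z) \<le> K" for p K
  proof (rule field_le_epsilon)
    fix e :: real assume e: "e > 0"
    then obtain N where N: "\<And>n z. n \<ge> N \<Longrightarrow> z \<in> spec a \<Longrightarrow> cmod (poly (q n) z - f z) < e"
      using near[of e] by auto
    have "(\<lambda>n. norm (peval (q n) a - peval p a)) \<longlonglongrightarrow> norm (y - peval p a)"
      by (intro tendsto_intros y)
    moreover have "\<forall>n\<ge>N. norm (peval (q n) a - peval p a) \<le> K + e"
    proof (intro allI impI norm_peval_diff_le[OF a])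
      fix n z assume "n \<ge> N" and z: "z \<in> spec a"
      then show "cmod (poly (q n) z - poly p z) \<le> K + e"
        using norm_triangle_ineq[of "poly (q n) z - f z" "f z - poly p z"] N[of n z] K[OF z] by simp
    qed
    ultimately show "norm (y - peval p a) \<le> K + e" by (intro LIMSEQ_le_const2) auto
  qed
  have "cfc f a = y"
    unfolding cfc_def
  proof (rule the_equality)
    fix y' assume y': "\<forall>p K. (\<forall>z\<in>spec a. cmod (f z - poly p z) \<le> K) \<longrightarrow> norm (y' - peval p a) \<le> K"
    have "norm (y' - y) \<le> 0"
    proof (rule field_le_epsilon)
      fix e :: real assume e: "e > 0"
      then obtain N where N: "\<And>n z. n \<ge> N \<Longrightarrow> z \<in> spec a \<Longrightarrow> cmod (poly (q n) z - f z) < e/2"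
        using near[of "e/2"] by auto
      then have le: "\<And>z. z \<in> spec a \<Longrightarrow> cmod (f z - poly (q N) z) \<le> e/2"
        by (metis norm_minus_commute less_imp_le order_refl)
      have "norm (y' - peval (q N) a) \<le> e/2" using y' le by blast
      moreover have "norm (y - peval (q N) a) \<le> e/2" using yb le by blast
      ultimately show "norm (y' - y) \<le> 0 + e"
        using norm_triangle_ineq4[of "y' - peval (q N) a" "y - peval (q N) a"] by simp
    qed
    then show "y' = y" by simp
  qed (use yb in blast)
  then show ?thesis using yb K by blast
qed

lemma cfc_limit:
  fixes a :: "'a::unital_cstar_algebra"
  assumes a: "a\<^sup>\<star> = a" and f: "continuous_on (spec a) f"
    and q: "uniform_limit (spec a) (\<lambda>n. poly (q n)) f sequentially"
  shows "(\<lambda>n. peval (q n) a) \<longlonglongrightarrow> cfc f a"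
proof (rule LIMSEQ_I)
  fix e :: real assume e: "e > 0"
  then obtain N where N: "\<And>n z. n \<ge> N \<Longrightarrow> z \<in> spec a \<Longrightarrow> dist (poly (q n) z) (f z) < e/2"
    using q unfolding uniform_limit_sequentially_iff by (metis half_gt_zero)
  have "norm (cfc f a - peval (q n) a) \<le> e/2" if "n \<ge> N" for n
    by (rule cfc_bound[OF a f]) (use N[OF that] in \<open>auto simp: dist_norm norm_minus_commute less_imp_le\<close>)
  then show "\<exists>N. \<forall>n\<ge>N. norm (peval (q n) a - cfc f a) < e"
    using e by (intro exI[of _ N]) (force simp: norm_minus_commute)
qed

context
  fixes a :: "'a::unital_cstar_algebra"
  assumes a: "a\<^sup>\<star> = a"
begin

lemma cfc_poly: "cfc (poly p) a = peval p a"
  using cfc_bound[OF a, of "poly p" p 0] by (simp add: continuous_on_poly)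

lemma cfc_norm_le:
  "continuous_on (spec a) f \<Longrightarrow> (\<And>z. z \<in> spec a \<Longrightarrow> cmod (f z) \<le> K) \<Longrightarrow> norm (cfc f a) \<le> K"
  using cfc_bound[OF a, of f 0 K] by simp

lemma cfc_add:
  assumes f: "continuous_on (spec a) f" and g: "continuous_on (spec a) g"
  shows "cfc (\<lambda>z. f z + g z) a = cfc f a + cfc g a"
proof -
  obtain p q where p: "uniform_limit (spec a) (\<lambda>n. poly (p n)) f sequentially"
    and q: "uniform_limit (spec a) (\<lambda>n. poly (q n)) g sequentially"
    using poly_sequence[OF a f] poly_sequence[OF a g] by blast
  have "uniform_limit (spec a) (\<lambda>n. poly (p n + q n)) (\<lambda>z. f z + g z) sequentially"
    using uniform_limit_add[OF p q] by (simp add: poly_add[abs_def])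
  from cfc_limit[OF a _ this] have "(\<lambda>n. peval (p n + q n) a) \<longlonglongrightarrow> cfc (\<lambda>z. f z + g z) a"
    using f g by (simp add: continuous_on_add)
  moreover have "(\<lambda>n. peval (p n + q n) a) \<longlonglongrightarrow> cfc f a + cfc g a"
    unfolding peval_add by (intro tendsto_add cfc_limit a f g p q)
  ultimately show ?thesis by (rule LIMSEQ_unique)
qed

lemma cfc_mult:
  assumes f: "continuous_on (spec a) f" and g: "continuous_on (spec a) g"
  shows "cfc (\<lambda>z. f z * g z) a = cfc f a * cfc g a"
proof -
  obtain p q where p: "uniform_limit (spec a) (\<lambda>n. poly (p n)) f sequentially"
    and q: "uniform_limit (spec a) (\<lambda>n. poly (q n)) g sequentially"
    using poly_sequence[OF a f] poly_sequence[OF a g] by blast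
  have "bounded (f ` spec a)" "bounded (g ` spec a)"
    by (intro compact_imp_bounded compact_continuous_image f g compact_spec)+
  then have "uniform_limit (spec a) (\<lambda>n. poly (p n * q n)) (\<lambda>z. f z * g z) sequentially"
    using uniform_lim_mult[OF p q] by (simp add: poly_mult[abs_def])
  from cfc_limit[OF a _ this] have "(\<lambda>n. peval (p n * q n) a) \<longlonglongrightarrow> cfc (\<lambda>z. f z * g z) a"
    using f g by (simp add: continuous_on_mult)
  moreover have "(\<lambda>n. peval (p n * q n) a) \<longlonglongrightarrow> cfc f a * cfc g a"
    unfolding peval_mult by (intro tendsto_mult cfc_limit a f g p q)
  ultimately show ?thesis by (rule LIMSEQ_unique)
qed

lemma cfc_const: "cfc (\<lambda>_. c) a = c *\<^sub>C 1"
  using cfc_poly[of "[:c:]"] by (simp add: poly_pCons[abs_def])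

lemma cfc_id: "cfc (\<lambda>z. z) a = a"
  using cfc_poly[of "[:0, 1:]"] by (simp add: poly_pCons[abs_def])

lemma cfc_scaleC: "continuous_on (spec a) f \<Longrightarrow> cfc (\<lambda>z. c * f z) a = c *\<^sub>C cfc f a"
  using cfc_mult[of "\<lambda>_. c" f] by (simp add: cfc_const mult_scaleC_left)

lemma cfc_star:
  assumes f: "continuous_on (spec a) f"
  shows "cfc (\<lambda>z. cnj (f z)) a = (cfc f a)\<^sup>\<star>"
proof -
  obtain p where p: "uniform_limit (spec a) (\<lambda>n. poly (p n)) f sequentially"
    using poly_sequence[OF a f] by blast
  have re: "cnj z = z" if "z \<in> spec a" for z
    using spec_selfadjoint_real[OF a that] by (simp add: complex_eq_iff)
  have "uniform_limit (spec a) (\<lambda>n z. cnj (poly (p n) z)) (\<lambda>z. cnj (f z)) sequentially"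
    by (intro uniform_limit_intros p)
  then have "uniform_limit (spec a) (\<lambda>n. poly (map_poly cnj (p n))) (\<lambda>z. cnj (f z)) sequentially"
    by (rule uniform_limit_cong'[THEN iffD1, rotated -1]) (simp_all add: poly_map_cnj re)
  from cfc_limit[OF a _ this] have "(\<lambda>n. peval (map_poly cnj (p n)) a) \<longlonglongrightarrow> cfc (\<lambda>z. cnj (f z)) a"
    using f by (simp add: continuous_on_cnj)
  moreover have "(\<lambda>n. peval (map_poly cnj (p n)) a) \<longlonglongrightarrow> (cfc f a)\<^sup>\<star>"
    unfolding peval_star[OF a, symmetric] by (intro tendsto_star cfc_limit a f p)
  ultimately show ?thesis by (rule LIMSEQ_unique)
qed

lemma cfc_cong: "(\<And>z. z \<in> spec a \<Longrightarrow> f z = g z) \<Longrightarrow> cfc f a = cfc g a"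
  unfolding cfc_def by (simp cong: ball_cong)

lemma cfc_real_selfadjoint:
  "continuous_on (spec a) f \<Longrightarrow> (\<And>z. z \<in> spec a \<Longrightarrow> Im (f z) = 0) \<Longrightarrow> (cfc f a)\<^sup>\<star> = cfc f a"
  by (subst cfc_star[symmetric]) (auto intro!: cfc_cong simp: complex_eq_iff)

end

section \<open>Positive elements of unital algebras\<close>

definition spec_positive :: "'a::unital_cstar_algebra \<Rightarrow> bool" where
  "spec_positive a \<longleftrightarrow> a\<^sup>\<star> = a \<and> (\<forall>z\<in>spec a. Im z = 0 \<and> 0 \<le> Re z)"

text \<open>
  For self-adjoint \<open>a\<close> and \<open>t \<ge> \<parallel>a\<parallel>\<close>, positivity is equivalent to \<open>\<parallel>t - a\<parallel> \<le> t\<close>. Unlike the definition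
  by the spectrum, this condition visibly survives sums and limits.
\<close>

lemma spec_positive_norm:
  fixes a :: "'a::unital_cstar_algebra"
  assumes "spec_positive a" "norm a \<le> t"
  shows "norm (t *\<^sub>R 1 - a) \<le> t"
proof -
  have "norm (peval [:of_real t, -1:] a) \<le> t"
  proof (rule norm_peval_le)
    fix z assume z: "z \<in> spec a"
    then have "z = of_real (Re z)" "0 \<le> Re z" using assms by (auto simp: spec_positive_def complex_eq_iff)
    moreover have "cmod z \<le> t" using spec_norm_le[OF z] assms(2) by simp
    ultimately have "cmod (of_real (t - Re z)) \<le> t" using complex_Re_le_cmod[of z]
      by (simp only: norm_of_real)
    then show "cmod (poly [:of_real t, -1:] z) \<le> t" using \<open>z = of_real (Re z)\<close> by (simp add: of_real_diff)
  qed (use assms in \<open>simp add: spec_positive_def\<close>)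
  then show ?thesis by (simp add: scaleC_of_real)
qed

lemma spec_reflect:
  "z \<in> spec a \<longleftrightarrow> w - z \<in> spec (w *\<^sub>C 1 - (a::'a::unital_cstar_algebra))"
proof -
  have "(w - z) *\<^sub>C 1 - (w *\<^sub>C 1 - a) = (-1) *\<^sub>C (z *\<^sub>C 1 - a)"
    by (simp add: scaleC_diff_left)
  then have "regular ((w - z) *\<^sub>C 1 - (w *\<^sub>C 1 - a)) \<longleftrightarrow> regular (z *\<^sub>C 1 - a)"
    using regular_scaleC[of "- 1" "z *\<^sub>C 1 - a"] by (simp only:) simp
  then show ?thesis unfolding spec_def by simp
qed

lemma spec_positiveI:
  fixes a :: "'a::unital_cstar_algebra"
  assumes a: "a\<^sup>\<star> = a" and "norm (t *\<^sub>R 1 - a) \<le> t"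
  shows "spec_positive a"
  unfolding spec_positive_def
proof (intro conjI ballI a)
  fix z assume z: "z \<in> spec a"
  then show "Im z = 0" by (rule spec_selfadjoint_real[OF a])
  have "of_real t - z \<in> spec (t *\<^sub>R 1 - a)"
    using z spec_reflect[of z a "of_real t"] by (simp add: scaleC_of_real)
  then have "cmod (of_real t - z) \<le> t" using spec_norm_le assms(2) by (meson order_trans)
  then show "0 \<le> Re z" using complex_Re_le_cmod[of "of_real t - z"] by simp
qed

lemma spec_positive_add: "spec_positive a \<Longrightarrow> spec_positive b \<Longrightarrow> spec_positive (a + b)"
proof (rule spec_positiveI[of _ "norm a + norm b"])
  assume "spec_positive a" "spec_positive b"
  then show "(a + b)\<^sup>\<star> = a + b" by (simp add: spec_positive_def star_add)
  show "norm ((norm a + norm b) *\<^sub>R 1 - (a + b)) \<le> norm a + norm b"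
    using norm_triangle_ineq[of "norm a *\<^sub>R 1 - a" "norm b *\<^sub>R 1 - b"]
      spec_positive_norm[OF \<open>spec_positive a\<close> order_refl] spec_positive_norm[OF \<open>spec_positive b\<close> order_refl]
    by (simp add: scaleR_add_left algebra_simps)
qed

lemma spec_positive_scaleR: "spec_positive a \<Longrightarrow> 0 \<le> r \<Longrightarrow> spec_positive (r *\<^sub>R a)"
proof (rule spec_positiveI[of _ "r * norm a"])
  assume a: "spec_positive a" and r: "0 \<le> r"
  then show "(r *\<^sub>R a)\<^sup>\<star> = r *\<^sub>R a" by (simp add: spec_positive_def star_scaleR)
  have "norm (r *\<^sub>R (norm a *\<^sub>R 1 - a)) \<le> r * norm a"
    using spec_positive_norm[OF a order_refl] r by (simp add: mult_left_mono)
  then show "norm ((r * norm a) *\<^sub>R 1 - r *\<^sub>R a) \<le> r * norm a" by (simp add: algebra_simps)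
qed

lemma spec_positive_limit:
  fixes l :: "'a::unital_cstar_algebra"
  assumes "\<And>n. spec_positive (x n)" "x \<longlonglongrightarrow> l"
  shows "spec_positive l"
proof (rule spec_positiveI[of _ "norm l"])
  have "(\<lambda>n. (x n)\<^sup>\<star>) \<longlonglongrightarrow> l\<^sup>\<star>" by (intro tendsto_intros assms)
  then show "l\<^sup>\<star> = l" using assms LIMSEQ_unique by (simp add: spec_positive_def) blast
  have "(\<lambda>n. norm (norm (x n) *\<^sub>R 1 - x n)) \<longlonglongrightarrow> norm (norm l *\<^sub>R 1 - l)"
    by (intro tendsto_intros assms)
  moreover have "(\<lambda>n. norm (x n)) \<longlonglongrightarrow> norm l" by (intro tendsto_intros assms)
  ultimately show "norm (norm l *\<^sub>R 1 - l) \<le> norm l"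
    by (rule LIMSEQ_le) (use spec_positive_norm[OF assms(1) order_refl] in blast)
qed

lemma spec_positive_square:
  fixes h :: "'a::unital_cstar_algebra"
  assumes h: "h\<^sup>\<star> = h" shows "spec_positive (h * h)"
proof -
  have "Im z = 0 \<and> 0 \<le> Re z" if "z \<in> spec (h * h)" for z
  proof -
    have "z \<in> spec (peval [:0,0,1:] h)" using that by simp
    then obtain w where "w \<in> spec h" "z = w * w"
      using spec_peval[OF _ spec_selfadjoint_nonempty[OF h]] by fastforce
    then show ?thesis using spec_selfadjoint_real[OF h] by simp
  qed
  then show ?thesis using h by (simp add: spec_positive_def star_mult)
qed

lemma cfc_spec_positive:
  fixes a :: "'a::unital_cstar_algebra"
  assumes a: "a\<^sup>\<star> = a" and f: "continuous_on (spec a) f"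
    and nn: "\<And>z. z \<in> spec a \<Longrightarrow> Im (f z) = 0 \<and> 0 \<le> Re (f z)"
  shows "spec_positive (cfc f a)"
proof -
  let ?g = "\<lambda>z. complex_of_real (sqrt (Re (f z)))"
  have g: "continuous_on (spec a) ?g" by (intro continuous_intros f)
  have "cfc f a = cfc (\<lambda>z. ?g z * ?g z) a"
    by (rule cfc_cong[OF a]) (use nn in \<open>simp add: complex_eq_iff\<close>)
  also have "\<dots> = cfc ?g a * cfc ?g a" by (rule cfc_mult[OF a g g])
  finally show ?thesis using spec_positive_square[OF cfc_real_selfadjoint[OF a g]] by simp
qed

lemma spec_positive_antisym: "spec_positive a \<Longrightarrow> spec_positive (- a) \<Longrightarrow> a = 0"
proof (rule ccontr)
  assume a: "spec_positive a" "spec_positive (- a)" and "a \<noteq> 0"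
  then obtain z where z: "z \<in> spec a" "cmod z = norm a"
    using spec_selfadjoint_attains_norm[of a] by (auto simp: spec_positive_def)
  have "- z \<in> spec (- a)" using spec_reflect[of z a 0] z(1) by simp
  then have "z = 0" using z a by (fastforce simp: spec_positive_def complex_eq_iff)
  then show False using z \<open>a \<noteq> 0\<close> by simp
qed

text \<open>
  If \<open>c\<close> inverts \<open>z - yx\<close>, then \<open>(1 + xcy)/z\<close> inverts \<open>z - xy\<close>.
\<close>

lemma spec_mult_commute:
  fixes x y :: "'a::unital_cstar_algebra"
  assumes "z \<in> spec (x * y)" "z \<noteq> 0"
  shows "z \<in> spec (y * x)"
proof (rule ccontr)
  assume "z \<notin> spec (y * x)"
  then have r: "regular (z *\<^sub>C 1 - y * x)" by (simp add: spec_def)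
  define c where "c = rinv (z *\<^sub>C 1 - y * x)"
  have c: "z *\<^sub>C c - y * x * c = 1" "z *\<^sub>C c - c * y * x = 1"
    using regular_rinv[OF r] by (simp_all add: c_def algebra_simps mult_scaleC_left mult_scaleC_right)
  have "(z *\<^sub>C 1 - x * y) * (1 + x * c * y) = z *\<^sub>C 1 - x * y + x * (z *\<^sub>C c - y * x * c) * y"
    by (simp add: algebra_simps mult_scaleC_left mult_scaleC_right scaleC_add_right)
  then have 1: "(z *\<^sub>C 1 - x * y) * (1 + x * c * y) = z *\<^sub>C 1" using c by simp
  have "(1 + x * c * y) * (z *\<^sub>C 1 - x * y) = z *\<^sub>C 1 - x * y + x * (z *\<^sub>C c - c * y * x) * y"
    by (simp add: algebra_simps mult_scaleC_left mult_scaleC_right scaleC_add_right)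
  then have 2: "(1 + x * c * y) * (z *\<^sub>C 1 - x * y) = z *\<^sub>C 1" using c by simp
  have "regular (z *\<^sub>C 1 - x * y)"
    by (rule regularI[of _ "inverse z *\<^sub>C (1 + x * c * y)" "inverse z *\<^sub>C (1 + x * c * y)"])
      (use assms(2) in \<open>simp_all only: mult_scaleC_left mult_scaleC_right 1 2, simp_all\<close>)
  then show False using assms(1) by (simp add: spec_def)
qed

lemma spec_positive_uminus_commute: "spec_positive (- (y\<^sup>\<star> * y)) \<Longrightarrow> spec_positive (- (y * y\<^sup>\<star>))" for y :: "'a::unital_cstar_algebra"
  unfolding spec_positive_def
proof (intro conjI ballI; elim conjE)
  fix z assume *: "\<forall>z\<in>spec (- (y\<^sup>\<star> * y)). Im z = 0 \<and> 0 \<le> Re z" and z: "z \<in> spec (- (y * y\<^sup>\<star>))"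
  have "z \<in> spec (- y\<^sup>\<star> * y)" if "z \<noteq> 0" using spec_mult_commute[of z y "- y\<^sup>\<star>"] z that by simp
  then show "Im z = 0" "0 \<le> Re z" using * by fastforce+
qed (simp add: star_mult)

text \<open>
  Kaplansky's argument. Let \<open>n\<close> be the negative part of \<open>a = x\<^sup>\<star>x\<close> and \<open>y = xn\<close>. Then \<open>y\<^sup>\<star>y = nan = -n\<^sup>3\<close>
  is negative, hence so is \<open>yy\<^sup>\<star>\<close>, as both have the same nonzero spectrum. The sum of the two is
  positive, so \<open>y\<^sup>\<star>y\<close> is positive as well, which forces \<open>n\<^sup>3 = 0\<close> and \<open>n = 0\<close>.
\<close>

lemma spec_positive_star_mult:
  fixes x :: "'a::unital_cstar_algebra"
  shows "spec_positive (x\<^sup>\<star> * x)"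
proof -
  define a where "a = x\<^sup>\<star> * x"
  have a: "a\<^sup>\<star> = a" by (simp add: a_def star_mult)
  let ?n = "\<lambda>z. complex_of_real (max 0 (- Re z))" and ?p = "\<lambda>z. complex_of_real (max 0 (Re z))"
  define n where "n = cfc ?n a"
  have cn: "continuous_on (spec a) ?n" "continuous_on (spec a) ?p" by (intro continuous_intros)+
  have n_sa: "n\<^sup>\<star> = n" unfolding n_def by (rule cfc_real_selfadjoint[OF a cn(1)]) simp
  have "cfc (\<lambda>z. z * ?n z) a = a * n" using cfc_mult[OF a _ cn(1), of "\<lambda>z. z"] by (simp add: cfc_id[OF a] n_def)
  then have "n * a * n = cfc (\<lambda>z. ?n z * (z * ?n z)) a"
    using cfc_mult[OF a cn(1), of "\<lambda>z. z * ?n z"] cn(1) by (simp add: n_def mult.assoc continuous_on_mult continuous_on_id)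
  also have "\<dots> = cfc (\<lambda>z. - 1 * (?n z * (?n z * ?n z))) a"
    by (rule cfc_cong[OF a]) (use spec_selfadjoint_real[OF a] in \<open>auto simp: max_def complex_eq_iff\<close>)
  also have "\<dots> = - (n * (n * n))"
    using cfc_scaleC[OF a, of "\<lambda>z. ?n z * (?n z * ?n z)" "- 1"] cfc_mult[OF a cn(1), of "\<lambda>z. ?n z * ?n z"]
      cfc_mult[OF a cn(1) cn(1)] cn(1) by (simp add: n_def continuous_on_mult)
  finally have nan: "n * a * n = - (n * (n * n))" .
  define y where "y = x * n"
  have yy: "y\<^sup>\<star> * y = - (n * (n * n))"
    using nan by (simp add: y_def star_mult n_sa a_def mult.assoc)
  have "cfc (\<lambda>z. ?n z * (?n z * ?n z)) a = n * (n * n)"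
    using cfc_mult[OF a cn(1), of "\<lambda>z. ?n z * ?n z"] cfc_mult[OF a cn(1) cn(1)] cn(1)
    by (simp add: n_def continuous_on_mult)
  moreover have "spec_positive (cfc (\<lambda>z. ?n z * (?n z * ?n z)) a)"
    by (rule cfc_spec_positive[OF a]) (intro continuous_intros cn, simp)
  ultimately have neg: "spec_positive (- (y\<^sup>\<star> * y))" using yy by simp
  \<comment> \<open>\<open>y\<^sup>\<star>y + yy\<^sup>\<star>\<close> is half the sum of the squares of two self-adjoint elements\<close>
  let ?u = "y + y\<^sup>\<star>" and ?v = "\<i> *\<^sub>C (y - y\<^sup>\<star>)"
  have "?u\<^sup>\<star> = ?u" "?v\<^sup>\<star> = ?v"
    by (simp_all add: star_add star_diff star_scaleC scaleC_diff_right)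
  then have uv: "spec_positive (?u * ?u + ?v * ?v)" by (intro spec_positive_add spec_positive_square)
  have "?u * ?u + ?v * ?v = 2 *\<^sub>R (y\<^sup>\<star> * y + y * y\<^sup>\<star>)"
    by (simp add: mult_scaleC_left mult_scaleC_right scaleR_2 algebra_simps scaleC_diff_right)
  with uv have "spec_positive (2 *\<^sub>R (y\<^sup>\<star> * y + y * y\<^sup>\<star>))" by simp
  then have "spec_positive ((1/2) *\<^sub>R (2 *\<^sub>R (y\<^sup>\<star> * y + y * y\<^sup>\<star>)))" by (rule spec_positive_scaleR) simp
  then have "spec_positive (y\<^sup>\<star> * y + y * y\<^sup>\<star>)" by simp
  from spec_positive_add[OF this spec_positive_uminus_commute[OF neg]] have "spec_positive (y\<^sup>\<star> * y)" by simp
  then have "y\<^sup>\<star> * y = 0" by (rule spec_positive_antisym[OF _ neg])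
  then have "n * (n * n) = 0" using yy by simp
  then have "n ^ 2 ^ 2 = 0" by (simp add: eval_nat_numeral)
  then have "norm n ^ 2 ^ 2 = 0" using norm_power_selfadjoint[OF n_sa, of 2] by simp
  then have n0: "cfc ?n a = 0" by (simp add: n_def)
  have "a = cfc (\<lambda>z. ?p z + - 1 * ?n z) a"
    by (subst (1) cfc_id[OF a, symmetric], rule cfc_cong[OF a])
      (use spec_selfadjoint_real[OF a] in \<open>auto simp: max_def complex_eq_iff\<close>)
  also have "\<dots> = cfc ?p a"
    using cfc_add[OF a cn(2), of "\<lambda>z. - 1 * ?n z"] cfc_scaleC[OF a cn(1), of "- 1"] cn(1) n0
    by (simp add: continuous_on_minus)
  finally have "a = cfc ?p a" .
  moreover have "spec_positive (cfc ?p a)" by (rule cfc_spec_positive[OF a cn(2)]) simp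
  ultimately show ?thesis by (simp add: a_def)
qed

lemma spec_positive_norm_minus:
  fixes z :: "'a::unital_cstar_algebra"
  assumes "z\<^sup>\<star> = z" "norm z \<le> r" shows "spec_positive (r *\<^sub>R 1 - z)"
  by (rule spec_positiveI[of _ r]) (simp_all add: assms star_diff star_scaleR)

text \<open>
  From \<open>a \<le> b \<le> \<parallel>b\<parallel>\<close> the spectrum of \<open>a\<close> lies below \<open>\<parallel>b\<parallel>\<close>.
\<close>

lemma spec_positive_norm_mono:
  fixes a b :: "'a::unital_cstar_algebra"
  assumes a: "spec_positive a" and ba: "spec_positive (b - a)"
  shows "norm a \<le> norm b"
proof (cases "a = 0")
  case False
  have sa: "a\<^sup>\<star> = a" "b\<^sup>\<star> = b" using a ba by (auto simp: spec_positive_def star_diff)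
  have "spec_positive ((norm b *\<^sub>R 1 - b) + (b - a))" by (intro spec_positive_add ba spec_positive_norm_minus sa) simp
  then have p: "spec_positive (norm b *\<^sub>R 1 - a)" by simp
  obtain z where z: "z \<in> spec a" "cmod z = norm a"
    using spec_selfadjoint_attains_norm[OF sa(1) False] by blast
  have "of_real (norm b) - z \<in> spec (norm b *\<^sub>R 1 - a)"
    using spec_reflect[of z a "of_real (norm b)"] z(1) by (simp add: scaleC_of_real)
  then have "Re z \<le> norm b" using p by (force simp: spec_positive_def)
  moreover have "cmod z = Re z" using a z(1) by (auto simp: spec_positive_def cmod_eq_Re)
  ultimately show ?thesis using z(2) by simp
qed simp

lemma spec_positive_sqrt:
  fixes a :: "'a::unital_cstar_algebra"
  assumes "spec_positive a" shows "\<exists>h. h\<^sup>\<star> = h \<and> h * h = a"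
proof -
  have a: "a\<^sup>\<star> = a" using assms by (simp add: spec_positive_def)
  let ?g = "\<lambda>z. complex_of_real (sqrt (Re z))"
  have g: "continuous_on (spec a) ?g" by (intro continuous_intros)
  have "cfc ?g a * cfc ?g a = cfc (\<lambda>z. ?g z * ?g z) a" by (simp add: cfc_mult[OF a g g])
  also have "\<dots> = cfc (\<lambda>z. z) a"
    by (rule cfc_cong[OF a]) (use assms in \<open>simp add: spec_positive_def complex_eq_iff\<close>)
  finally show ?thesis using cfc_real_selfadjoint[OF a g] cfc_id[OF a] by auto
qed

lemma spec_positive_conj:
  fixes a x :: "'a::unital_cstar_algebra"
  assumes "spec_positive a" shows "spec_positive (x * a * x\<^sup>\<star>)"
proof -
  obtain h where h: "h\<^sup>\<star> = h" "h * h = a" using spec_positive_sqrt[OF assms] by blast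
  have "x * a * x\<^sup>\<star> = (h * x\<^sup>\<star>)\<^sup>\<star> * (h * x\<^sup>\<star>)" by (simp add: star_mult h(1) h(2)[symmetric] mult.assoc)
  then show ?thesis using spec_positive_star_mult by simp
qed

section \<open>Positivity and functional calculus without unit\<close>

definition unitize :: "'a::cstar_algebra \<Rightarrow> 'a unitization" where "unitize a = Unitized 0 a"

lemma unitize_sel [simp]: "scalar (unitize a) = 0" "elt (unitize a) = a"
  by (simp_all add: unitize_def)

lemma unitize_elt: "scalar x = 0 \<Longrightarrow> unitize (elt x) = x"
  by (simp add: unitization.expand)

lemma unitize_zero [simp]: "unitize 0 = 0"
  and unitize_add: "unitize (a + b) = unitize a + unitize b"
  and unitize_diff: "unitize (a - b) = unitize a - unitize b"
  and unitize_mult: "unitize (a * b) = unitize a * unitize b"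
  and unitize_star: "unitize (a\<^sup>\<star>) = (unitize a)\<^sup>\<star>"
  and unitize_scaleR: "unitize (r *\<^sub>R a) = r *\<^sub>R unitize a"
  by (simp_all add: unitization.expand)

lemma unitize_eq_iff: "unitize a = unitize b \<longleftrightarrow> a = b"
  by (simp add: unitize_def)

lemma norm_unitize [simp]: "norm (unitize a) = norm a"
  by (simp add: norm_unitization_def op_norm_unitize)

lemma tendsto_unitize: "x \<longlonglongrightarrow> l \<Longrightarrow> (\<lambda>n. unitize (x n)) \<longlonglongrightarrow> unitize l"
  by (simp add: tendsto_iff dist_norm flip: unitize_diff)

lemma spectrum_eq_spec: "spectrum a = spec (unitize a)"
proof -
  have "regular (z *\<^sub>C 1 - unitize a) \<longleftrightarrow> (\<exists>w b. z * w = 1 \<and>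
     z *\<^sub>C b - w *\<^sub>C a - a * b = 0 \<and> z *\<^sub>C b - w *\<^sub>C a - b * a = 0)" for z
  proof
    assume "regular (z *\<^sub>C 1 - unitize a)"
    then obtain y where y: "(z *\<^sub>C 1 - unitize a) * y = 1" "y * (z *\<^sub>C 1 - unitize a) = 1"
      unfolding regular_def by blast
    have "scalar ((z *\<^sub>C 1 - unitize a) * y) = 1" "elt ((z *\<^sub>C 1 - unitize a) * y) = 0"
      "elt (y * (z *\<^sub>C 1 - unitize a)) = 0"
      unfolding y by simp_all
    then show "\<exists>w b. z * w = 1 \<and>
       z *\<^sub>C b - w *\<^sub>C a - a * b = 0 \<and> z *\<^sub>C b - w *\<^sub>C a - b * a = 0"
      by (intro exI[of _ "scalar y"] exI[of _ "elt y"]) (simp add: algebra_simps)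
  next
    assume "\<exists>w b. z * w = 1 \<and> z *\<^sub>C b - w *\<^sub>C a - a * b = 0 \<and> z *\<^sub>C b - w *\<^sub>C a - b * a = 0"
    then obtain w b where "z * w = 1" "z *\<^sub>C b - w *\<^sub>C a - a * b = 0" "z *\<^sub>C b - w *\<^sub>C a - b * a = 0"
      by blast
    then show "regular (z *\<^sub>C 1 - unitize a)"
      by (intro regularI[of _ "Unitized w b" "Unitized w b"])
        (simp_all add: unitization.expand algebra_simps)
  qed
  then show ?thesis by (simp add: spectrum_def spec_def)
qed

lemma positives_iff: "a \<in> positives \<longleftrightarrow> spec_positive (unitize a)"
  by (auto simp: positives_def spec_positive_def spectrum_eq_spec unitize_star[symmetric] unitize_eq_iff)

lemma positives_selfadjoint: "a \<in> positives \<Longrightarrow> a\<^sup>\<star> = a"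
  by (simp add: positives_def)

lemma positives_add: "a \<in> positives \<Longrightarrow> b \<in> positives \<Longrightarrow> a + b \<in> positives"
  by (simp add: positives_iff unitize_add spec_positive_add)

lemma positives_scaleR: "a \<in> positives \<Longrightarrow> 0 \<le> r \<Longrightarrow> r *\<^sub>R a \<in> positives"
  by (simp add: positives_iff unitize_scaleR spec_positive_scaleR)

lemma positives_star_mult: "x\<^sup>\<star> * x \<in> positives"
  by (simp add: positives_iff unitize_mult unitize_star spec_positive_star_mult)

lemma positives_mult_star: "x * x\<^sup>\<star> \<in> positives"
  using positives_star_mult[of "x\<^sup>\<star>"] by simp

lemma positives_zero [simp]: "0 \<in> positives"
  using positives_star_mult[of 0] by simp

lemma positives_limit: "(\<And>n. x n \<in> positives) \<Longrightarrow> x \<longlonglongrightarrow> l \<Longrightarrow> l \<in> positives"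
  unfolding positives_iff by (rule spec_positive_limit[OF _ tendsto_unitize])

lemma positives_conj: "a \<in> positives \<Longrightarrow> x * a * x\<^sup>\<star> \<in> positives"
  by (simp add: positives_iff unitize_mult unitize_star spec_positive_conj)

lemma norm_mono_positives: "a \<in> positives \<Longrightarrow> b - a \<in> positives \<Longrightarrow> norm a \<le> norm b"
  using spec_positive_norm_mono[of "unitize a" "unitize b"] by (simp add: positives_iff unitize_diff)

text \<open>
  Conjugation by \<open>1 - h\<close>, written out so that no unit appears.
\<close>

lemma positives_conj_one_minus:
  assumes "a \<in> positives" shows "a - h * a - a * h\<^sup>\<star> + h * a * h\<^sup>\<star> \<in> positives"
proof -
  have "spec_positive ((1 - unitize h) * unitize a * (1 - unitize h)\<^sup>\<star>)"
    by (rule spec_positive_conj) (use assms in \<open>simp add: positives_iff\<close>)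
  also have "(1 - unitize h) * unitize a * (1 - unitize h)\<^sup>\<star> = unitize (a - h * a - a * h\<^sup>\<star> + h * a * h\<^sup>\<star>)"
    by (simp add: unitize_diff unitize_add unitize_mult unitize_star star_diff algebra_simps)
  finally show ?thesis by (simp add: positives_iff)
qed

lemma positives_conj_norm:
  assumes "z\<^sup>\<star> = z" "norm z \<le> r" shows "r *\<^sub>R (x * x\<^sup>\<star>) - x * z * x\<^sup>\<star> \<in> positives"
proof -
  have "spec_positive (unitize x * (r *\<^sub>R 1 - unitize z) * (unitize x)\<^sup>\<star>)"
    by (intro spec_positive_conj spec_positive_norm_minus) (simp_all add: assms flip: unitize_star)
  also have "unitize x * (r *\<^sub>R 1 - unitize z) * (unitize x)\<^sup>\<star> = unitize (r *\<^sub>R (x * x\<^sup>\<star>) - x * z * x\<^sup>\<star>)"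
    by (simp add: unitize_diff unitize_mult unitize_star unitize_scaleR algebra_simps)
  finally show ?thesis by (simp add: positives_iff)
qed

lemma zero_in_spectrum: "0 \<in> spectrum a"
  by (auto simp: spectrum_def)

text \<open>
  Taking the scalar part is a continuous character that maps \<open>p(a)\<close> to \<open>p(0)\<close>. Functions vanishing at
  \<open>0\<close> are therefore applied to elements of the algebra without leaving it.
\<close>

lemma scalar_cfc:
  fixes a :: "'a::cstar_algebra"
  assumes a: "a\<^sup>\<star> = a" and f: "continuous_on (spec (unitize a)) f"
  shows "scalar (cfc f (unitize a)) = f 0"
proof -
  have ea: "(unitize a)\<^sup>\<star> = unitize a" by (simp add: a flip: unitize_star)
  have sp: "scalar (peval p x) = poly p (scalar x)" for p and x :: "'a unitization"
    by (induction p) simp_all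
  obtain p where p: "uniform_limit (spec (unitize a)) (\<lambda>n. poly (p n)) f sequentially"
    using poly_sequence[OF ea f] by blast
  have "(\<lambda>n. scalar (peval (p n) (unitize a))) \<longlonglongrightarrow> scalar (cfc f (unitize a))"
    by (intro bounded_linear.tendsto[OF bounded_linear_scalar] cfc_limit ea f p)
  moreover have "(\<lambda>n. poly (p n) 0) \<longlonglongrightarrow> f 0"
    by (rule tendsto_uniform_limitI[OF p]) (use zero_in_spectrum spectrum_eq_spec in blast)
  ultimately show ?thesis using LIMSEQ_unique by (simp add: sp) blast
qed

lemma unitize_elt_cfc:
  "a\<^sup>\<star> = a \<Longrightarrow> continuous_on (spec (unitize a)) f \<Longrightarrow> f 0 = 0 \<Longrightarrow>
    unitize (elt (cfc f (unitize a))) = cfc f (unitize a)"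
  by (rule unitize_elt) (simp add: scalar_cfc)

lemma is_functional_calculus_cfc:
  fixes a :: "'a::cstar_algebra"
  assumes a: "a\<^sup>\<star> = a"
  shows "is_functional_calculus a (\<lambda>f. elt (cfc f (unitize a)))"
proof -
  have ea: "(unitize a)\<^sup>\<star> = unitize a" by (simp add: a flip: unitize_star)
  have sp: "spectrum a = spec (unitize a)" by (rule spectrum_eq_spec)
  note C = cont_vanishing_def sp mem_Collect_eq
  show ?thesis
    unfolding is_functional_calculus_def
  proof (intro conjI ballI allI impI)
    fix f g assume "f \<in> cont_vanishing (spectrum a)" "g \<in> cont_vanishing (spectrum a)"
    then have f: "continuous_on (spec (unitize a)) f" "f 0 = 0"
      and g: "continuous_on (spec (unitize a)) g" "g 0 = 0" by (simp_all add: C)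
    show "elt (cfc (\<lambda>z. f z + g z) (unitize a)) = elt (cfc f (unitize a)) + elt (cfc g (unitize a))"
      unfolding cfc_add[OF ea f(1) g(1)] by simp
    show "elt (cfc (\<lambda>z. f z * g z) (unitize a)) = elt (cfc f (unitize a)) * elt (cfc g (unitize a))"
      unfolding cfc_mult[OF ea f(1) g(1)] by (simp add: scalar_cfc[OF a f(1)] scalar_cfc[OF a g(1)] f g)
  next
    fix f c K assume "f \<in> cont_vanishing (spectrum a)"
    then have f: "continuous_on (spec (unitize a)) f" "f 0 = 0" by (simp_all add: C)
    show "elt (cfc (\<lambda>z. c * f z) (unitize a)) = c *\<^sub>C elt (cfc f (unitize a))"
      unfolding cfc_scaleC[OF ea f(1)] by simp
    show "elt (cfc (\<lambda>z. cnj (f z)) (unitize a)) = (elt (cfc f (unitize a)))\<^sup>\<star>"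
      unfolding cfc_star[OF ea f(1)] by simp
    assume K: "\<forall>z\<in>spectrum a. cmod (f z) \<le> K"
    have "norm (cfc f (unitize a)) \<le> K" by (rule cfc_norm_le[OF ea f(1)]) (use K sp in auto)
    then show "norm (elt (cfc f (unitize a))) \<le> K"
      using norm_unitize[of "elt (cfc f (unitize a))"] unitize_elt_cfc[OF a f] by simp
  qed (simp add: cfc_id[OF ea])
qed

lemma is_functional_calculusD:
  assumes "is_functional_calculus a X"
  shows "f \<in> cont_vanishing (spectrum a) \<Longrightarrow> g \<in> cont_vanishing (spectrum a) \<Longrightarrow> X (\<lambda>z. f z + g z) = X f + X g"
    and "f \<in> cont_vanishing (spectrum a) \<Longrightarrow> g \<in> cont_vanishing (spectrum a) \<Longrightarrow> X (\<lambda>z. f z * g z) = X f * X g"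
    and "f \<in> cont_vanishing (spectrum a) \<Longrightarrow> X (\<lambda>z. c * f z) = c *\<^sub>C X f"
    and "f \<in> cont_vanishing (spectrum a) \<Longrightarrow> (\<And>z. z \<in> spectrum a \<Longrightarrow> cmod (f z) \<le> K) \<Longrightarrow> norm (X f) \<le> K"
    and "X (\<lambda>z. z) = a"
  using assms unfolding is_functional_calculus_def by simp_all

text \<open>
  Multiplicativity fixes the calculus on polynomials without constant term, and these are dense among
  the functions vanishing at \<open>0\<close>; contractivity does the rest.
\<close>

lemma functional_calculus_unique:
  assumes a: "a\<^sup>\<star> = a" and \<Phi>: "is_functional_calculus a \<Phi>" and \<Psi>: "is_functional_calculus a \<Psi>"
    and f: "f \<in> cont_vanishing (spectrum a)"
  shows "\<Phi> f = \<Psi> f"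
proof -
  let ?C = "cont_vanishing (spectrum a)"
  have ea: "(unitize a)\<^sup>\<star> = unitize a" by (simp add: a flip: unitize_star)
  have pC: "(\<lambda>z. z * poly p z) \<in> ?C" "(\<lambda>z. c * z) \<in> ?C" "(\<lambda>z. z) \<in> ?C" for p c
    by (auto simp: cont_vanishing_def intro!: continuous_intros)
  have poly: "\<Phi> (\<lambda>z. z * poly p z) = \<Psi> (\<lambda>z. z * poly p z)" for p
  proof (induction p)
    case 0
    have "\<Phi> (\<lambda>z. 0 * z) = \<Psi> (\<lambda>z. 0 * z)"
      by (simp only: is_functional_calculusD(3)[OF \<Phi> pC(3)] is_functional_calculusD(3)[OF \<Psi> pC(3)] scaleC_zero_left)
    then show ?case by simp
  next
    case (pCons c p)
    have eq: "X (\<lambda>z. z * poly (pCons c p) z) = c *\<^sub>C a + a * X (\<lambda>z. z * poly p z)"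
      if X: "is_functional_calculus a X" for X
    proof -
      have "(\<lambda>z. z * poly (pCons c p) z) = (\<lambda>z. c * z + z * (z * poly p z))"
        by (simp add: algebra_simps)
      moreover have "(\<lambda>z. z * (z * poly p z)) \<in> ?C"
        by (auto simp: cont_vanishing_def intro!: continuous_intros)
      then have "X (\<lambda>z. c * z + z * (z * poly p z)) = X (\<lambda>z. c * z) + X (\<lambda>z. z * (z * poly p z))"
        by (rule is_functional_calculusD(1)[OF X pC(2)])
      ultimately show ?thesis
        by (simp only: is_functional_calculusD(3)[OF X pC(3)] is_functional_calculusD(5)[OF X]
            is_functional_calculusD(2)[OF X pC(3) pC(1)])
    qed
    show ?case unfolding eq[OF \<Phi>] eq[OF \<Psi>] pCons.IH ..
  qed
  have "norm (\<Phi> f - \<Psi> f) \<le> 0"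
  proof (rule field_le_epsilon)
    fix e :: real assume e: "e > 0"
    have f': "continuous_on (spec (unitize a)) f" using f by (simp add: cont_vanishing_def spectrum_eq_spec)
    have "\<exists>p. \<forall>z\<in>spec (unitize a). cmod (f z - poly p z) < e / 4"
      by (rule complex_poly_approximation[OF compact_spec spec_selfadjoint_real[OF ea] f']) (use e in simp_all)
    then obtain p where p: "\<And>z. z \<in> spectrum a \<Longrightarrow> cmod (f z - poly p z) < e / 4"
      unfolding spectrum_eq_spec by blast
    \<comment> \<open>removing the constant term of \<open>p\<close> costs another \<open>e/4\<close>, as \<open>0\<close> is in the spectrum\<close>
    obtain c q where pq: "p = pCons c q" by (cases p)
    have "cmod c < e / 4" using p[OF zero_in_spectrum] f by (simp add: pq cont_vanishing_def)
    then have q: "cmod (f z + - 1 * (z * poly q z)) \<le> e / 2" if "z \<in> spectrum a" for z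
      using p[OF that] norm_triangle_ineq[of "f z - poly p z" c] by (simp add: pq algebra_simps)
    have bd: "norm (X f - X (\<lambda>z. z * poly q z)) \<le> e / 2" if X: "is_functional_calculus a X" for X
    proof -
      have m: "(\<lambda>z. - 1 * (z * poly q z)) \<in> ?C" "(\<lambda>z. f z + - 1 * (z * poly q z)) \<in> ?C"
        using f by (auto simp: cont_vanishing_def intro!: continuous_intros)
      have "X (\<lambda>z. f z + - 1 * (z * poly q z)) = X f + X (\<lambda>z. - 1 * (z * poly q z))"
        by (rule is_functional_calculusD(1)[OF X f m(1)])
      moreover have "X (\<lambda>z. - 1 * (z * poly q z)) = (- 1) *\<^sub>C X (\<lambda>z. z * poly q z)"
        by (rule is_functional_calculusD(3)[OF X pC(1)])
      moreover have "norm (X (\<lambda>z. f z + - 1 * (z * poly q z))) \<le> e / 2"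
        by (rule is_functional_calculusD(4)[OF X m(2) q])
      ultimately show ?thesis by simp
    qed
    show "norm (\<Phi> f - \<Psi> f) \<le> 0 + e"
      using norm_triangle_ineq4[of "\<Phi> f - \<Phi> (\<lambda>z. z * poly q z)" "\<Psi> f - \<Psi> (\<lambda>z. z * poly q z)"]
        bd[OF \<Phi>] bd[OF \<Psi>] poly[of q] by simp
  qed
  then show ?thesis by simp
qed

lemma functional_calculus_eq_cfc:
  assumes "a\<^sup>\<star> = a" "f \<in> cont_vanishing (spectrum a)"
  shows "functional_calculus f a = elt (cfc f (unitize a))"
  unfolding functional_calculus_def
proof (rule the_equality)
  show "\<exists>\<Phi>. is_functional_calculus a \<Phi> \<and> elt (cfc f (unitize a)) = \<Phi> f"
    by (intro exI[of _ "\<lambda>f. elt (cfc f (unitize a))"] conjI refl is_functional_calculus_cfc assms)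
next
  fix y assume "\<exists>\<Phi>. is_functional_calculus a \<Phi> \<and> y = \<Phi> f"
  then obtain \<Phi> where \<Phi>: "is_functional_calculus a \<Phi>" and y: "y = \<Phi> f" by (elim exE conjE)
  show "y = elt (cfc f (unitize a))"
    unfolding y
    by (rule functional_calculus_unique[OF assms(1) \<Phi> is_functional_calculus_cfc[OF assms(1)] assms(2)])
qed

text \<open>
  Functional calculus for real functions of a positive element. Continuity on the whole half-line is
  asked of them, so that the functions can be chosen before the element.
\<close>

definition fcalc :: "(real \<Rightarrow> real) \<Rightarrow> 'a::cstar_algebra \<Rightarrow> 'a" where
  "fcalc f a = elt (cfc (\<lambda>z. of_real (f (Re z))) (unitize a))"

definition vanishing :: "(real \<Rightarrow> real) \<Rightarrow> bool" where
  "vanishing f \<longleftrightarrow> continuous_on {0..} f \<and> f 0 = 0"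

context
  fixes a :: "'a::cstar_algebra"
  assumes pos: "a \<in> positives"
begin

lemma unitize_selfadjoint: "(unitize a)\<^sup>\<star> = unitize a"
  using pos by (simp add: positives_def flip: unitize_star)

lemma spec_unitizeD: "z \<in> spec (unitize a) \<Longrightarrow> Im z = 0 \<and> 0 \<le> Re z \<and> Re z \<le> norm a"
  using pos spec_norm_le[of z "unitize a"] complex_Re_le_cmod[of z]
  by (auto simp: positives_iff spec_positive_def)

lemma fcalc_continuous: "vanishing f \<Longrightarrow> continuous_on (spec (unitize a)) (\<lambda>z. complex_of_real (f (Re z)))"
proof -
  assume "vanishing f"
  then have "continuous_on {0..} f" by (simp add: vanishing_def)
  then have "continuous_on (spec (unitize a)) (\<lambda>z. f (Re z))"
    by (rule continuous_on_compose2) (use spec_unitizeD in \<open>auto intro!: continuous_intros\<close>)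
  then show ?thesis by (rule continuous_on_of_real)
qed

lemma unitize_fcalc: "vanishing f \<Longrightarrow> unitize (fcalc f a) = cfc (\<lambda>z. of_real (f (Re z))) (unitize a)"
  unfolding fcalc_def
  by (rule unitize_elt_cfc) (use pos fcalc_continuous in \<open>auto simp: positives_def vanishing_def\<close>)

lemma fcalc_mult: "vanishing f \<Longrightarrow> vanishing g \<Longrightarrow> fcalc (\<lambda>t. f t * g t) a = fcalc f a * fcalc g a"
proof -
  assume fg: "vanishing f" "vanishing g"
  then have "vanishing (\<lambda>t. f t * g t)" by (auto simp: vanishing_def intro!: continuous_intros)
  then have "unitize (fcalc (\<lambda>t. f t * g t) a) = unitize (fcalc f a * fcalc g a)"
    by (simp add: unitize_fcalc fg unitize_mult
        cfc_mult[OF unitize_selfadjoint fcalc_continuous[OF fg(1)] fcalc_continuous[OF fg(2)]])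
  then show ?thesis by (simp add: unitize_eq_iff)
qed

lemma fcalc_add: "vanishing f \<Longrightarrow> vanishing g \<Longrightarrow> fcalc (\<lambda>t. f t + g t) a = fcalc f a + fcalc g a"
proof -
  assume fg: "vanishing f" "vanishing g"
  then have "vanishing (\<lambda>t. f t + g t)" by (auto simp: vanishing_def intro!: continuous_intros)
  then have "unitize (fcalc (\<lambda>t. f t + g t) a) = unitize (fcalc f a + fcalc g a)"
    by (simp add: unitize_fcalc fg unitize_add
        cfc_add[OF unitize_selfadjoint fcalc_continuous[OF fg(1)] fcalc_continuous[OF fg(2)]])
  then show ?thesis by (simp add: unitize_eq_iff)
qed

lemma fcalc_scaleR: "vanishing f \<Longrightarrow> fcalc (\<lambda>t. r * f t) a = r *\<^sub>R fcalc f a"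
proof -
  assume f: "vanishing f"
  then have "vanishing (\<lambda>t. r * f t)" by (auto simp: vanishing_def intro!: continuous_intros)
  then have "unitize (fcalc (\<lambda>t. r * f t) a) = unitize (r *\<^sub>R fcalc f a)"
    by (simp add: unitize_fcalc f unitize_scaleR
        cfc_scaleC[OF unitize_selfadjoint fcalc_continuous[OF f]] scaleC_of_real)
  then show ?thesis by (simp add: unitize_eq_iff)
qed

lemma fcalc_diff: "vanishing f \<Longrightarrow> vanishing g \<Longrightarrow> fcalc (\<lambda>t. f t - g t) a = fcalc f a - fcalc g a"
proof -
  assume fg: "vanishing f" "vanishing g"
  then have "vanishing (\<lambda>t. (- 1) * g t)" by (auto simp: vanishing_def intro!: continuous_intros)
  then show ?thesis using fcalc_add[of f "\<lambda>t. (- 1) * g t"] fcalc_scaleR[of g "- 1"] fg by simp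
qed

lemma fcalc_id: "fcalc (\<lambda>t. t) a = a"
proof -
  have "cfc (\<lambda>z. of_real (Re z)) (unitize a) = cfc (\<lambda>z. z) (unitize a)"
    by (rule cfc_cong[OF unitize_selfadjoint]) (use spec_unitizeD in \<open>auto simp: complex_eq_iff\<close>)
  then show ?thesis by (simp add: fcalc_def cfc_id[OF unitize_selfadjoint])
qed

lemma fcalc_cong: "(\<And>t. 0 \<le> t \<Longrightarrow> t \<le> norm a \<Longrightarrow> f t = g t) \<Longrightarrow> fcalc f a = fcalc g a"
  unfolding fcalc_def by (rule arg_cong[where f=elt], rule cfc_cong[OF unitize_selfadjoint]) (use spec_unitizeD in auto)

lemma fcalc_star: "vanishing f \<Longrightarrow> (fcalc f a)\<^sup>\<star> = fcalc f a"
proof -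
  assume f: "vanishing f"
  have "(unitize (fcalc f a))\<^sup>\<star> = unitize (fcalc f a)"
    unfolding unitize_fcalc[OF f]
    by (rule cfc_real_selfadjoint[OF unitize_selfadjoint fcalc_continuous[OF f]]) simp
  then show ?thesis by (simp add: unitize_star[symmetric] unitize_eq_iff)
qed

lemma norm_fcalc_le:
  "vanishing f \<Longrightarrow> (\<And>t. 0 \<le> t \<Longrightarrow> t \<le> norm a \<Longrightarrow> \<bar>f t\<bar> \<le> K) \<Longrightarrow> norm (fcalc f a) \<le> K"
proof -
  assume f: "vanishing f" and K: "\<And>t. 0 \<le> t \<Longrightarrow> t \<le> norm a \<Longrightarrow> \<bar>f t\<bar> \<le> K"
  have "norm (cfc (\<lambda>z. of_real (f (Re z))) (unitize a)) \<le> K"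
    by (rule cfc_norm_le[OF unitize_selfadjoint fcalc_continuous[OF f]]) (use K spec_unitizeD in auto)
  then show ?thesis using norm_unitize[of "fcalc f a"] by (simp add: unitize_fcalc[OF f])
qed

lemma fcalc_positives:
  "vanishing f \<Longrightarrow> (\<And>t. 0 \<le> t \<Longrightarrow> t \<le> norm a \<Longrightarrow> 0 \<le> f t) \<Longrightarrow> fcalc f a \<in> positives"
  unfolding positives_iff using spec_unitizeD
  by (simp add: unitize_fcalc) (rule cfc_spec_positive[OF unitize_selfadjoint fcalc_continuous], auto)

lemma fcalc_mono:
  "vanishing f \<Longrightarrow> vanishing g \<Longrightarrow> (\<And>t. 0 \<le> t \<Longrightarrow> t \<le> norm a \<Longrightarrow> f t \<le> g t) \<Longrightarrow>
    fcalc g a - fcalc f a \<in> positives"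
  by (subst fcalc_diff[symmetric]) (auto intro!: fcalc_positives simp: vanishing_def intro!: continuous_intros)

lemma fcalc_conj_le:
  assumes f: "vanishing f" and le: "\<And>t. 0 \<le> t \<Longrightarrow> t \<le> norm a \<Longrightarrow> f t \<le> 1"
  shows "x * x\<^sup>\<star> - x * fcalc f a * x\<^sup>\<star> \<in> positives"
proof -
  have c: "continuous_on (spec (unitize a)) (\<lambda>z. 1 + - 1 * complex_of_real (f (Re z)))"
    by (intro continuous_intros fcalc_continuous f)
  have "spec_positive (cfc (\<lambda>z. 1 + - 1 * complex_of_real (f (Re z))) (unitize a))"
    by (rule cfc_spec_positive[OF unitize_selfadjoint c]) (use le spec_unitizeD in auto)
  also have "cfc (\<lambda>z. 1 + - 1 * complex_of_real (f (Re z))) (unitize a) = 1 - unitize (fcalc f a)"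
    using cfc_add[OF unitize_selfadjoint, of "\<lambda>_. 1" "\<lambda>z. - 1 * complex_of_real (f (Re z))"]
      cfc_scaleC[OF unitize_selfadjoint fcalc_continuous[OF f], of "- 1"]
      cfc_const[OF unitize_selfadjoint, of 1] fcalc_continuous[OF f]
    by (simp add: unitize_fcalc f continuous_on_minus)
  finally have "spec_positive (unitize x * (1 - unitize (fcalc f a)) * (unitize x)\<^sup>\<star>)" by (rule spec_positive_conj)
  then show ?thesis by (simp add: positives_iff unitize_diff unitize_mult unitize_star algebra_simps)
qed

lemma vanishing_cut: "0 \<le> \<epsilon> \<Longrightarrow> vanishing (\<lambda>t. max (t - \<epsilon>) 0)"
  by (auto simp: vanishing_def intro!: continuous_intros)

lemma cut_down_eq: "0 \<le> \<epsilon> \<Longrightarrow> cut_down a \<epsilon> = fcalc (\<lambda>t. max (t - \<epsilon>) 0) a"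
  unfolding cut_down_def fcalc_def
  by (rule functional_calculus_eq_cfc)
    (use pos fcalc_continuous[OF vanishing_cut, of \<epsilon>] in
      \<open>auto simp: positives_def cont_vanishing_def spectrum_eq_spec\<close>)

end

lemma positives_sqrt:
  assumes "a \<in> positives" shows "\<exists>x. x\<^sup>\<star> = x \<and> x * x = a"
proof -
  have v: "vanishing sqrt" by (auto simp: vanishing_def intro!: continuous_intros)
  have "fcalc sqrt a * fcalc sqrt a = fcalc (\<lambda>t. sqrt t * sqrt t) a"
    by (rule fcalc_mult[OF assms v v, symmetric])
  also have "\<dots> = fcalc (\<lambda>t. t) a" by (rule fcalc_cong[OF assms]) simp
  finally show ?thesis using fcalc_id[OF assms] fcalc_star[OF assms v] by auto
qed

section \<open>Compressing and interpolating elements\<close>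

definition pos_le :: "'a::cstar_algebra \<Rightarrow> 'a \<Rightarrow> bool" (infix "\<sqsubseteq>" 50) where
  "a \<sqsubseteq> b \<longleftrightarrow> b - a \<in> positives"

lemma pos_le_refl [simp]: "a \<sqsubseteq> a" by (simp add: pos_le_def)

lemma zero_pos_le: "0 \<sqsubseteq> a \<longleftrightarrow> a \<in> positives" by (simp add: pos_le_def)

lemma pos_le_trans [trans]: "a \<sqsubseteq> b \<Longrightarrow> b \<sqsubseteq> c \<Longrightarrow> a \<sqsubseteq> c"
  using positives_add[of "b - a" "c - b"] by (simp add: pos_le_def)

lemma pos_le_add_mono: "a \<sqsubseteq> b \<Longrightarrow> c \<sqsubseteq> d \<Longrightarrow> a + c \<sqsubseteq> b + d"
  using positives_add[of "b - a" "d - c"] by (simp add: pos_le_def algebra_simps)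

lemma pos_le_add_right: "b \<in> positives \<Longrightarrow> a \<sqsubseteq> a + b" by (simp add: pos_le_def)

lemma pos_le_add_left: "b \<in> positives \<Longrightarrow> a \<sqsubseteq> b + a" by (simp add: pos_le_def)

lemma positives_pos_le: "a \<in> positives \<Longrightarrow> a \<sqsubseteq> b \<Longrightarrow> b \<in> positives"
  using positives_add[of a "b - a"] by (simp add: pos_le_def)

lemma pos_le_scaleR: "a \<sqsubseteq> b \<Longrightarrow> 0 \<le> r \<Longrightarrow> r *\<^sub>R a \<sqsubseteq> r *\<^sub>R b"
  using positives_scaleR[of "b - a" r] by (simp add: pos_le_def scaleR_diff_right)

lemma pos_le_scaleR_left: "a \<in> positives \<Longrightarrow> r \<le> s \<Longrightarrow> r *\<^sub>R a \<sqsubseteq> s *\<^sub>R a"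
  using positives_scaleR[of a "s - r"] by (simp add: pos_le_def scaleR_diff_left)

lemma pos_le_conj: "a \<sqsubseteq> b \<Longrightarrow> x * a * x\<^sup>\<star> \<sqsubseteq> x * b * x\<^sup>\<star>"
  using positives_conj[of "b - a" x] by (simp add: pos_le_def algebra_simps)

lemma pos_le_conj': "a \<sqsubseteq> b \<Longrightarrow> x\<^sup>\<star> * a * x \<sqsubseteq> x\<^sup>\<star> * b * x"
  using pos_le_conj[of a b "x\<^sup>\<star>"] by simp

lemma norm_mono_pos_le: "a \<in> positives \<Longrightarrow> a \<sqsubseteq> b \<Longrightarrow> norm a \<le> norm b"
  unfolding pos_le_def by (rule norm_mono_positives)

lemma pos_le_limit: "(\<And>n. x n \<sqsubseteq> b) \<Longrightarrow> x \<longlonglongrightarrow> l \<Longrightarrow> l \<sqsubseteq> b"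
  unfolding pos_le_def by (rule positives_limit[of "\<lambda>n. b - x n"]) (auto intro: tendsto_intros)

lemma vanishing_id: "vanishing (\<lambda>t. t)"
  and vanishing_mult: "vanishing f \<Longrightarrow> vanishing g \<Longrightarrow> vanishing (\<lambda>t. f t * g t)"
  and vanishing_add: "vanishing f \<Longrightarrow> vanishing g \<Longrightarrow> vanishing (\<lambda>t. f t + g t)"
  and vanishing_diff: "vanishing f \<Longrightarrow> vanishing g \<Longrightarrow> vanishing (\<lambda>t. f t - g t)"
  and vanishing_scale: "vanishing f \<Longrightarrow> vanishing (\<lambda>t. r * f t)"
  and vanishing_sqrt: "vanishing sqrt"
  by (auto simp: vanishing_def intro!: continuous_intros)

lemmas vanishing_intros = vanishing_id vanishing_mult vanishing_add vanishing_diff vanishing_scale vanishing_sqrt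

lemma fcalc_sandwich:
  assumes b: "b \<in> positives" and f: "vanishing f" and g: "vanishing g"
  shows "fcalc f b * fcalc g b * fcalc f b = fcalc (\<lambda>t. f t * g t * f t) b"
  by (simp add: fcalc_mult[OF b f g] fcalc_mult[OF b vanishing_mult[OF f g] f])

lemma fcalc_sandwich_id:
  "b \<in> positives \<Longrightarrow> vanishing f \<Longrightarrow> fcalc f b * b * fcalc f b = fcalc (\<lambda>t. f t * t * f t) b"
  using fcalc_sandwich[of b f "\<lambda>t. t"] by (simp add: fcalc_id vanishing_id)

text \<open>
  With \<open>h = f(b)\<close> one has \<open>\<parallel>x(1 - h)\<parallel>\<^sup>2 = \<parallel>(1 - h)x\<^sup>\<star>x(1 - h)\<parallel> \<le> \<parallel>(1 - h)b(1 - h)\<parallel>\<close>, and the right-hand side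
  is a function of \<open>b\<close> alone. The bound is the same for all \<open>x\<close> with \<open>x\<^sup>\<star>x \<le> b\<close>.
\<close>

lemma norm_compress_le:
  assumes b: "b \<in> positives" and x: "x\<^sup>\<star> * x \<sqsubseteq> b" and f: "vanishing f"
    and K: "\<And>t. 0 \<le> t \<Longrightarrow> t * (1 - f t)\<^sup>2 \<le> K"
  shows "(norm (x - x * fcalc f b))\<^sup>2 \<le> K"
proof -
  let ?h = "fcalc f b"
  have h: "?h\<^sup>\<star> = ?h" by (rule fcalc_star[OF b f])
  let ?y = "x - x * ?h"
  let ?g = "\<lambda>t. t - f t * t - t * f t + f t * t * f t"
  have g: "fcalc ?g b = b - ?h * b - b * ?h + ?h * b * ?h"
  proof -
    have 1: "fcalc (\<lambda>t. f t * t) b = ?h * b" "fcalc (\<lambda>t. t * f t) b = b * ?h"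
      using fcalc_mult[OF b f vanishing_id] fcalc_mult[OF b vanishing_id f] by (simp_all only: fcalc_id[OF b])
    have v: "vanishing (\<lambda>t. f t * t)" "vanishing (\<lambda>t. t * f t)" "vanishing (\<lambda>t. f t * t * f t)"
      by (intro vanishing_intros f)+
    have "fcalc ?g b = fcalc (\<lambda>t. t - f t * t - t * f t) b + fcalc (\<lambda>t. f t * t * f t) b"
      by (rule fcalc_add[OF b _ v(3)]) (intro vanishing_diff vanishing_id v)
    also have "fcalc (\<lambda>t. t - f t * t - t * f t) b = fcalc (\<lambda>t. t - f t * t) b - fcalc (\<lambda>t. t * f t) b"
      by (rule fcalc_diff[OF b _ v(2)]) (intro vanishing_diff vanishing_id v)
    also have "fcalc (\<lambda>t. t - f t * t) b = b - fcalc (\<lambda>t. f t * t) b"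
      using fcalc_diff[OF b vanishing_id v(1)] by (simp only: fcalc_id[OF b])
    finally show ?thesis by (simp only: 1 fcalc_sandwich_id[OF b f])
  qed
  have gK: "\<bar>?g t\<bar> \<le> K" if "0 \<le> t" for t
  proof -
    have "?g t = t * (1 - f t)\<^sup>2" by (simp add: power2_eq_square algebra_simps)
    then show ?thesis using K[OF that] that by simp
  qed
  have "?y\<^sup>\<star> * ?y = x\<^sup>\<star> * x - ?h * (x\<^sup>\<star> * x) - x\<^sup>\<star> * x * ?h + ?h * (x\<^sup>\<star> * x) * ?h"
    by (simp add: star_diff star_mult h algebra_simps)
  moreover have "x\<^sup>\<star> * x - ?h * (x\<^sup>\<star> * x) - x\<^sup>\<star> * x * ?h + ?h * (x\<^sup>\<star> * x) * ?h
      \<sqsubseteq> b - ?h * b - b * ?h + ?h * b * ?h"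
    using positives_conj_one_minus[of "b - x\<^sup>\<star> * x" ?h] x h
    by (simp add: pos_le_def algebra_simps)
  ultimately have "?y\<^sup>\<star> * ?y \<sqsubseteq> fcalc ?g b" by (simp only: g)
  then have "norm (?y\<^sup>\<star> * ?y) \<le> norm (fcalc ?g b)"
    by (intro norm_mono_pos_le positives_star_mult)
  also have "\<dots> \<le> K" by (rule norm_fcalc_le[OF b _ gK]) (intro vanishing_intros f)
  finally show ?thesis by (simp add: cstar_identity)
qed

text \<open>
  Each of the two hypotheses allows one replacement by \<open>b\<close> inside a norm:
  \<open>\<parallel>xhy\<parallel>\<^sup>2 = \<parallel>y\<^sup>\<star>hx\<^sup>\<star>xhy\<parallel> \<le> \<parallel>y\<^sup>\<star>hbhy\<parallel> = \<parallel>b\<^sup>1\<^sup>/\<^sup>2hyy\<^sup>\<star>hb\<^sup>1\<^sup>/\<^sup>2\<parallel> \<le> \<parallel>b\<^sup>1\<^sup>/\<^sup>2hbhb\<^sup>1\<^sup>/\<^sup>2\<parallel>\<close>, where \<open>h = d(b)\<close>.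
  Thus only \<open>t d(t)\<close> has to be small, not \<open>d\<close> itself.
\<close>

lemma norm_interpolate_le:
  assumes b: "b \<in> positives" and x: "x\<^sup>\<star> * x \<sqsubseteq> b" and y: "y * y\<^sup>\<star> \<sqsubseteq> b" and d: "vanishing d"
    and K: "\<And>t. 0 \<le> t \<Longrightarrow> \<bar>t * d t\<bar> \<le> K"
  shows "norm (x * fcalc d b * y) \<le> K"
proof -
  let ?h = "fcalc d b" and ?s = "fcalc sqrt b"
  have h: "?h\<^sup>\<star> = ?h" by (rule fcalc_star[OF b d])
  have s: "?s\<^sup>\<star> = ?s" by (rule fcalc_star[OF b vanishing_sqrt])
  have "?s * ?s = fcalc (\<lambda>t. sqrt t * sqrt t) b"
    by (rule fcalc_mult[OF b vanishing_sqrt vanishing_sqrt, symmetric])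
  also have "\<dots> = b" by (subst (2) fcalc_id[OF b, symmetric], rule fcalc_cong[OF b]) simp
  finally have ss: "?s * ?s = b" .
  have "(norm (x * ?h * y))\<^sup>2 = norm (y\<^sup>\<star> * ?h * (x\<^sup>\<star> * x) * (y\<^sup>\<star> * ?h)\<^sup>\<star>)"
    unfolding cstar_identity[symmetric] by (simp add: star_mult h mult.assoc)
  also have "\<dots> \<le> norm (y\<^sup>\<star> * ?h * b * (y\<^sup>\<star> * ?h)\<^sup>\<star>)"
    by (intro norm_mono_pos_le positives_conj positives_star_mult pos_le_conj x)
  also have "y\<^sup>\<star> * ?h * b * (y\<^sup>\<star> * ?h)\<^sup>\<star> = y\<^sup>\<star> * ?h * (?s * ?s) * (y\<^sup>\<star> * ?h)\<^sup>\<star>" by (simp only: ss)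
  also have "\<dots> = (?s * ?h * y)\<^sup>\<star> * (?s * ?h * y)"
    by (simp add: star_mult h s mult.assoc)
  also have "norm ((?s * ?h * y)\<^sup>\<star> * (?s * ?h * y)) = norm ((?s * ?h * y) * (?s * ?h * y)\<^sup>\<star>)"
    by (simp only: cstar_identity cstar_identity')
  also have "\<dots> = norm (?s * ?h * (y * y\<^sup>\<star>) * (?s * ?h)\<^sup>\<star>)"
    by (simp add: star_mult h s mult.assoc)
  also have "\<dots> \<le> norm (?s * ?h * b * (?s * ?h)\<^sup>\<star>)"
    by (intro norm_mono_pos_le positives_conj positives_mult_star pos_le_conj y)
  also have "?s * ?h * b * (?s * ?h)\<^sup>\<star> = ?s * (?h * b * ?h) * ?s"
    by (simp add: star_mult h s mult.assoc)
  also have "\<dots> = fcalc (\<lambda>t. sqrt t * (d t * t * d t) * sqrt t) b"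
    by (simp add: fcalc_sandwich_id b d fcalc_sandwich vanishing_intros)
  also have "norm \<dots> \<le> K\<^sup>2"
  proof (rule norm_fcalc_le[OF b])
    fix t :: real assume t: "0 \<le> t"
    have "sqrt t * (d t * t * d t) * sqrt t = (t * d t)\<^sup>2"
      using t by (simp add: power2_eq_square mult.assoc mult.left_commute[of "sqrt t"])
    moreover have "(t * d t)\<^sup>2 \<le> K\<^sup>2" using K[OF t] by (intro abs_le_square_iff[THEN iffD1]) linarith
    ultimately show "\<bar>sqrt t * (d t * t * d t) * sqrt t\<bar> \<le> K\<^sup>2" by simp
  qed (intro vanishing_intros d)
  finally show ?thesis by (rule power2_le_imp_le) (use K[of 0] in auto)
qed

text \<open>
  A substitute for \<open>t\<^sup>-\<^sup>1\<^sup>/\<^sup>2\<close> that is continuous on the half-line and vanishes at \<open>0\<close>.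
\<close>

definition reg_inv_sqrt :: "nat \<Rightarrow> real \<Rightarrow> real" where
  "reg_inv_sqrt k t = sqrt t / (t + 1 / (real k + 1))"

lemma vanishing_reg_inv_sqrt: "vanishing (reg_inv_sqrt k)"
proof -
  have "t + 1 / (real k + 1) \<noteq> 0" if "t \<ge> 0" for t
    using that add_nonneg_pos[of t "1 / (real k + 1)"] by auto
  then show ?thesis unfolding vanishing_def reg_inv_sqrt_def by (auto intro!: continuous_intros)
qed

lemma reg_inv_sqrt_near:
  assumes "0 \<le> t" shows "\<bar>t * reg_inv_sqrt k t - sqrt t\<bar> \<le> sqrt (1 / (real k + 1))"
proof -
  define e where "e = 1 / (real k + 1)"
  have e: "e > 0" by (simp add: e_def)
  have "t * reg_inv_sqrt k t - sqrt t = - (sqrt t * e / (t + e))"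
    using e assms unfolding reg_inv_sqrt_def e_def[symmetric] by (simp add: field_simps)
  moreover have "sqrt t * e / (t + e) \<le> sqrt e"
  proof -
    have "2 * (sqrt t * sqrt e) \<le> t + e"
      using sum_squares_bound[of "sqrt t" "sqrt e"] assms e by (simp add: mult.assoc)
    then have "sqrt t * sqrt e \<le> t + e" using assms e by simp
    then have "sqrt e * (sqrt t * sqrt e) \<le> sqrt e * (t + e)" using e by (intro mult_left_mono) auto
    moreover have "sqrt e * (sqrt t * sqrt e) = sqrt t * e" using e by (simp add: mult.left_commute[of "sqrt e"])
    ultimately have "sqrt t * e \<le> sqrt e * (t + e)" by simp
    then show ?thesis using e assms by (simp add: divide_le_eq)
  qed
  moreover have "0 \<le> sqrt t * e / (t + e)" using e assms by simp
  ultimately show ?thesis by (simp add: e_def[symmetric] abs_if)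
qed

text \<open>
  In spirit \<open>x b\<^sup>-\<^sup>1\<^sup>/\<^sup>2 y\<close>.
\<close>

definition interp :: "'a::cstar_algebra \<Rightarrow> 'a \<Rightarrow> 'a \<Rightarrow> 'a" where
  "interp b x y = lim (\<lambda>k. x * fcalc (reg_inv_sqrt k) b * y)"

lemma sqrt_inverse_tendsto_zero: "(\<lambda>k. sqrt (1 / (real k + 1))) \<longlonglongrightarrow> 0"
  using tendsto_real_sqrt[OF LIMSEQ_inverse_real_of_nat] by (simp add: inverse_eq_divide add.commute)

text \<open>
  The functions \<open>t \<mapsto> t reg_inv_sqrt k t\<close> converge to the square root uniformly on the half-line, so the
  sequence is Cauchy by the preceding estimate.
\<close>

lemma interp_tendsto:
  assumes b: "b \<in> positives" and x: "x\<^sup>\<star> * x \<sqsubseteq> b" and y: "y * y\<^sup>\<star> \<sqsubseteq> b"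
  shows "(\<lambda>k. x * fcalc (reg_inv_sqrt k) b * y) \<longlonglongrightarrow> interp b x y"
proof -
  let ?w = "\<lambda>k. x * fcalc (reg_inv_sqrt k) b * y"
  have "Cauchy ?w"
  proof (rule metric_CauchyI)
    fix e :: real assume e: "e > 0"
    from sqrt_inverse_tendsto_zero have "eventually (\<lambda>k. sqrt (1 / (real k + 1)) < e/2) sequentially"
      by (rule order_tendstoD) (use e in simp)
    then obtain N where N: "\<And>k. k \<ge> N \<Longrightarrow> sqrt (1 / (real k + 1)) < e/2"
      by (auto simp: eventually_sequentially)
    have "dist (?w k) (?w l) < e" if "k \<ge> N" "l \<ge> N" for k l
    proof -
      let ?d = "\<lambda>t. reg_inv_sqrt k t - reg_inv_sqrt l t"
      have "?w k - ?w l = x * fcalc ?d b * y"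
        by (simp add: fcalc_diff[OF b vanishing_reg_inv_sqrt vanishing_reg_inv_sqrt] algebra_simps)
      moreover have "norm (x * fcalc ?d b * y) \<le> sqrt (1 / (real k + 1)) + sqrt (1 / (real l + 1))"
      proof (rule norm_interpolate_le[OF b x y])
        fix t :: real assume "0 \<le> t"
        from reg_inv_sqrt_near[OF this, of k] reg_inv_sqrt_near[OF this, of l]
        show "\<bar>t * ?d t\<bar> \<le> sqrt (1 / (real k + 1)) + sqrt (1 / (real l + 1))"
          by (simp only: right_diff_distrib)
      qed (intro vanishing_diff vanishing_reg_inv_sqrt)
      ultimately show ?thesis using N[OF that(1)] N[OF that(2)] by (simp add: dist_norm)
    qed
    then show "\<exists>N. \<forall>m\<ge>N. \<forall>n\<ge>N. dist (?w m) (?w n) < e" by blast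
  qed
  then show ?thesis unfolding interp_def by (simp add: Cauchy_convergent_iff convergent_LIMSEQ_iff)
qed

section \<open>Finite Cuntz-Pedersen comparison\<close>

text \<open>
  The two sides \<open>\<Sum> x\<^sub>i x\<^sub>i\<^sup>\<star>\<close> and \<open>\<Sum> x\<^sub>i\<^sup>\<star> x\<^sub>i\<close> of a finite Cuntz-Pedersen equivalence. Lists are used
  because they are easily concatenated.
\<close>

definition lsum :: "'a::cstar_algebra list \<Rightarrow> 'a" where "lsum xs = (\<Sum>x\<leftarrow>xs. x * x\<^sup>\<star>)"
definition rsum :: "'a::cstar_algebra list \<Rightarrow> 'a" where "rsum xs = (\<Sum>x\<leftarrow>xs. x\<^sup>\<star> * x)"

lemma lsum_simps [simp]: "lsum [] = 0" "lsum (x # xs) = x * x\<^sup>\<star> + lsum xs" "lsum (xs @ ys) = lsum xs + lsum ys"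
  and rsum_simps [simp]: "rsum [] = 0" "rsum (x # xs) = x\<^sup>\<star> * x + rsum xs" "rsum (xs @ ys) = rsum xs + rsum ys"
  by (simp_all add: lsum_def rsum_def)

lemma lsum_map_star: "lsum (map star xs) = rsum xs" and rsum_map_star: "rsum (map star xs) = lsum xs"
  by (induction xs) simp_all

lemma lsum_positives: "lsum xs \<in> positives"
  by (induction xs) (simp_all add: positives_add positives_mult_star)

lemma rsum_positives: "rsum xs \<in> positives"
  using lsum_positives[of "map star xs"] by (simp add: lsum_map_star)

lemma member_pos_le_rsum: "x \<in> set xs \<Longrightarrow> x\<^sup>\<star> * x \<sqsubseteq> rsum xs"
  by (induction xs) (auto intro: pos_le_add_right pos_le_trans pos_le_add_left rsum_positives positives_star_mult)

lemma member_pos_le_lsum: "x \<in> set xs \<Longrightarrow> x * x\<^sup>\<star> \<sqsubseteq> lsum xs"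
  using member_pos_le_rsum[of "x\<^sup>\<star>" "map star xs"] by (auto simp: rsum_map_star)

lemma tendsto_sum_list:
  "(\<And>x. x \<in> set xs \<Longrightarrow> (\<lambda>n. f x n) \<longlonglongrightarrow> l x) \<Longrightarrow>
    (\<lambda>n. \<Sum>x\<leftarrow>xs. f x n) \<longlonglongrightarrow> (\<Sum>x\<leftarrow>xs. l x :: 'a::real_normed_vector)"
  by (induction xs) (auto intro!: tendsto_add)

lemma sum_list_pos_le_mono: "(\<And>x. x \<in> set xs \<Longrightarrow> f x \<sqsubseteq> g x) \<Longrightarrow> (\<Sum>x\<leftarrow>xs. f x) \<sqsubseteq> (\<Sum>x\<leftarrow>xs. g x)"
  by (induction xs) (auto intro: pos_le_add_mono)

lemma sum_list_swap: "(\<Sum>x\<leftarrow>xs. \<Sum>y\<leftarrow>ys. f x y) = (\<Sum>y\<leftarrow>ys. \<Sum>x\<leftarrow>xs. f x y :: 'a::comm_monoid_add)"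
  by (induction xs) (simp_all add: sum_list_addf)

lemma lsum_concat: "lsum (concat xss) = (\<Sum>xs\<leftarrow>xss. lsum xs)" and rsum_concat: "rsum (concat xss) = (\<Sum>xs\<leftarrow>xss. rsum xs)"
  by (induction xss) simp_all

lemma mult_lsum_mult: "u * lsum ys * u\<^sup>\<star> = (\<Sum>y\<leftarrow>ys. (u * y) * (u * y)\<^sup>\<star>)"
  by (induction ys) (simp_all add: star_mult algebra_simps)

lemma mult_rsum_mult: "u\<^sup>\<star> * rsum xs * u = (\<Sum>x\<leftarrow>xs. (x * u)\<^sup>\<star> * (x * u))"
  by (induction xs) (simp_all add: star_mult algebra_simps)

text \<open>
  Riesz refinement. With \<open>b = lsum ys\<close> put \<open>w\<^sub>i\<^sub>j = x\<^sub>i b\<^sup>-\<^sup>1\<^sup>/\<^sup>2 y\<^sub>j\<close>. Summing over \<open>j\<close> gives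
  \<open>\<Sum>\<^sub>j w\<^sub>i\<^sub>j w\<^sub>i\<^sub>j\<^sup>\<star> = x\<^sub>i b\<^sup>-\<^sup>1\<^sup>/\<^sup>2 b b\<^sup>-\<^sup>1\<^sup>/\<^sup>2 x\<^sub>i\<^sup>\<star> = x\<^sub>i x\<^sub>i\<^sup>\<star>\<close>, and summing over \<open>i\<close> gives
  \<open>\<Sum>\<^sub>i w\<^sub>i\<^sub>j\<^sup>\<star> w\<^sub>i\<^sub>j = y\<^sub>j\<^sup>\<star> b\<^sup>-\<^sup>1\<^sup>/\<^sup>2 (rsum xs) b\<^sup>-\<^sup>1\<^sup>/\<^sup>2 y\<^sub>j \<le> y\<^sub>j\<^sup>\<star> y\<^sub>j\<close>. The regularized inverse square
  roots make this precise in the limit.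
\<close>

lemma interpolation:
  assumes xs: "rsum xs \<sqsubseteq> lsum ys"
  shows "\<exists>ws. lsum ws = lsum xs \<and> rsum ws \<sqsubseteq> rsum ys"
proof -
  define b where "b = lsum ys"
  have b: "b \<in> positives" by (simp add: b_def lsum_positives)
  let ?g = "\<lambda>k. fcalc (reg_inv_sqrt k) b"
  let ?h = "\<lambda>k. fcalc (\<lambda>t. t / (t + 1 / (real k + 1))) b"
  have vh: "vanishing (\<lambda>t. t / (t + 1 / (real k + 1)))" for k
  proof -
    have "t + 1 / (real k + 1) \<noteq> 0" if "t \<ge> 0" for t
      using that add_nonneg_pos[of t "1 / (real k + 1)"] by auto
    then show ?thesis unfolding vanishing_def by (auto intro!: continuous_intros)
  qed
  have gs: "(?g k)\<^sup>\<star> = ?g k" "(?h k)\<^sup>\<star> = ?h k" for k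
    by (simp_all add: fcalc_star[OF b] vanishing_reg_inv_sqrt vh)
  have gbg: "?g k * b * ?g k = ?h k * ?h k" for k
  proof -
    have "?g k * b * ?g k = fcalc (\<lambda>t. reg_inv_sqrt k t * t * reg_inv_sqrt k t) b"
      by (rule fcalc_sandwich_id[OF b vanishing_reg_inv_sqrt])
    also have "\<dots> = fcalc (\<lambda>t. t / (t + 1 / (real k + 1)) * (t / (t + 1 / (real k + 1)))) b"
      by (rule fcalc_cong[OF b]) (simp add: reg_inv_sqrt_def)
    finally show ?thesis by (simp only: fcalc_mult[OF b vh vh])
  qed
  have x_le: "x\<^sup>\<star> * x \<sqsubseteq> b" if "x \<in> set xs" for x
    using member_pos_le_rsum[OF that] xs pos_le_trans unfolding b_def by blast
  have y_le: "y * y\<^sup>\<star> \<sqsubseteq> b" if "y \<in> set ys" for y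
    using member_pos_le_lsum[OF that] by (simp add: b_def)
  define ws where "ws = concat (map (\<lambda>x. map (\<lambda>y. interp b x y) ys) xs)"
  have row: "lsum (map (\<lambda>y. interp b x y) ys) = x * x\<^sup>\<star>" if x: "x \<in> set xs" for x
  proof -
    have "(\<lambda>k. \<Sum>y\<leftarrow>ys. (x * ?g k * y) * (x * ?g k * y)\<^sup>\<star>)
        \<longlonglongrightarrow> (\<Sum>y\<leftarrow>ys. interp b x y * (interp b x y)\<^sup>\<star>)"
      by (intro tendsto_sum_list tendsto_mult tendsto_star interp_tendsto b x_le[OF x] y_le)
    moreover have "(\<Sum>y\<leftarrow>ys. (x * ?g k * y) * (x * ?g k * y)\<^sup>\<star>) = (x * ?h k) * (x * ?h k)\<^sup>\<star>" for k
    proof -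
      have "(\<Sum>y\<leftarrow>ys. (x * ?g k * y) * (x * ?g k * y)\<^sup>\<star>) = x * ?g k * b * (x * ?g k)\<^sup>\<star>"
        unfolding b_def by (rule mult_lsum_mult[symmetric])
      also have "\<dots> = x * (?g k * b * ?g k) * x\<^sup>\<star>" by (simp add: star_mult gs mult.assoc)
      also have "\<dots> = x * (?h k * ?h k) * x\<^sup>\<star>" by (simp only: gbg)
      finally show ?thesis by (simp add: star_mult gs mult.assoc)
    qed
    moreover have "(\<lambda>k. (x * ?h k) * (x * ?h k)\<^sup>\<star>) \<longlonglongrightarrow> x * x\<^sup>\<star>"
    proof (intro tendsto_mult tendsto_star)
      have "norm (x - x * ?h k) \<le> sqrt (1 / (real k + 1))" for k
      proof (rule real_le_rsqrt, rule norm_compress_le[OF b x_le[OF x] vh])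
        fix t :: real assume t: "0 \<le> t"
        define e where "e = 1 / (real k + 1)"
        have e: "e > 0" by (simp add: e_def)
        have "1 - t / (t + e) = e / (t + e)" using e t by (simp add: field_simps)
        then have "t * (1 - t / (t + e))\<^sup>2 = e * ((t / (t + e)) * (e / (t + e)))"
          using e t by (simp add: power2_eq_square)
        also have "\<dots> \<le> e * (1 * 1)" using e t by (intro mult_left_mono mult_mono) auto
        finally show "t * (1 - t / (t + 1 / (real k + 1)))\<^sup>2 \<le> 1 / (real k + 1)" by (simp add: e_def)
      qed
      then have "(\<lambda>k. x * ?h k - x) \<longlonglongrightarrow> 0"
        by (intro Lim_null_comparison[OF always_eventually sqrt_inverse_tendsto_zero])
          (simp add: norm_minus_commute)
      then show "(\<lambda>k. x * ?h k) \<longlonglongrightarrow> x" "(\<lambda>k. x * ?h k) \<longlonglongrightarrow> x" by (simp_all add: LIM_zero_iff)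
    qed
    ultimately show ?thesis by (simp add: lsum_def comp_def) (rule LIMSEQ_unique)
  qed
  have col: "(\<Sum>x\<leftarrow>xs. (interp b x y)\<^sup>\<star> * interp b x y) \<sqsubseteq> y\<^sup>\<star> * y" if y: "y \<in> set ys" for y
  proof (rule pos_le_limit)
    show "(\<lambda>k. \<Sum>x\<leftarrow>xs. (x * ?g k * y)\<^sup>\<star> * (x * ?g k * y))
        \<longlonglongrightarrow> (\<Sum>x\<leftarrow>xs. (interp b x y)\<^sup>\<star> * interp b x y)"
      by (intro tendsto_sum_list tendsto_mult tendsto_star interp_tendsto b x_le y_le[OF y])
    fix k
    have "(\<Sum>x\<leftarrow>xs. (x * ?g k * y)\<^sup>\<star> * (x * ?g k * y)) = (?g k * y)\<^sup>\<star> * rsum xs * (?g k * y)"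
      unfolding mult_rsum_mult by (simp only: mult.assoc)
    also have "\<dots> \<sqsubseteq> (?g k * y)\<^sup>\<star> * b * (?g k * y)" using xs unfolding b_def by (rule pos_le_conj')
    also have "(?g k * y)\<^sup>\<star> * b * (?g k * y) = y\<^sup>\<star> * (?g k * b * ?g k) * (y\<^sup>\<star>)\<^sup>\<star>"
      by (simp add: star_mult gs mult.assoc)
    also have "\<dots> = y\<^sup>\<star> * fcalc (\<lambda>t. t / (t + 1 / (real k + 1)) * (t / (t + 1 / (real k + 1)))) b * (y\<^sup>\<star>)\<^sup>\<star>"
      unfolding gbg fcalc_mult[OF b vh vh] ..
    also have "\<dots> \<sqsubseteq> y\<^sup>\<star> * (y\<^sup>\<star>)\<^sup>\<star>"
      unfolding pos_le_def
    proof (rule fcalc_conj_le[OF b])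
      fix t :: real assume t: "0 \<le> t"
      have "t / (t + 1 / (real k + 1)) \<le> 1"
        using t add_nonneg_pos[of t "1 / (real k + 1)"] by (simp add: divide_le_eq_1)
      moreover have "0 \<le> t / (t + 1 / (real k + 1))" using t by simp
      ultimately show "t / (t + 1 / (real k + 1)) * (t / (t + 1 / (real k + 1))) \<le> 1"
        using mult_mono[of _ 1 _ 1] by fastforce
    qed (intro vanishing_mult vh)
    finally show "(\<Sum>x\<leftarrow>xs. (x * ?g k * y)\<^sup>\<star> * (x * ?g k * y)) \<sqsubseteq> y\<^sup>\<star> * y" by simp
  qed
  have "lsum ws = (\<Sum>x\<leftarrow>xs. lsum (map (\<lambda>y. interp b x y) ys))"
    by (simp add: ws_def lsum_concat comp_def)
  also have "\<dots> = lsum xs" unfolding lsum_def[of xs] by (rule arg_cong[where f=sum_list]) (simp add: row)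
  finally have "lsum ws = lsum xs" .
  moreover have "rsum ws = (\<Sum>x\<leftarrow>xs. \<Sum>y\<leftarrow>ys. (interp b x y)\<^sup>\<star> * interp b x y)"
    by (simp add: ws_def rsum_concat comp_def) (simp add: rsum_def comp_def)
  then have "rsum ws \<sqsubseteq> rsum ys"
    unfolding rsum_def[of ys] sum_list_swap[of _ ys xs] by (simp add: sum_list_pos_le_mono col)
  ultimately show ?thesis by blast
qed

text \<open>
  The proof compares cut-downs only, and for these finitely many witnesses suffice. In return sums can
  be truncated and concatenated without questions of convergence.
\<close>

definition fin_cp_le :: "'a::cstar_algebra \<Rightarrow> 'a \<Rightarrow> bool" (infix "\<preceq>\<^sub>f" 50) where
  "a \<preceq>\<^sub>f b \<longleftrightarrow> (\<exists>xs. a = lsum xs \<and> rsum xs \<sqsubseteq> b)"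

lemma fin_cp_leI: "a = lsum xs \<Longrightarrow> rsum xs \<sqsubseteq> b \<Longrightarrow> a \<preceq>\<^sub>f b"
  by (auto simp: fin_cp_le_def)

lemma fin_cp_le_positives: "a \<preceq>\<^sub>f b \<Longrightarrow> a \<in> positives" "a \<preceq>\<^sub>f b \<Longrightarrow> b \<in> positives"
  by (auto simp: fin_cp_le_def lsum_positives intro: positives_pos_le[OF rsum_positives])

lemma lsum_fin_cp_le_rsum: "lsum xs \<preceq>\<^sub>f rsum xs"
  by (rule fin_cp_leI[of _ xs]) simp_all

lemma mult_star_fin_cp_le: "x * x\<^sup>\<star> \<preceq>\<^sub>f x\<^sup>\<star> * x"
  using lsum_fin_cp_le_rsum[of "[x]"] by simp

lemma lsum_surj: assumes "b \<in> positives" shows "\<exists>x. b = lsum [x] \<and> b = rsum [x]"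
proof -
  obtain x where "x\<^sup>\<star> = x" "x * x = b" using positives_sqrt[OF assms] by blast
  then have "b = lsum [x] \<and> b = rsum [x]" by simp
  then show ?thesis ..
qed

lemma pos_le_fin_cp_le: assumes "a \<in> positives" "a \<sqsubseteq> b" shows "a \<preceq>\<^sub>f b"
  using lsum_surj[OF assms(1)] assms(2) fin_cp_leI by metis

lemma fin_cp_le_refl: "a \<in> positives \<Longrightarrow> a \<preceq>\<^sub>f a"
  by (rule pos_le_fin_cp_le) simp_all

lemma fin_cp_le_trans [trans]: assumes "a \<preceq>\<^sub>f b" "b \<preceq>\<^sub>f c" shows "a \<preceq>\<^sub>f c"
proof -
  obtain xs where xs: "a = lsum xs" "rsum xs \<sqsubseteq> b" using assms(1) by (auto simp: fin_cp_le_def)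
  obtain ys where ys: "b = lsum ys" "rsum ys \<sqsubseteq> c" using assms(2) by (auto simp: fin_cp_le_def)
  obtain ws where "lsum ws = lsum xs" "rsum ws \<sqsubseteq> rsum ys" using interpolation xs(2) ys(1) by blast
  then show ?thesis using xs(1) ys(2) by (intro fin_cp_leI[of _ ws]) (auto intro: pos_le_trans)
qed

lemma fin_cp_le_pos_le: "a \<preceq>\<^sub>f b \<Longrightarrow> b \<sqsubseteq> c \<Longrightarrow> a \<preceq>\<^sub>f c"
  unfolding fin_cp_le_def using pos_le_trans by blast

lemma pos_le_fin_cp_le_trans: "a \<in> positives \<Longrightarrow> a \<sqsubseteq> b \<Longrightarrow> b \<preceq>\<^sub>f c \<Longrightarrow> a \<preceq>\<^sub>f c"
  using fin_cp_le_trans pos_le_fin_cp_le by blast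

lemma fin_cp_le_add: assumes "a \<preceq>\<^sub>f b" "c \<preceq>\<^sub>f d" shows "a + c \<preceq>\<^sub>f b + d"
proof -
  obtain xs where xs: "a = lsum xs" "rsum xs \<sqsubseteq> b" using assms(1) by (auto simp: fin_cp_le_def)
  obtain ys where ys: "c = lsum ys" "rsum ys \<sqsubseteq> d" using assms(2) by (auto simp: fin_cp_le_def)
  show ?thesis by (rule fin_cp_leI[of _ "xs @ ys"]) (simp_all add: xs ys pos_le_add_mono)
qed

lemma fin_cp_le_scaleR: assumes "a \<preceq>\<^sub>f b" "0 \<le> r" shows "r *\<^sub>R a \<preceq>\<^sub>f r *\<^sub>R b"
proof -
  obtain xs where xs: "a = lsum xs" "rsum xs \<sqsubseteq> b" using assms(1) by (auto simp: fin_cp_le_def)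
  have "lsum (map (scaleR (sqrt r)) xs) = r *\<^sub>R lsum xs" "rsum (map (scaleR (sqrt r)) xs) = r *\<^sub>R rsum xs"
    using assms(2) by (induction xs) (simp_all add: star_scaleR scaleR_add_right)
  then show ?thesis
    using pos_le_scaleR[OF xs(2) assms(2)] by (intro fin_cp_leI[of _ "map (scaleR (sqrt r)) xs"]) (simp_all add: xs)
qed

lemma cut_down_positives: "a \<in> positives \<Longrightarrow> 0 \<le> \<epsilon> \<Longrightarrow> cut_down a \<epsilon> \<in> positives"
  by (simp add: cut_down_eq) (rule fcalc_positives, auto intro: vanishing_cut)

lemma cut_down_pos_le: "a \<in> positives \<Longrightarrow> 0 \<le> \<epsilon> \<Longrightarrow> cut_down a \<epsilon> \<sqsubseteq> a"
  using fcalc_mono[of a "\<lambda>t. max (t - \<epsilon>) 0" "\<lambda>t. t"]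
  by (simp add: cut_down_eq pos_le_def fcalc_id vanishing_id vanishing_cut)

lemma norm_diff_cut_down: assumes a: "a \<in> positives" and e: "0 \<le> \<epsilon>" shows "norm (a - cut_down a \<epsilon>) \<le> \<epsilon>"
proof -
  have "a - cut_down a \<epsilon> = fcalc (\<lambda>t. t - max (t - \<epsilon>) 0) a"
    by (simp add: cut_down_eq[OF a e] fcalc_diff[OF a vanishing_id vanishing_cut[OF a e]] fcalc_id[OF a])
  also have "norm \<dots> \<le> \<epsilon>"
    by (rule norm_fcalc_le[OF a]) (use e in \<open>auto intro!: vanishing_diff vanishing_id vanishing_cut[OF a]\<close>)
  finally show ?thesis .
qed

text \<open>
  On \<open>[0, \<parallel>a\<parallel>]\<close> the function \<open>max (t - \<epsilon>) 0\<close> stays below a line through the origin of slope less than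
  \<open>1\<close>. Cutting down therefore leaves a fixed proportion of \<open>a\<close> untouched. This slack absorbs the factor
  that a separation argument loses, and it keeps remainders comparable with \<open>a\<close>.
\<close>

lemma cut_down_pos_le_scaleR:
  assumes a: "a \<in> positives" and e: "0 < \<epsilon>" shows "\<exists>\<eta>>0. \<eta> < 1 \<and> cut_down a \<epsilon> \<sqsubseteq> (1 - \<eta>) *\<^sub>R a"
proof -
  define M where "M = norm a + 2 * \<epsilon>"
  have M: "M > 0" "M \<ge> norm a" "M > \<epsilon>" using e norm_ge_zero[of a] unfolding M_def by linarith+
  have "cut_down a \<epsilon> \<sqsubseteq> fcalc (\<lambda>t. (1 - \<epsilon> / M) * t) a"
    unfolding pos_le_def cut_down_eq[OF a less_imp_le[OF e]]
  proof (rule fcalc_mono[OF a])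
    fix t assume t: "0 \<le> t" "t \<le> norm a"
    have "t * \<epsilon> \<le> M * \<epsilon>" using t M e by (intro mult_right_mono) auto
    then have "\<epsilon> / M * t \<le> \<epsilon>" using M by (simp add: field_simps)
    moreover have "0 \<le> (1 - \<epsilon> / M) * t" using t M e by simp
    ultimately show "max (t - \<epsilon>) 0 \<le> (1 - \<epsilon> / M) * t" by (simp add: left_diff_distrib)
  qed (use e in \<open>auto intro: vanishing_cut[OF a] vanishing_scale vanishing_id\<close>)
  moreover have "fcalc (\<lambda>t. (1 - \<epsilon> / M) * t) a = (1 - \<epsilon> / M) *\<^sub>R a"
    by (simp add: fcalc_scaleR[OF a vanishing_id] fcalc_id[OF a])
  ultimately show ?thesis using M e by (intro exI[of _ "\<epsilon> / M"]) simp
qed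

text \<open>
  Let \<open>\<epsilon>' = \<parallel>a - s\<parallel> < \<epsilon>\<close>, so that \<open>a - \<epsilon>' \<le> s\<close> in the unitization. Take \<open>e = f(a)\<close> with \<open>f\<close> increasing
  from \<open>0\<close> at \<open>\<epsilon>'\<close> to \<open>1\<close> at \<open>\<epsilon>\<close>. Then \<open>(a - \<epsilon>)\<^sub>+ \<le> e(a - \<epsilon>')e \<le> ese\<close>, and \<open>ese\<close> is equivalent to
  \<open>s\<^sup>1\<^sup>/\<^sup>2e\<^sup>2s\<^sup>1\<^sup>/\<^sup>2 \<le> s\<close>.
\<close>

lemma cut_down_fin_cp_le_near:
  assumes a: "a \<in> positives" and s: "s \<in> positives" and near: "norm (a - s) < \<epsilon>"
  shows "cut_down a \<epsilon> \<preceq>\<^sub>f s"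
proof -
  define \<epsilon>' where "\<epsilon>' = norm (a - s)"
  have e: "0 \<le> \<epsilon>'" "\<epsilon>' < \<epsilon>" "0 \<le> \<epsilon>" using near norm_ge_zero[of "a - s"] by (auto simp: \<epsilon>'_def simp del: norm_ge_zero)
  define f where "f = (\<lambda>t. min 1 (max 0 ((t - \<epsilon>') / (\<epsilon> - \<epsilon>'))))"
  have f: "vanishing f" unfolding vanishing_def f_def
    using e by (auto intro!: continuous_intros simp: divide_le_0_iff)
  have f01: "0 \<le> f t" "f t \<le> 1" for t by (auto simp: f_def)
  let ?e = "fcalc f a"
  have es: "?e\<^sup>\<star> = ?e" by (rule fcalc_star[OF a f])
  have "cut_down a \<epsilon> \<sqsubseteq> fcalc (\<lambda>t. f t * t * f t - \<epsilon>' * (f t * f t)) a"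
    unfolding pos_le_def cut_down_eq[OF a e(3)]
  proof (rule fcalc_mono[OF a])
    fix t :: real assume "0 \<le> t"
    have eq: "f t * t * f t - \<epsilon>' * (f t * f t) = f t * f t * (t - \<epsilon>')" by (simp add: algebra_simps)
    consider "t \<le> \<epsilon>'" | "\<epsilon>' < t" "t \<le> \<epsilon>" | "\<epsilon> < t" by linarith
    then show "max (t - \<epsilon>) 0 \<le> f t * t * f t - \<epsilon>' * (f t * f t)"
    proof cases
      case 1
      then have "f t = 0" using e by (auto simp: f_def divide_le_0_iff)
      then show ?thesis using 1 e by simp
    next
      case 2
      then show ?thesis unfolding eq using f01[of t] by simp
    next
      case 3
      then have "f t = 1" using e by (auto simp: f_def)
      then show ?thesis using 3 e by simp
    qed
  qed (auto intro!: vanishing_intros f vanishing_cut[OF a e(3)])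
  also have "fcalc (\<lambda>t. f t * t * f t - \<epsilon>' * (f t * f t)) a = ?e * a * ?e - \<epsilon>' *\<^sub>R (?e * ?e)"
    by (simp add: fcalc_diff[OF a] fcalc_scaleR[OF a] fcalc_sandwich_id[OF a] fcalc_mult[OF a] f vanishing_intros)
  also have "\<dots> \<sqsubseteq> ?e * s * ?e"
    using positives_conj_norm[of "a - s" \<epsilon>' ?e] positives_selfadjoint[OF a] positives_selfadjoint[OF s]
    by (simp add: pos_le_def \<epsilon>'_def star_diff es algebra_simps)
  finally have 1: "cut_down a \<epsilon> \<sqsubseteq> ?e * s * ?e" .
  obtain r where r: "r\<^sup>\<star> = r" "r * r = s" using positives_sqrt[OF s] by blast
  have "?e * s * ?e = (?e * r) * (?e * r)\<^sup>\<star>" by (simp add: star_mult es r(1) r(2)[symmetric] mult.assoc)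
  also have "\<dots> \<preceq>\<^sub>f (?e * r)\<^sup>\<star> * (?e * r)" by (rule mult_star_fin_cp_le)
  finally have 2: "?e * s * ?e \<preceq>\<^sub>f r * fcalc (\<lambda>t. f t * f t) a * r\<^sup>\<star>"
    by (simp add: star_mult es r(1) mult.assoc fcalc_mult[OF a f f])
  have "r * fcalc (\<lambda>t. f t * f t) a * r\<^sup>\<star> \<sqsubseteq> r * r\<^sup>\<star>"
    unfolding pos_le_def
    by (rule fcalc_conj_le[OF a vanishing_mult[OF f f]]) (use f01 mult_mono[of _ 1 _ 1] in fastforce)
  then show ?thesis
    using fin_cp_le_pos_le[OF pos_le_fin_cp_le_trans[OF cut_down_positives[OF a e(3)] 1 2]] r by simp
qed

text \<open>
  Apply \<open>max (t - \<delta>) 0 / max t \<delta>\<close> with \<open>\<delta> \<rightarrow> 0\<close> to \<open>b\<close>: the results act more and more like a unit on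
  everything dominated by \<open>b\<close>, yet compress \<open>b\<close> below its cut-downs.
\<close>

lemma compressing_sequence:
  assumes b: "b \<in> positives"
  shows "\<exists>k. (\<forall>n. (k n)\<^sup>\<star> = k n \<and> k n * b * k n \<sqsubseteq> cut_down b (1 / (real n + 1))) \<and>
    (\<forall>x. x\<^sup>\<star> * x \<sqsubseteq> b \<longrightarrow> (\<lambda>n. x * k n) \<longlonglongrightarrow> x)"
proof -
  define f where "f = (\<lambda>n t. max (t - 1 / (real n + 1)) 0 / max t (1 / (real n + 1)))"
  have v: "vanishing (f n)" for n
  proof -
    have "max t (1 / (real n + 1)) \<noteq> 0" for t
      using less_max_iff_disj[of 0 t "1 / (real n + 1)"] by (metis divide_pos_pos less_irrefl zero_less_one of_nat_0_le_iff add_nonneg_pos)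
    then show ?thesis unfolding vanishing_def f_def by (auto intro!: continuous_intros)
  qed
  let ?k = "\<lambda>n. fcalc (f n) b"
  have "?k n * b * ?k n \<sqsubseteq> cut_down b (1 / (real n + 1))" for n
  proof -
    define d where "d = 1 / (real n + 1)"
    have d: "d > 0" by (simp add: d_def)
    have fn: "f n = (\<lambda>t. max (t - d) 0 / max t d)" unfolding f_def d_def ..
    show ?thesis
      unfolding fcalc_sandwich_id[OF b v] pos_le_def cut_down_eq[OF b less_imp_le[OF d], unfolded d_def]
    proof (rule fcalc_mono[OF b])
      fix t :: real assume t: "0 \<le> t"
      have "f n t * t * f n t \<le> max (t - d) 0"
      proof (cases "t \<le> d")
        case False
        then have "f n t * t * f n t = (t - d) * ((t - d) / t)" using d by (simp add: fn)
        also have "\<dots> \<le> (t - d) * 1" using False d by (intro mult_left_mono) (auto simp: divide_le_eq)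
        finally show ?thesis by simp
      qed (simp add: fn)
      then show "f n t * t * f n t \<le> max (t - 1 / (real n + 1)) 0" by (simp add: d_def)
    qed (auto intro!: vanishing_intros v vanishing_cut[OF b])
  qed
  moreover have "(\<lambda>n. x * ?k n) \<longlonglongrightarrow> x" if x: "x\<^sup>\<star> * x \<sqsubseteq> b" for x
  proof -
    have "norm (x - x * ?k n) \<le> sqrt (1 / (real n + 1))" for n
    proof (rule real_le_rsqrt, rule norm_compress_le[OF b x v])
      fix t :: real assume t: "0 \<le> t"
      define d where "d = 1 / (real n + 1)"
      have d: "d > 0" by (simp add: d_def)
      have fn: "f n = (\<lambda>t. max (t - d) 0 / max t d)" unfolding f_def d_def ..
      have "t * (1 - f n t)\<^sup>2 \<le> d"
      proof (cases "t \<le> d")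
        case True then show ?thesis by (simp add: fn)
      next
        case False
        then have "1 - f n t = d / t" using d by (simp add: fn field_simps)
        then have "t * (1 - f n t)\<^sup>2 = d * (d / t)" using False d by (simp add: power2_eq_square)
        also have "\<dots> \<le> d * 1" using False d by (intro mult_left_mono) auto
        finally show ?thesis by simp
      qed
      then show "t * (1 - f n t)\<^sup>2 \<le> 1 / (real n + 1)" by (simp add: d_def)
    qed
    then have "(\<lambda>n. x * ?k n - x) \<longlonglongrightarrow> 0"
      by (intro Lim_null_comparison[OF always_eventually sqrt_inverse_tendsto_zero])
        (simp add: norm_minus_commute)
    then show ?thesis by (simp add: LIM_zero_iff)
  qed
  ultimately show ?thesis using fcalc_star[OF b v] by (intro exI[of _ ?k]) blast
qed

text \<open>
  If \<open>a = \<Sum> x\<^sub>i x\<^sub>i\<^sup>\<star>\<close> with \<open>\<Sum> x\<^sub>i\<^sup>\<star> x\<^sub>i \<le> b\<close>, replace \<open>x\<^sub>i\<close> by \<open>x\<^sub>i k\<close> with a compressing element \<open>k\<close> of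
  \<open>b\<close>. The left sum changes little because there are finitely many \<open>x\<^sub>i\<close>, and the right sum drops below
  \<open>kbk\<close>.
\<close>

lemma fin_cp_le_cut_down:
  assumes ab: "a \<preceq>\<^sub>f b" and e: "0 < \<epsilon>"
  shows "\<exists>\<delta>>0. cut_down a \<epsilon> \<preceq>\<^sub>f cut_down b \<delta>"
proof -
  note pos = fin_cp_le_positives[OF ab]
  obtain xs where xs: "a = lsum xs" "rsum xs \<sqsubseteq> b" using ab by (auto simp: fin_cp_le_def)
  obtain k where k: "\<And>n. (k n)\<^sup>\<star> = k n" "\<And>n. k n * b * k n \<sqsubseteq> cut_down b (1 / (real n + 1))"
    and lim: "\<And>x. x\<^sup>\<star> * x \<sqsubseteq> b \<Longrightarrow> (\<lambda>n. x * k n) \<longlonglongrightarrow> x"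
    using compressing_sequence[OF pos(2)] by blast
  let ?ys = "\<lambda>n. map (\<lambda>x. x * k n) xs"
  have "(\<lambda>n. lsum (?ys n)) \<longlonglongrightarrow> a"
    unfolding xs(1) lsum_def map_map comp_def
    by (intro tendsto_sum_list tendsto_mult tendsto_star lim pos_le_trans[OF member_pos_le_rsum xs(2)])
  then obtain n where n: "norm (lsum (?ys n) - a) < \<epsilon>" using LIMSEQ_D[OF _ e] by blast
  have "cut_down a \<epsilon> \<preceq>\<^sub>f lsum (?ys n)"
    by (rule cut_down_fin_cp_le_near[OF pos(1) lsum_positives]) (use n in \<open>simp add: norm_minus_commute\<close>)
  also have "lsum (?ys n) \<preceq>\<^sub>f rsum (?ys n)" by (rule lsum_fin_cp_le_rsum)
  finally have 1: "cut_down a \<epsilon> \<preceq>\<^sub>f rsum (?ys n)" .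
  have "rsum (?ys n) = (k n)\<^sup>\<star> * rsum xs * k n" by (simp only: mult_rsum_mult) (simp add: rsum_def comp_def)
  also have "\<dots> \<sqsubseteq> (k n)\<^sup>\<star> * b * k n" by (rule pos_le_conj'[OF xs(2)])
  also have "\<dots> \<sqsubseteq> cut_down b (1 / (real n + 1))" using k by simp
  finally show ?thesis using fin_cp_le_pos_le[OF 1] by (intro exI[of _ "1 / (real n + 1)"]) simp
qed

section \<open>Traces and their lower semicontinuous regularization\<close>

lemma trace_zero: "is_trace \<tau> \<Longrightarrow> \<tau> 0 = 0"
proof -
  assume t: "is_trace \<tau>"
  have "\<tau> (0 *\<^sub>R 0) = ennreal 0 * \<tau> 0"
    using t positives_zero unfolding is_trace_def by blast
  then show ?thesis by simp
qed

lemma trace_add: "is_trace \<tau> \<Longrightarrow> a \<in> positives \<Longrightarrow> b \<in> positives \<Longrightarrow> \<tau> (a + b) = \<tau> a + \<tau> b"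
  by (simp add: is_trace_def)

lemma trace_scaleR: "is_trace \<tau> \<Longrightarrow> a \<in> positives \<Longrightarrow> 0 \<le> r \<Longrightarrow> \<tau> (r *\<^sub>R a) = ennreal r * \<tau> a"
  by (simp add: is_trace_def)

lemma trace_diff: "is_trace \<tau> \<Longrightarrow> a \<in> positives \<Longrightarrow> a \<sqsubseteq> b \<Longrightarrow> \<tau> b = \<tau> a + \<tau> (b - a)"
  using trace_add[of \<tau> a "b - a"] by (simp add: pos_le_def)

lemma trace_mono: "is_trace \<tau> \<Longrightarrow> a \<in> positives \<Longrightarrow> a \<sqsubseteq> b \<Longrightarrow> \<tau> a \<le> \<tau> b"
  by (subst trace_diff[of \<tau> a b]) simp_all

lemma trace_lsum: "is_trace \<tau> \<Longrightarrow> \<tau> (lsum xs) = \<tau> (rsum xs)"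
proof (induction xs)
  case (Cons x xs)
  then have "\<tau> (x * x\<^sup>\<star>) = \<tau> (x\<^sup>\<star> * x)" by (simp add: is_trace_def)
  with Cons show ?case
    by (simp add: trace_add positives_mult_star positives_star_mult lsum_positives rsum_positives)
qed simp

lemma trace_fin_cp_le: "is_trace \<tau> \<Longrightarrow> a \<preceq>\<^sub>f b \<Longrightarrow> \<tau> a \<le> \<tau> b"
  by (auto simp: fin_cp_le_def trace_lsum trace_mono rsum_positives)

text \<open>
  The largest lower semicontinuous trace below a trace.
\<close>

definition lsc_reg :: "('a::cstar_algebra \<Rightarrow> ennreal) \<Rightarrow> 'a \<Rightarrow> ennreal" where
  "lsc_reg \<tau> a = (SUP \<epsilon>\<in>{0<..}. \<tau> (cut_down a \<epsilon>))"

lemma lsc_reg_upper: "0 < \<epsilon> \<Longrightarrow> \<tau> (cut_down a \<epsilon>) \<le> lsc_reg \<tau> a"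
  unfolding lsc_reg_def by (rule SUP_upper) simp

lemma lsc_reg_least: "(\<And>\<epsilon>. 0 < \<epsilon> \<Longrightarrow> \<tau> (cut_down a \<epsilon>) \<le> K) \<Longrightarrow> lsc_reg \<tau> a \<le> K"
  unfolding lsc_reg_def by (rule SUP_least) simp

lemma lsc_reg_add_le:
  assumes "\<And>\<epsilon> \<delta>. 0 < \<epsilon> \<Longrightarrow> 0 < \<delta> \<Longrightarrow> \<tau> (cut_down a \<epsilon>) + \<tau> (cut_down b \<delta>) \<le> K"
  shows "lsc_reg \<tau> a + lsc_reg \<tau> b \<le> K"
proof -
  have "\<tau> (cut_down a \<epsilon>) + lsc_reg \<tau> b \<le> K" if "0 < \<epsilon>" for \<epsilon>
  proof -
    have "\<tau> (cut_down a \<epsilon>) + lsc_reg \<tau> b = (SUP \<delta>\<in>{0<..}. \<tau> (cut_down a \<epsilon>) + \<tau> (cut_down b \<delta>))"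
      unfolding lsc_reg_def by (rule ennreal_SUP_add_right) (simp add: ex_in_conv[symmetric] gt_ex)
    also have "\<dots> \<le> K" by (rule SUP_least) (simp add: assms that)
    finally show ?thesis .
  qed
  moreover have "lsc_reg \<tau> a + lsc_reg \<tau> b = (SUP \<epsilon>\<in>{0<..}. \<tau> (cut_down a \<epsilon>) + lsc_reg \<tau> b)"
    unfolding lsc_reg_def[of \<tau> a] by (rule ennreal_SUP_add_left[symmetric]) (simp add: ex_in_conv[symmetric] gt_ex)
  ultimately show ?thesis by (simp only:) (rule SUP_least, simp)
qed

lemma lsc_reg_le: "is_trace \<tau> \<Longrightarrow> a \<in> positives \<Longrightarrow> lsc_reg \<tau> a \<le> \<tau> a"
  by (rule lsc_reg_least) (simp add: trace_mono cut_down_positives cut_down_pos_le)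

lemma lsc_reg_mono: assumes "is_trace \<tau>" "a \<preceq>\<^sub>f b" shows "lsc_reg \<tau> a \<le> lsc_reg \<tau> b"
proof (rule lsc_reg_least)
  fix \<epsilon> :: real assume "0 < \<epsilon>"
  then obtain \<delta> where "0 < \<delta>" "cut_down a \<epsilon> \<preceq>\<^sub>f cut_down b \<delta>" using fin_cp_le_cut_down[OF assms(2)] by blast
  then show "\<tau> (cut_down a \<epsilon>) \<le> lsc_reg \<tau> b"
    using trace_fin_cp_le[OF assms(1)] lsc_reg_upper order_trans by blast
qed

lemma lsc_reg_near:
  assumes t: "is_trace \<tau>" and a: "a \<in> positives" and c: "c \<in> positives" and n: "norm (a - c) < \<epsilon>"
  shows "\<tau> (cut_down a \<epsilon>) \<le> lsc_reg \<tau> c"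
proof -
  define \<delta> where "\<delta> = (\<epsilon> - norm (a - c)) / 2"
  have d: "0 < \<delta>" using n by (simp add: \<delta>_def)
  have "norm (a - cut_down c \<delta>) \<le> norm (a - c) + norm (c - cut_down c \<delta>)"
    using norm_triangle_ineq[of "a - c" "c - cut_down c \<delta>"] by simp
  also have "\<dots> < \<epsilon>" using norm_diff_cut_down[OF c less_imp_le[OF d]] n by (simp add: \<delta>_def)
  finally have "cut_down a \<epsilon> \<preceq>\<^sub>f cut_down c \<delta>"
    by (intro cut_down_fin_cp_le_near a cut_down_positives c less_imp_le[OF d])
  then show ?thesis using trace_fin_cp_le[OF t] lsc_reg_upper[OF d] order_trans by blast
qed

text \<open>
  Superadditivity is the harder half. Write \<open>a = xx\<^sup>\<star> = x\<^sup>\<star>x\<close> and \<open>b = yy\<^sup>\<star> = y\<^sup>\<star>y\<close>. One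
  element \<open>k\<close> that compresses \<open>a + b\<close> serves both summands: \<open>xk\<^sup>2x\<^sup>\<star>\<close> is close to \<open>a\<close> and \<open>yk\<^sup>2y\<^sup>\<star>\<close> to
  \<open>b\<close>, while their sum is equivalent to \<open>k(a + b)k\<close>, which lies below a cut-down of \<open>a + b\<close>.
\<close>

lemma lsc_reg_add:
  assumes t: "is_trace \<tau>" and a: "a \<in> positives" and b: "b \<in> positives"
  shows "lsc_reg \<tau> (a + b) = lsc_reg \<tau> a + lsc_reg \<tau> b"
proof (rule antisym)
  have ab: "a + b \<in> positives" by (rule positives_add[OF a b])
  show "lsc_reg \<tau> (a + b) \<le> lsc_reg \<tau> a + lsc_reg \<tau> b"
  proof (rule lsc_reg_least)
    fix \<epsilon> :: real assume e: "0 < \<epsilon>"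
    let ?a = "cut_down a (\<epsilon> / 3)" and ?b = "cut_down b (\<epsilon> / 3)"
    have p: "?a \<in> positives" "?b \<in> positives" using e by (simp_all add: cut_down_positives a b)
    have "norm ((a - ?a) + (b - ?b)) \<le> \<epsilon> / 3 + \<epsilon> / 3"
      using e by (intro norm_triangle_mono norm_diff_cut_down a b) simp_all
    then have "cut_down (a + b) \<epsilon> \<preceq>\<^sub>f ?a + ?b"
      using e by (intro cut_down_fin_cp_le_near ab positives_add p) (simp add: algebra_simps)
    then have "\<tau> (cut_down (a + b) \<epsilon>) \<le> \<tau> (?a + ?b)" by (rule trace_fin_cp_le[OF t])
    also have "\<dots> = \<tau> ?a + \<tau> ?b" by (rule trace_add[OF t p])
    also have "\<dots> \<le> lsc_reg \<tau> a + lsc_reg \<tau> b" using e by (intro add_mono lsc_reg_upper) simp_all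
    finally show "\<tau> (cut_down (a + b) \<epsilon>) \<le> lsc_reg \<tau> a + lsc_reg \<tau> b" .
  qed
  show "lsc_reg \<tau> a + lsc_reg \<tau> b \<le> lsc_reg \<tau> (a + b)"
  proof (rule lsc_reg_add_le)
    fix \<epsilon> \<delta> :: real assume e: "0 < \<epsilon>" and d: "0 < \<delta>"
    obtain x where x: "a = lsum [x]" "a = rsum [x]" using lsum_surj[OF a] by blast
    obtain y where y: "b = lsum [y]" "b = rsum [y]" using lsum_surj[OF b] by blast
    obtain k where k: "\<And>n. (k n)\<^sup>\<star> = k n" "\<And>n. k n * (a + b) * k n \<sqsubseteq> cut_down (a + b) (1 / (real n + 1))"
      and lim: "\<And>x. x\<^sup>\<star> * x \<sqsubseteq> a + b \<Longrightarrow> (\<lambda>n. x * k n) \<longlonglongrightarrow> x"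
      using compressing_sequence[OF ab] by blast
    have "(\<lambda>n. (x * k n) * (x * k n)\<^sup>\<star>) \<longlonglongrightarrow> x * x\<^sup>\<star>"
      by (intro tendsto_mult tendsto_star lim) (use x b pos_le_add_right in auto)
    then have la: "(\<lambda>n. (x * k n) * (x * k n)\<^sup>\<star>) \<longlonglongrightarrow> a" using x by simp
    have "(\<lambda>n. (y * k n) * (y * k n)\<^sup>\<star>) \<longlonglongrightarrow> y * y\<^sup>\<star>"
      by (intro tendsto_mult tendsto_star lim) (use y a pos_le_add_left in auto)
    then have lb: "(\<lambda>n. (y * k n) * (y * k n)\<^sup>\<star>) \<longlonglongrightarrow> b" using y by simp
    have "eventually (\<lambda>n. dist ((x * k n) * (x * k n)\<^sup>\<star>) a < \<epsilon> \<and> dist ((y * k n) * (y * k n)\<^sup>\<star>) b < \<delta>) sequentially"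
      by (intro eventually_conj tendstoD la lb e d)
    then obtain n where n: "norm (a - (x * k n) * (x * k n)\<^sup>\<star>) < \<epsilon>" "norm (b - (y * k n) * (y * k n)\<^sup>\<star>) < \<delta>"
      by (auto simp: eventually_sequentially dist_norm norm_minus_commute)
    let ?c = "(x * k n) * (x * k n)\<^sup>\<star>" and ?d = "(y * k n) * (y * k n)\<^sup>\<star>"
    have "\<tau> (cut_down a \<epsilon>) + \<tau> (cut_down b \<delta>) \<le> \<tau> ?c + \<tau> ?d"
      by (intro add_mono trace_fin_cp_le[OF t] cut_down_fin_cp_le_near a b positives_mult_star n)
    also have "\<dots> = \<tau> (lsum [x * k n, y * k n])" by (simp add: trace_add[OF t] positives_mult_star)
    also have "\<dots> = \<tau> (rsum [x * k n, y * k n])" by (rule trace_lsum[OF t])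
    also have "rsum [x * k n, y * k n] = k n * (rsum [x] + rsum [y]) * k n"
      by (simp add: star_mult k algebra_simps)
    also have "\<dots> = k n * (a + b) * k n" using x y by simp
    also have "\<tau> \<dots> \<le> \<tau> (cut_down (a + b) (1 / (real n + 1)))"
      using positives_conj[OF ab, of "k n"] by (intro trace_mono[OF t] k) (simp add: k)
    also have "\<dots> \<le> lsc_reg \<tau> (a + b)" by (rule lsc_reg_upper) simp
    finally show "\<tau> (cut_down a \<epsilon>) + \<tau> (cut_down b \<delta>) \<le> lsc_reg \<tau> (a + b)" .
  qed
qed

lemma lsc_reg_scaleR_le:
  assumes t: "is_trace \<tau>" and a: "a \<in> positives" and r: "0 < r"
  shows "lsc_reg \<tau> (r *\<^sub>R a) \<le> ennreal r * lsc_reg \<tau> a"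
proof (rule lsc_reg_least)
  fix \<epsilon> :: real assume e: "0 < \<epsilon>"
  define \<delta> where "\<delta> = \<epsilon> / (2 * r)"
  have d: "0 < \<delta>" using e r by (simp add: \<delta>_def)
  have c: "cut_down a \<delta> \<in> positives" using d by (simp add: cut_down_positives a)
  have "norm (r *\<^sub>R a - r *\<^sub>R cut_down a \<delta>) = r * norm (a - cut_down a \<delta>)"
    using r by (simp flip: scaleR_diff_right)
  also have "\<dots> \<le> r * \<delta>" using norm_diff_cut_down[OF a less_imp_le[OF d]] r by (intro mult_left_mono) auto
  also have "\<dots> < \<epsilon>" using r e by (simp add: \<delta>_def)
  finally have "cut_down (r *\<^sub>R a) \<epsilon> \<preceq>\<^sub>f r *\<^sub>R cut_down a \<delta>"
    using r by (intro cut_down_fin_cp_le_near positives_scaleR a c) simp_all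
  then have "\<tau> (cut_down (r *\<^sub>R a) \<epsilon>) \<le> \<tau> (r *\<^sub>R cut_down a \<delta>)" by (rule trace_fin_cp_le[OF t])
  also have "\<dots> = ennreal r * \<tau> (cut_down a \<delta>)" using r by (simp add: trace_scaleR[OF t c])
  also have "\<dots> \<le> ennreal r * lsc_reg \<tau> a" by (intro mult_left_mono lsc_reg_upper d) simp
  finally show "\<tau> (cut_down (r *\<^sub>R a) \<epsilon>) \<le> ennreal r * lsc_reg \<tau> a" .
qed

lemma lsc_reg_scaleR:
  assumes t: "is_trace \<tau>" and a: "a \<in> positives" and r: "0 \<le> r"
  shows "lsc_reg \<tau> (r *\<^sub>R a) = ennreal r * lsc_reg \<tau> a"
proof (cases "r = 0")
  case True
  then show ?thesis using lsc_reg_le[OF t positives_zero] by (simp add: trace_zero[OF t])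
next
  case False
  then have r: "0 < r" using r by simp
  have "ennreal r * lsc_reg \<tau> ((1 / r) *\<^sub>R (r *\<^sub>R a)) \<le> ennreal r * (ennreal (1 / r) * lsc_reg \<tau> (r *\<^sub>R a))"
    using r by (intro mult_left_mono lsc_reg_scaleR_le t positives_scaleR a) simp_all
  also have "\<dots> = (ennreal r * ennreal (1 / r)) * lsc_reg \<tau> (r *\<^sub>R a)" by (simp only: mult.assoc)
  also have "ennreal r * ennreal (1 / r) = 1" using r ennreal_mult[of r "1 / r"] by simp
  finally have "ennreal r * lsc_reg \<tau> a \<le> lsc_reg \<tau> (r *\<^sub>R a)" using r by simp
  then show ?thesis using lsc_reg_scaleR_le[OF t a r] by (rule antisym[rotated])
qed

text \<open>
  Lower semicontinuity holds because a cut-down of \<open>a\<close> is already dominated, in the Cuntz-Pedersen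
  sense, by every element near \<open>a\<close>.
\<close>

lemma lsc_reg_lsc_trace:
  assumes t: "is_trace \<tau>"
  shows "lsc_reg \<tau> \<in> lsc_traces"
proof -
  have "lsc_reg \<tau> (x * x\<^sup>\<star>) = lsc_reg \<tau> (x\<^sup>\<star> * x)" for x
    using mult_star_fin_cp_le[of x] mult_star_fin_cp_le[of "x\<^sup>\<star>"]
    by (intro antisym lsc_reg_mono t) simp_all
  then have "is_trace (lsc_reg \<tau>)"
    by (simp add: is_trace_def lsc_reg_add[OF t] lsc_reg_scaleR[OF t])
  moreover have "lsc_on positives (lsc_reg \<tau>)"
    unfolding lsc_on_def closedin_closed
  proof (intro allI exI conjI)
    fix s let ?S = "{x \<in> positives. lsc_reg \<tau> x \<le> s}"
    show "closed (closure ?S)" by simp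
    have "lsc_reg \<tau> a \<le> s" if a: "a \<in> positives" "a \<in> closure ?S" for a
    proof (rule lsc_reg_least)
      fix \<epsilon> :: real assume "0 < \<epsilon>"
      then obtain c where c: "c \<in> ?S" "dist c a < \<epsilon>" using a(2) unfolding closure_approachable by blast
      then have "\<tau> (cut_down a \<epsilon>) \<le> lsc_reg \<tau> c"
        by (intro lsc_reg_near t a) (auto simp: dist_norm norm_minus_commute)
      then show "\<tau> (cut_down a \<epsilon>) \<le> s" using c by auto
    qed
    then have "positives \<inter> closure ?S \<subseteq> ?S" by (intro subsetI CollectI conjI) simp_all
    moreover have "?S \<subseteq> positives \<inter> closure ?S"
      by (intro Int_greatest closure_subset) simp
    ultimately show "?S = positives \<inter> closure ?S" by (rule antisym[rotated])
  qed
  ultimately show ?thesis by (simp add: lsc_traces_def)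
qed

lemma lsc_trace_limit_le:
  assumes "\<tau> \<in> lsc_traces" "\<And>n::nat. x n \<in> positives" "\<And>n. \<tau> (x n) \<le> t" "x \<longlonglongrightarrow> l"
  shows "\<tau> l \<le> t"
proof -
  have "closedin (top_of_set positives) {x \<in> positives. \<tau> x \<le> t}"
    using assms(1) by (simp add: lsc_traces_def lsc_on_def)
  then obtain C where C: "closed C" "{x \<in> positives. \<tau> x \<le> t} = positives \<inter> C"
    unfolding closedin_closed by blast
  have "x n \<in> C" for n using C(2) assms(2,3) by blast
  then have "l \<in> C" using C(1) assms(4) closed_sequentially by blast
  moreover have "l \<in> positives" by (rule positives_limit[OF assms(2,4)])
  ultimately show ?thesis using C(2) by blast
qed

lemma partial_sums_lsum: "(\<Sum>i<n. x i * (x i)\<^sup>\<star>) = lsum (map x [0..<n])"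
  and partial_sums_rsum: "(\<Sum>i<n. (x i)\<^sup>\<star> * x i) = rsum (map x [0..<n])"
  by (induction n) (simp_all add: add.commute)

lemma partial_sum_pos_le:
  assumes p: "\<And>i. f i \<in> positives" and s: "f sums a"
  shows "(\<Sum>i<n. f i) \<sqsubseteq> a"
proof -
  have "(\<lambda>m. (\<Sum>i<m + n. f i) - (\<Sum>i<n. f i)) \<longlonglongrightarrow> a - (\<Sum>i<n. f i)"
    using LIMSEQ_ignore_initial_segment[OF s[unfolded sums_def], of n] by (intro tendsto_intros)
  moreover have "(\<Sum>i<m + n. f i) - (\<Sum>i<n. f i) \<in> positives" for m
  proof (induction m)
    case (Suc m)
    have "(\<Sum>i<Suc m + n. f i) - (\<Sum>i<n. f i) = ((\<Sum>i<m + n. f i) - (\<Sum>i<n. f i)) + f (m + n)"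
      by simp
    then show ?case using positives_add[OF Suc p] by (simp only:)
  qed simp
  ultimately show ?thesis unfolding pos_le_def by (rule positives_limit[rotated])
qed

lemma cp_equiv_sym: "a \<sim>\<^sub>C\<^sub>P b \<Longrightarrow> b \<sim>\<^sub>C\<^sub>P a"
  unfolding cp_equiv_def by (elim exE, rule_tac x="\<lambda>i. (x i)\<^sup>\<star>" in exI) simp

text \<open>
  Traces agree on corresponding partial sums, and lower semicontinuity passes the bound to the limit.
\<close>

lemma cp_equiv_lsc_trace_le:
  assumes \<tau>: "\<tau> \<in> lsc_traces" and "a \<sim>\<^sub>C\<^sub>P b"
  shows "\<tau> a \<le> \<tau> b"
proof -
  have t: "is_trace \<tau>" using \<tau> by (simp add: lsc_traces_def)
  obtain x where x: "(\<lambda>i. x i * (x i)\<^sup>\<star>) sums a" "(\<lambda>i. (x i)\<^sup>\<star> * x i) sums b"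
    using assms(2) by (auto simp: cp_equiv_def)
  show ?thesis
  proof (rule lsc_trace_limit_le[OF \<tau>])
    show "(\<lambda>n. \<Sum>i<n. x i * (x i)\<^sup>\<star>) \<longlonglongrightarrow> a" using x(1) by (simp add: sums_def)
    fix n
    show "(\<Sum>i<n. x i * (x i)\<^sup>\<star>) \<in> positives" by (simp add: partial_sums_lsum lsum_positives)
    have "\<tau> (\<Sum>i<n. x i * (x i)\<^sup>\<star>) = \<tau> (\<Sum>i<n. (x i)\<^sup>\<star> * x i)"
      by (simp only: partial_sums_lsum partial_sums_rsum trace_lsum[OF t])
    also have "\<dots> \<le> \<tau> b"
      by (intro trace_mono[OF t] partial_sum_pos_le x positives_star_mult)
        (simp add: partial_sums_rsum rsum_positives)
    finally show "\<tau> (\<Sum>i<n. x i * (x i)\<^sup>\<star>) \<le> \<tau> b" .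
  qed
qed

lemma cp_equiv_lsc_trace_eq: "\<tau> \<in> lsc_traces \<Longrightarrow> a \<sim>\<^sub>C\<^sub>P b \<Longrightarrow> \<tau> a = \<tau> b"
  using cp_equiv_lsc_trace_le cp_equiv_sym by (metis antisym)

lemma lsum_cp_equiv_rsum: "lsum xs \<sim>\<^sub>C\<^sub>P rsum xs"
proof -
  define x where "x = (\<lambda>i. if i < length xs then xs ! i else 0)"
  have m: "map x [0..<length xs] = xs" by (rule nth_equalityI) (simp_all add: x_def)
  have "(\<lambda>i. x i * (x i)\<^sup>\<star>) sums (\<Sum>i<length xs. x i * (x i)\<^sup>\<star>)"
    "(\<lambda>i. (x i)\<^sup>\<star> * x i) sums (\<Sum>i<length xs. (x i)\<^sup>\<star> * x i)"
    by (intro sums_finite; simp add: x_def)+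
  then show ?thesis unfolding cp_equiv_def partial_sums_lsum partial_sums_rsum m by blast
qed

lemma fin_cp_le_imp_cp_le: "a \<preceq>\<^sub>f b \<Longrightarrow> a \<preceq>\<^sub>C\<^sub>P b"
  unfolding fin_cp_le_def cp_le_def pos_le_def using lsum_cp_equiv_rsum rsum_positives by blast

section \<open>Linear functionals below a sublinear one\<close>

definition sublinear_on :: "'a::real_vector set \<Rightarrow> ('a \<Rightarrow> real) \<Rightarrow> bool" where
  "sublinear_on V q \<longleftrightarrow> (\<forall>x\<in>V. \<forall>y\<in>V. q (x + y) \<le> q x + q y) \<and> (\<forall>x\<in>V. \<forall>r>0. q (r *\<^sub>R x) \<le> r * q x)"

lemma sublinear_onD:
  assumes "sublinear_on V q"
  shows "x \<in> V \<Longrightarrow> y \<in> V \<Longrightarrow> q (x + y) \<le> q x + q y" and "x \<in> V \<Longrightarrow> 0 < r \<Longrightarrow> q (r *\<^sub>R x) \<le> r * q x"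
  using assms by (auto simp: sublinear_on_def)

lemma sublinear_on_scaleR:
  assumes V: "subspace V" and q: "sublinear_on V q" and x: "x \<in> V" and r: "0 \<le> r"
  shows "q (r *\<^sub>R x) = r * q x"
proof (cases "r = 0")
  case False
  then have r: "0 < r" using r by simp
  have "q ((1 / r) *\<^sub>R (r *\<^sub>R x)) \<le> (1 / r) * q (r *\<^sub>R x)"
    by (rule sublinear_onD(2)[OF q]) (use r subspace_scale[OF V x] in simp_all)
  then have "r * q x \<le> q (r *\<^sub>R x)" using r by (simp add: field_simps)
  then show ?thesis using sublinear_onD(2)[OF q x r] by simp
next
  case True
  have "q ((1 / 2) *\<^sub>R 0) \<le> (1 / 2) * q 0" "q (2 *\<^sub>R 0) \<le> 2 * q 0"
    by (rule sublinear_onD(2)[OF q]; simp add: subspace_0[OF V])+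
  then show ?thesis using True by simp
qed

lemma sublinear_on_minus:
  assumes V: "subspace V" and q: "sublinear_on V q" and x: "x \<in> V"
  shows "- q (- x) \<le> q x"
proof -
  have "q (x + - x) \<le> q x + q (- x)" using x subspace_neg[OF V] by (intro sublinear_onD(1)[OF q])
  moreover have "q 0 = 0" using sublinear_on_scaleR[OF V q x, of 0] by simp
  ultimately show ?thesis by simp
qed

text \<open>
  The greatest sublinear functional below \<open>q\<close> whose value at \<open>- w\<close> is at most \<open>- q w\<close>.
\<close>

definition lower_along :: "('a::real_vector \<Rightarrow> real) \<Rightarrow> 'a \<Rightarrow> 'a \<Rightarrow> real" where
  "lower_along q w x = (INF t\<in>{0..}. q (x + t *\<^sub>R w) - t * q w)"

lemma lower_along:
  assumes V: "subspace V" and q: "sublinear_on V q" and w: "w \<in> V"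
  shows "sublinear_on V (lower_along q w)"
    and "x \<in> V \<Longrightarrow> lower_along q w x \<le> q x"
    and "lower_along q w (- w) \<le> - q w"
proof -
  have bdd: "bdd_below ((\<lambda>t. q (x + t *\<^sub>R w) - t * q w) ` {0..})" if x: "x \<in> V" for x
  proof (rule bdd_belowI2)
    fix t :: real assume t: "t \<in> {0..}"
    have "t * q w = q ((x + t *\<^sub>R w) + - x)" using sublinear_on_scaleR[OF V q w, of t] t by simp
    also have "\<dots> \<le> q (x + t *\<^sub>R w) + q (- x)"
      by (intro sublinear_onD(1)[OF q] subspace_add[OF V] subspace_scale[OF V] subspace_neg[OF V] x w)
    finally show "- q (- x) \<le> q (x + t *\<^sub>R w) - t * q w" by simp
  qed
  have le: "lower_along q w x \<le> q (x + t *\<^sub>R w) - t * q w" if "x \<in> V" "0 \<le> t" for x t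
    unfolding lower_along_def by (rule cINF_lower[OF bdd[OF that(1)]]) (use that in simp)
  have ge: "K \<le> lower_along q w x" if "\<And>t. 0 \<le> t \<Longrightarrow> K \<le> q (x + t *\<^sub>R w) - t * q w" for x K
    unfolding lower_along_def by (rule cINF_greatest) (use that in auto)
  show "x \<in> V \<Longrightarrow> lower_along q w x \<le> q x" using le[of x 0] by simp
  have "q 0 = 0" using sublinear_on_scaleR[OF V q w, of 0] by simp
  then show "lower_along q w (- w) \<le> - q w" using le[of "- w" 1] subspace_neg[OF V w] by simp
  show "sublinear_on V (lower_along q w)"
    unfolding sublinear_on_def
  proof (intro conjI ballI allI impI)
    fix x y assume x: "x \<in> V" and y: "y \<in> V"
    have *: "lower_along q w (x + y) \<le> (q (x + t *\<^sub>R w) - t * q w) + (q (y + s *\<^sub>R w) - s * q w)"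
      if "0 \<le> t" "0 \<le> s" for t s
    proof -
      have "lower_along q w (x + y) \<le> q ((x + y) + (t + s) *\<^sub>R w) - (t + s) * q w"
        by (rule le) (use that subspace_add[OF V x y] in simp_all)
      also have "(x + y) + (t + s) *\<^sub>R w = (x + t *\<^sub>R w) + (y + s *\<^sub>R w)" by (simp add: scaleR_add_left)
      also have "q \<dots> \<le> q (x + t *\<^sub>R w) + q (y + s *\<^sub>R w)"
        by (intro sublinear_onD(1)[OF q] subspace_add[OF V] subspace_scale[OF V] x y w)
      finally show ?thesis by (simp add: algebra_simps)
    qed
    have "lower_along q w (x + y) - (q (y + s *\<^sub>R w) - s * q w) \<le> lower_along q w x" if "0 \<le> s" for s
      by (rule ge) (use *[OF _ that] in \<open>simp add: algebra_simps\<close>)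
    then have "lower_along q w (x + y) - lower_along q w x \<le> q (y + s *\<^sub>R w) - s * q w" if "0 \<le> s" for s
      using that by (simp add: algebra_simps)
    from ge[OF this] show "lower_along q w (x + y) \<le> lower_along q w x + lower_along q w y" by simp
  next
    fix x and r :: real assume x: "x \<in> V" and r: "0 < r"
    have "lower_along q w (r *\<^sub>R x) / r \<le> lower_along q w x"
    proof (rule ge)
      fix t :: real assume t: "0 \<le> t"
      have "lower_along q w (r *\<^sub>R x) \<le> q (r *\<^sub>R x + (r * t) *\<^sub>R w) - (r * t) * q w"
        by (rule le) (use r t subspace_scale[OF V x] in simp_all)
      also have "r *\<^sub>R x + (r * t) *\<^sub>R w = r *\<^sub>R (x + t *\<^sub>R w)" by (simp add: scaleR_add_right)
      also have "q \<dots> \<le> r * q (x + t *\<^sub>R w)"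
        by (intro sublinear_onD(2)[OF q] subspace_add[OF V] subspace_scale[OF V] x w r)
      finally show "lower_along q w (r *\<^sub>R x) / r \<le> q (x + t *\<^sub>R w) - t * q w"
        using r by (simp add: field_simps)
    qed
    then show "lower_along q w (r *\<^sub>R x) \<le> r * lower_along q w x" using r by (simp add: field_simps)
  qed
qed

text \<open>
  Zorn's lemma: the pointwise infimum of a chain is finite because every member \<open>q\<close> satisfies
  \<open>q x \<ge> - q (- x) \<ge> - p (- x)\<close>, and subadditivity of the infimum holds because any two members can be
  replaced by the smaller one. Functionals are normalized to \<open>0\<close> outside \<open>V\<close> to make the order
  antisymmetric.
\<close>

lemma minimal_sublinear:
  assumes V: "subspace V" and p: "sublinear_on V p"
  shows "\<exists>m. sublinear_on V m \<and> (\<forall>x\<in>V. m x \<le> p x) \<and>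
    (\<forall>q. sublinear_on V q \<longrightarrow> (\<forall>x\<in>V. q x \<le> m x) \<longrightarrow> (\<forall>x\<in>V. q x = m x))"
proof -
  define Q where "Q = {q. sublinear_on V q \<and> (\<forall>x\<in>V. q x \<le> p x) \<and> (\<forall>x. x \<notin> V \<longrightarrow> q x = 0)}"
  define restr where "restr = (\<lambda>(q :: 'a \<Rightarrow> real) x. if x \<in> V then q x else 0)"
  have restr: "sublinear_on V (restr q)" if "sublinear_on V q" for q
    using that subspace_add[OF V] subspace_scale[OF V] by (simp add: sublinear_on_def restr_def)
  let ?P = "\<lambda>q r. \<forall>x::'a. r x \<le> (q x :: real)"
  have "\<exists>m\<in>Q. \<forall>q\<in>Q. ?P m q \<longrightarrow> q = m"
  proof (rule predicate_Zorn)
    show "partial_order_on Q (relation_of ?P Q)"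
      by (rule partial_order_on_relation_ofI) (auto intro: order_trans intro!: ext antisym)
  next
    fix C assume "C \<in> Chains (relation_of ?P Q)"
    then have CQ: "C \<subseteq> Q" and chain: "\<And>q r. q \<in> C \<Longrightarrow> r \<in> C \<Longrightarrow> ?P q r \<or> ?P r q"
      by (auto simp: Chains_def relation_of_def)
    show "\<exists>u\<in>Q. \<forall>q\<in>C. ?P q u"
    proof (cases "C = {}")
      case True
      have "restr p \<in> Q" using restr[OF p] by (auto simp: Q_def restr_def)
      then show ?thesis using True by blast
    next
      case False
      define u where "u = restr (\<lambda>x. INF q\<in>C. q x)"
      have C: "sublinear_on V q" "x \<in> V \<Longrightarrow> q x \<le> p x" "x \<notin> V \<Longrightarrow> q x = 0" if "q \<in> C" for q x
        using that CQ by (auto simp: Q_def)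
      have bdd: "bdd_below ((\<lambda>q. q x) ` C)" if x: "x \<in> V" for x
      proof (rule bdd_belowI2)
        fix q assume q: "q \<in> C"
        show "- p (- x) \<le> q x"
          using sublinear_on_minus[OF V C(1)[OF q] x] C(2)[OF q subspace_neg[OF V x]] by simp
      qed
      have le: "u x \<le> q x" if "q \<in> C" "x \<in> V" for q x
        using cINF_lower[OF bdd[OF that(2)] that(1)] that(2) by (simp add: u_def restr_def)
      have ge: "K \<le> u x" if "\<And>q. q \<in> C \<Longrightarrow> K \<le> q x" "x \<in> V" for K x
        using cINF_greatest[OF False that(1)] that(2) by (simp add: u_def restr_def)
      have "sublinear_on V u"
        unfolding sublinear_on_def
      proof (intro conjI ballI allI impI)
        fix x y assume x: "x \<in> V" and y: "y \<in> V"
        have *: "u (x + y) \<le> q1 x + q2 y" if q: "q1 \<in> C" "q2 \<in> C" for q1 q2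
        proof -
          obtain q where q': "q \<in> C" "q x \<le> q1 x" "q y \<le> q2 y"
            using chain[OF q] q by (metis order_refl)
          have "u (x + y) \<le> q (x + y)" by (rule le[OF q'(1) subspace_add[OF V x y]])
          also have "\<dots> \<le> q x + q y" by (rule sublinear_onD(1)[OF C(1)[OF q'(1)] x y])
          finally show ?thesis using q' by simp
        qed
        have "u (x + y) - q2 y \<le> u x" if "q2 \<in> C" for q2
          by (rule ge[OF _ x]) (use *[OF _ that] in \<open>simp add: algebra_simps\<close>)
        then have "u (x + y) - u x \<le> q2 y" if "q2 \<in> C" for q2 using that by (simp add: algebra_simps)
        then have "u (x + y) - u x \<le> u y" by (rule ge[OF _ y])
        then show "u (x + y) \<le> u x + u y" by simp
      next
        fix x and r :: real assume x: "x \<in> V" and r: "0 < r"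
        have "u (r *\<^sub>R x) / r \<le> u x"
        proof (rule ge[OF _ x])
          fix q assume q: "q \<in> C"
          have "u (r *\<^sub>R x) \<le> q (r *\<^sub>R x)" by (rule le[OF q subspace_scale[OF V x]])
          also have "\<dots> \<le> r * q x" by (rule sublinear_onD(2)[OF C(1)[OF q] x r])
          finally show "u (r *\<^sub>R x) / r \<le> q x" using r by (simp add: field_simps)
        qed
        then show "u (r *\<^sub>R x) \<le> r * u x" using r by (simp add: field_simps)
      qed
      moreover obtain q0 where q0: "q0 \<in> C" using False by blast
      then have "\<forall>x\<in>V. u x \<le> p x" using le C(2) order_trans by blast
      moreover have u0: "\<forall>x. x \<notin> V \<longrightarrow> u x = 0" by (simp add: u_def restr_def)
      ultimately have "u \<in> Q" by (simp add: Q_def)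
      moreover have "?P q u" if "q \<in> C" for q
        using le[OF that] C(3)[OF that] u0 by (metis order_refl)
      ultimately show ?thesis by blast
    qed
  qed
  then obtain m where m: "m \<in> Q" and min: "\<And>q. q \<in> Q \<Longrightarrow> ?P m q \<Longrightarrow> q = m" by blast
  have "\<forall>x\<in>V. q x = m x" if q: "sublinear_on V q" "\<forall>x\<in>V. q x \<le> m x" for q
  proof -
    have "restr q \<in> Q" using restr[OF q(1)] q(2) m by (force simp: Q_def restr_def)
    moreover have "?P m (restr q)" using q(2) m by (simp add: restr_def Q_def)
    ultimately have "restr q = m" by (rule min)
    then show ?thesis by (auto simp: restr_def)
  qed
  then show ?thesis using m by (auto simp: Q_def)
qed

text \<open>
  A minimal sublinear functional \<open>m\<close> is linear, since lowering it along any \<open>w\<close> cannot change it and so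
  \<open>m (- w) = - m w\<close>. Starting from \<open>p\<close> lowered along \<open>v\<close> fixes the value at \<open>v\<close>.
\<close>

lemma hahn_banach_sublinear:
  assumes V: "subspace V" and p: "sublinear_on V p" and v: "v \<in> V"
  shows "\<exists>f. (\<forall>x\<in>V. f x \<le> p x) \<and> (\<forall>x\<in>V. \<forall>y\<in>V. f (x + y) = f x + f y) \<and>
    (\<forall>x\<in>V. \<forall>r. f (r *\<^sub>R x) = r * f x) \<and> f v = p v"
proof -
  note pv = lower_along[OF V p v]
  obtain m where m': "sublinear_on V m \<and> (\<forall>x\<in>V. m x \<le> lower_along p v x) \<and>
    (\<forall>q. sublinear_on V q \<longrightarrow> (\<forall>x\<in>V. q x \<le> m x) \<longrightarrow> (\<forall>x\<in>V. q x = m x))"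
    using minimal_sublinear[OF V pv(1)] by (elim exE)
  then have m: "sublinear_on V m" "\<And>x. x \<in> V \<Longrightarrow> m x \<le> lower_along p v x" by simp_all
  have min: "q x = m x" if "sublinear_on V q" "\<And>x. x \<in> V \<Longrightarrow> q x \<le> m x" "x \<in> V" for q x
    using m'[THEN conjunct2, THEN conjunct2, rule_format, OF that(1) _ that(3)] that(2) by simp
  have odd: "m (- w) = - m w" if w: "w \<in> V" for w
  proof -
    have nw: "- w \<in> V" by (rule subspace_neg[OF V w])
    have "lower_along m w (- w) = m (- w)"
      by (rule min[OF lower_along(1)[OF V m(1) w] lower_along(2)[OF V m(1) w] nw])
    then have "m (- w) \<le> - m w" using lower_along(3)[OF V m(1) w] by simp
    then show ?thesis using sublinear_on_minus[OF V m(1) w] by simp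
  qed
  have add: "m (x + y) = m x + m y" if x: "x \<in> V" and y: "y \<in> V" for x y
  proof -
    have "m ((x + y) + - y) \<le> m (x + y) + m (- y)"
      by (intro sublinear_onD(1)[OF m(1)] subspace_add[OF V] subspace_neg[OF V] x y)
    then show ?thesis using odd[OF y] sublinear_onD(1)[OF m(1) x y] by simp
  qed
  have scale: "m (r *\<^sub>R x) = r * m x" if x: "x \<in> V" for r x
  proof (cases "0 \<le> r")
    case True then show ?thesis by (rule sublinear_on_scaleR[OF V m(1) x])
  next
    case False
    then have "m ((- r) *\<^sub>R x) = - r * m x" by (intro sublinear_on_scaleR[OF V m(1) x]) simp
    then show ?thesis using odd[OF subspace_scale[OF V x, of r]] by simp
  qed
  have le: "m x \<le> p x" if "x \<in> V" for x using m(2)[OF that] pv(2)[OF that] by simp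
  have "m (- v) \<le> - p v" using m(2)[OF subspace_neg[OF V v]] pv(3) by simp
  then have "m v = p v" using odd[OF v] le[OF v] by simp
  then show ?thesis using le add scale by (intro exI[of _ m] conjI ballI allI) simp_all
qed

section \<open>Separation by traces\<close>

text \<open>
  A trace that is finite at \<open>b\<close> is finite on all these elements, while elsewhere it may be infinite.
\<close>

definition cp_ideal :: "'a::cstar_algebra \<Rightarrow> 'a set" where
  "cp_ideal b = {x. \<exists>s\<ge>0. x \<preceq>\<^sub>f s *\<^sub>R b}"

lemma cp_idealI: "x \<preceq>\<^sub>f s *\<^sub>R b \<Longrightarrow> 0 \<le> s \<Longrightarrow> x \<in> cp_ideal b"
  by (auto simp: cp_ideal_def)

lemma cp_ideal_positives: "x \<in> cp_ideal b \<Longrightarrow> x \<in> positives"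
  by (auto simp: cp_ideal_def fin_cp_le_positives)

lemma cp_ideal_add: "x \<in> cp_ideal b \<Longrightarrow> y \<in> cp_ideal b \<Longrightarrow> x + y \<in> cp_ideal b"
proof -
  assume "x \<in> cp_ideal b" "y \<in> cp_ideal b"
  then obtain s t where "0 \<le> s" "x \<preceq>\<^sub>f s *\<^sub>R b" "0 \<le> t" "y \<preceq>\<^sub>f t *\<^sub>R b" by (auto simp: cp_ideal_def)
  then show ?thesis using fin_cp_le_add[of x "s *\<^sub>R b" y "t *\<^sub>R b"]
    by (intro cp_idealI[of _ "s + t"]) (simp_all add: scaleR_add_left)
qed

lemma cp_ideal_scaleR: "x \<in> cp_ideal b \<Longrightarrow> 0 \<le> r \<Longrightarrow> r *\<^sub>R x \<in> cp_ideal b"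
proof -
  assume "x \<in> cp_ideal b" and r: "0 \<le> r"
  then obtain s where "0 \<le> s" "x \<preceq>\<^sub>f s *\<^sub>R b" by (auto simp: cp_ideal_def)
  then show ?thesis using fin_cp_le_scaleR[of x "s *\<^sub>R b" r] r
    by (intro cp_idealI[of _ "r * s"]) simp_all
qed

lemma cp_ideal_hereditary: "y \<in> cp_ideal b \<Longrightarrow> x \<preceq>\<^sub>f y \<Longrightarrow> x \<in> cp_ideal b"
  by (auto simp: cp_ideal_def intro: fin_cp_le_trans)

lemma cp_ideal_zero: "b \<in> positives \<Longrightarrow> 0 \<in> cp_ideal b"
  using fin_cp_le_refl[OF positives_zero] by (intro cp_idealI[of _ 0]) simp_all

lemma cp_ideal_self: "b \<in> positives \<Longrightarrow> b \<in> cp_ideal b"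
  by (intro cp_idealI[of _ 1]) (simp_all add: fin_cp_le_refl)

lemma trace_of_ideal_functional:
  fixes f :: "'a::cstar_algebra \<Rightarrow> real"
  assumes b: "b \<in> positives"
    and nonneg: "\<And>x. x \<in> cp_ideal b \<Longrightarrow> 0 \<le> f x"
    and add: "\<And>x y. x \<in> cp_ideal b \<Longrightarrow> y \<in> cp_ideal b \<Longrightarrow> f (x + y) = f x + f y"
    and scale: "\<And>x r. x \<in> cp_ideal b \<Longrightarrow> 0 \<le> r \<Longrightarrow> f (r *\<^sub>R x) = r * f x"
    and star: "\<And>x. x * x\<^sup>\<star> \<in> cp_ideal b \<Longrightarrow> f (x * x\<^sup>\<star>) = f (x\<^sup>\<star> * x)"
  shows "is_trace (\<lambda>x. if x \<in> cp_ideal b then ennreal (f x) else top)" (is "is_trace ?\<tau>")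
  unfolding is_trace_def
proof (intro conjI ballI allI impI)
  fix x y :: 'a assume x: "x \<in> positives" and y: "y \<in> positives"
  show "?\<tau> (x + y) = ?\<tau> x + ?\<tau> y"
  proof (cases "x \<in> cp_ideal b \<and> y \<in> cp_ideal b")
    case True
    then show ?thesis using cp_ideal_add[of x b y] by (simp add: add nonneg ennreal_plus)
  next
    case False
    then have "x + y \<notin> cp_ideal b"
      using cp_ideal_hereditary[of "x + y" b] pos_le_fin_cp_le[OF x pos_le_add_right[OF y]]
        pos_le_fin_cp_le[OF y pos_le_add_left[OF x]] by blast
    then show ?thesis using False by auto
  qed
next
  fix x :: 'a and r :: real assume x: "x \<in> positives" and r: "0 \<le> r"
  show "?\<tau> (r *\<^sub>R x) = ennreal r * ?\<tau> x"
  proof (cases "x \<in> cp_ideal b")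
    case True
    then show ?thesis using cp_ideal_scaleR[OF True r] by (simp add: scale r nonneg ennreal_mult)
  next
    case x': False
    show ?thesis
    proof (cases "r = 0")
      case True
      have "f 0 = 0" using scale[OF cp_ideal_zero[OF b], of 0] by simp
      then show ?thesis using True cp_ideal_zero[OF b] by simp
    next
      case False
      then have r: "0 < r" using r by simp
      have "r *\<^sub>R x \<notin> cp_ideal b"
      proof
        assume "r *\<^sub>R x \<in> cp_ideal b"
        from cp_ideal_scaleR[OF this, of "1 / r"] show False using r x' by simp
      qed
      then show ?thesis using x' r by (simp add: ennreal_mult_top)
    qed
  qed
next
  fix x :: 'a
  have "x * x\<^sup>\<star> \<in> cp_ideal b \<longleftrightarrow> x\<^sup>\<star> * x \<in> cp_ideal b"
    using cp_ideal_hereditary mult_star_fin_cp_le[of x] mult_star_fin_cp_le[of "x\<^sup>\<star>"] by auto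
  then show "?\<tau> (x * x\<^sup>\<star>) = ?\<tau> (x\<^sup>\<star> * x)" using star[of x] by simp
qed

lemma fin_cp_le_iterate:
  assumes step: "a + z \<preceq>\<^sub>f z + c" and z: "z \<in> positives" and a: "a \<in> positives" and c: "c \<in> positives"
  shows "real n *\<^sub>R a + z \<preceq>\<^sub>f z + real n *\<^sub>R c"
proof (induction n)
  case 0
  then show ?case using fin_cp_le_refl[OF z] by simp
next
  case (Suc n)
  have "real (Suc n) *\<^sub>R a + z = a + (real n *\<^sub>R a + z)" by (simp add: scaleR_add_left algebra_simps)
  also have "\<dots> \<preceq>\<^sub>f a + (z + real n *\<^sub>R c)" by (intro fin_cp_le_add fin_cp_le_refl a Suc)
  also have "a + (z + real n *\<^sub>R c) = (a + z) + real n *\<^sub>R c" by (simp add: add.assoc)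
  also have "\<dots> \<preceq>\<^sub>f (z + c) + real n *\<^sub>R c"
    by (intro fin_cp_le_add step fin_cp_le_refl positives_scaleR c) simp
  also have "(z + c) + real n *\<^sub>R c = z + real (Suc n) *\<^sub>R c" by (simp add: scaleR_add_left algebra_simps)
  finally show ?case .
qed

text \<open>
  Iterating \<open>a + z \<preceq> z + sb\<close> gives \<open>na \<preceq> z + nsb\<close> for all \<open>n\<close> with the same \<open>z\<close>. As \<open>z\<close> is dominated by
  \<open>rb\<close>, division by \<open>n\<close> makes its contribution \<open>r/n\<close> as small as desired.
\<close>

lemma fin_cp_le_cancel:
  assumes step: "a + z \<preceq>\<^sub>f z + s *\<^sub>R b" and z: "z \<in> cp_ideal b"
    and a: "a \<in> positives" and b: "b \<in> positives" and s: "0 \<le> s" "s < t"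
  shows "a \<preceq>\<^sub>f t *\<^sub>R b"
proof -
  obtain r where r: "0 \<le> r" "z \<preceq>\<^sub>f r *\<^sub>R b" using z by (auto simp: cp_ideal_def)
  have zp: "z \<in> positives" by (rule cp_ideal_positives[OF z])
  obtain n :: nat where n: "r / (t - s) < real n" using reals_Archimedean2 by blast
  have n0: "0 < real n" using n r s by (smt (verit) divide_nonneg_pos)
  have sb: "s *\<^sub>R b \<in> positives" by (rule positives_scaleR[OF b s(1)])
  have "real n *\<^sub>R a \<preceq>\<^sub>f real n *\<^sub>R a + z"
    by (intro pos_le_fin_cp_le positives_scaleR a pos_le_add_right zp) simp
  also have "\<dots> \<preceq>\<^sub>f z + real n *\<^sub>R (s *\<^sub>R b)" by (rule fin_cp_le_iterate[OF step zp a sb])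
  also have "\<dots> \<preceq>\<^sub>f r *\<^sub>R b + real n *\<^sub>R (s *\<^sub>R b)"
    by (intro fin_cp_le_add r fin_cp_le_refl positives_scaleR sb) simp
  also have "r *\<^sub>R b + real n *\<^sub>R (s *\<^sub>R b) = (r + real n * s) *\<^sub>R b" by (simp add: scaleR_add_left)
  finally have "(1 / real n) *\<^sub>R (real n *\<^sub>R a) \<preceq>\<^sub>f (1 / real n) *\<^sub>R ((r + real n * s) *\<^sub>R b)"
    by (rule fin_cp_le_scaleR) simp
  moreover have "(1 / real n) *\<^sub>R (real n *\<^sub>R a) = a" using n0 by simp
  ultimately have "a \<preceq>\<^sub>f ((1 / real n) * (r + real n * s)) *\<^sub>R b" by simp
  moreover have "(1 / real n) * (r + real n * s) \<le> t"
  proof -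
    have "r < real n * (t - s)" using n s by (simp add: pos_divide_less_eq)
    then have "r + real n * s \<le> real n * t" by (simp add: algebra_simps)
    then show ?thesis using n0 by (simp add: field_simps)
  qed
  ultimately show ?thesis using fin_cp_le_pos_le pos_le_scaleR_left[OF b] by blast
qed

text \<open>
  The infimum of the multiples of \<open>b\<close> that dominate \<open>c\<close>, up to a common summand \<open>z\<close>. The summand makes the
  quantity well defined and subadditive on differences, where the relation itself has no cancellation.
\<close>

definition cp_gauge :: "'a::cstar_algebra \<Rightarrow> 'a \<Rightarrow> real" where
  "cp_gauge b c = Inf {s. 0 \<le> s \<and> (\<exists>z\<in>cp_ideal b. c + z \<preceq>\<^sub>f z + s *\<^sub>R b)}"

definition cp_span :: "'a::cstar_algebra \<Rightarrow> 'a set" where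
  "cp_span b = {x - y |x y. x \<in> cp_ideal b \<and> y \<in> cp_ideal b}"

lemma cp_spanI: "x \<in> cp_ideal b \<Longrightarrow> y \<in> cp_ideal b \<Longrightarrow> x - y \<in> cp_span b"
  by (auto simp: cp_span_def)

lemma subspace_cp_span: assumes b: "b \<in> positives" shows "subspace (cp_span b)"
proof (rule subspaceI)
  show "0 \<in> cp_span b" using cp_spanI[OF cp_ideal_zero[OF b] cp_ideal_zero[OF b]] by simp
  fix x y :: 'a and r :: real
  assume "x \<in> cp_span b"
  then obtain x1 x2 where x: "x = x1 - x2" "x1 \<in> cp_ideal b" "x2 \<in> cp_ideal b" by (auto simp: cp_span_def)
  show "r *\<^sub>R x \<in> cp_span b"
  proof (cases "0 \<le> r")
    case True
    then show ?thesis using cp_spanI[OF cp_ideal_scaleR[OF x(2)] cp_ideal_scaleR[OF x(3)], of r r]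
      by (simp add: x(1) scaleR_diff_right)
  next
    case False
    then show ?thesis using cp_spanI[OF cp_ideal_scaleR[OF x(3)] cp_ideal_scaleR[OF x(2)], of "- r" "- r"]
      by (simp add: x(1) scaleR_diff_right)
  qed
  assume "y \<in> cp_span b"
  then obtain y1 y2 where y: "y = y1 - y2" "y1 \<in> cp_ideal b" "y2 \<in> cp_ideal b" by (auto simp: cp_span_def)
  show "x + y \<in> cp_span b"
    using cp_spanI[OF cp_ideal_add[OF x(2) y(2)] cp_ideal_add[OF x(3) y(3)]] by (simp add: x(1) y(1) algebra_simps)
qed

lemma cp_gauge_le: "0 \<le> s \<Longrightarrow> z \<in> cp_ideal b \<Longrightarrow> c + z \<preceq>\<^sub>f z + s *\<^sub>R b \<Longrightarrow> cp_gauge b c \<le> s"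
  unfolding cp_gauge_def by (intro cInf_lower bdd_belowI[of _ 0]) auto

lemma cp_gauge_witness:
  assumes c: "c \<in> cp_span b" and lt: "cp_gauge b c < t"
  shows "\<exists>s z. 0 \<le> s \<and> s < t \<and> z \<in> cp_ideal b \<and> c + z \<preceq>\<^sub>f z + s *\<^sub>R b"
proof -
  obtain x y where xy: "c = x - y" "x \<in> cp_ideal b" "y \<in> cp_ideal b" using c by (auto simp: cp_span_def)
  then obtain s where s: "0 \<le> s" "x \<preceq>\<^sub>f s *\<^sub>R b" by (auto simp: cp_ideal_def)
  have "s *\<^sub>R b \<preceq>\<^sub>f y + s *\<^sub>R b"
    by (intro pos_le_fin_cp_le fin_cp_le_positives(2)[OF s(2)] pos_le_add_left cp_ideal_positives[OF xy(3)])
  then have "c + y \<preceq>\<^sub>f y + s *\<^sub>R b" using fin_cp_le_trans[OF s(2)] by (simp add: xy(1))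
  then have "{s. 0 \<le> s \<and> (\<exists>z\<in>cp_ideal b. c + z \<preceq>\<^sub>f z + s *\<^sub>R b)} \<noteq> {}" using s(1) xy(3) by blast
  from cInf_lessD[OF this lt[unfolded cp_gauge_def]] show ?thesis by blast
qed

lemma cp_gauge_sublinear:
  assumes b: "b \<in> positives" shows "sublinear_on (cp_span b) (cp_gauge b)"
  unfolding sublinear_on_def
proof (intro conjI ballI allI impI)
  fix x y assume x: "x \<in> cp_span b" and y: "y \<in> cp_span b"
  show "cp_gauge b (x + y) \<le> cp_gauge b x + cp_gauge b y"
  proof (rule field_le_epsilon)
    fix e :: real assume e: "0 < e"
    obtain s z where s: "0 \<le> s" "s < cp_gauge b x + e/2" "z \<in> cp_ideal b" "x + z \<preceq>\<^sub>f z + s *\<^sub>R b"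
      using cp_gauge_witness[OF x, of "cp_gauge b x + e/2"] e by auto
    obtain t w where t: "0 \<le> t" "t < cp_gauge b y + e/2" "w \<in> cp_ideal b" "y + w \<preceq>\<^sub>f w + t *\<^sub>R b"
      using cp_gauge_witness[OF y, of "cp_gauge b y + e/2"] e by auto
    have "(x + y) + (z + w) \<preceq>\<^sub>f (z + w) + (s + t) *\<^sub>R b"
      using fin_cp_le_add[OF s(4) t(4)] by (simp add: algebra_simps)
    then have "cp_gauge b (x + y) \<le> s + t"
      using s(1) t(1) by (intro cp_gauge_le[of _ "z + w"] cp_ideal_add s t) simp
    then show "cp_gauge b (x + y) \<le> cp_gauge b x + cp_gauge b y + e" using s(2) t(2) by simp
  qed
next
  fix x and r :: real assume x: "x \<in> cp_span b" and r: "0 < r"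
  show "cp_gauge b (r *\<^sub>R x) \<le> r * cp_gauge b x"
  proof (rule field_le_epsilon)
    fix e :: real assume e: "0 < e"
    then obtain s z where s: "0 \<le> s" "s < cp_gauge b x + e / r" "z \<in> cp_ideal b" "x + z \<preceq>\<^sub>f z + s *\<^sub>R b"
      using cp_gauge_witness[OF x, of "cp_gauge b x + e / r"] r by auto
    have "r *\<^sub>R x + r *\<^sub>R z \<preceq>\<^sub>f r *\<^sub>R z + (r * s) *\<^sub>R b"
      using fin_cp_le_scaleR[OF s(4), of r] r by (simp add: scaleR_add_right)
    then have "cp_gauge b (r *\<^sub>R x) \<le> r * s"
      using r s by (intro cp_gauge_le[of _ "r *\<^sub>R z"] cp_ideal_scaleR) simp_all
    also have "\<dots> \<le> r * (cp_gauge b x + e / r)" using r s(2) by simp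
    finally show "cp_gauge b (r *\<^sub>R x) \<le> r * cp_gauge b x + e" using r by (simp add: distrib_left)
  qed
qed

text \<open>
  If \<open>a\<close> lies outside the ideal of \<open>b\<close>, the trace that is \<open>0\<close> on the ideal and infinite elsewhere
  separates them. Otherwise a linear functional below the gauge of \<open>b\<close> that agrees with it at \<open>a\<close>,
  extended by \<open>\<infinity>\<close>, is a trace: being below the gauge makes it monotone for Cuntz-Pedersen comparison,
  hence nonnegative and equal on \<open>xx\<^sup>\<star>\<close> and \<open>x\<^sup>\<star>x\<close>. It is at most \<open>1\<close> at \<open>b\<close>, so the gauge of \<open>a\<close> is at
  most \<open>1\<close>, and the common summand in its definition is cancelled at the price of \<open>t > 1\<close>.
\<close>

lemma fin_cp_le_of_traces:
  fixes a b :: "'a::cstar_algebra"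
  assumes a: "a \<in> positives" and b: "b \<in> positives" and t: "1 < t"
    and traces: "\<And>\<tau>. is_trace \<tau> \<Longrightarrow> \<tau> a \<le> \<tau> b"
  shows "a \<preceq>\<^sub>f t *\<^sub>R b"
proof -
  let ?I = "cp_ideal b" and ?V = "cp_span b" and ?p = "cp_gauge b"
  note I = cp_ideal_zero[OF b]
  have IV: "x \<in> ?V" if "x \<in> ?I" for x using cp_spanI[OF that I] by simp
  have aI: "a \<in> ?I"
  proof (rule ccontr)
    assume "a \<notin> ?I"
    moreover have "is_trace (\<lambda>x. if x \<in> ?I then ennreal 0 else top)"
      by (rule trace_of_ideal_functional[OF b]) simp_all
    ultimately show False using traces cp_ideal_self[OF b] by fastforce
  qed
  obtain f where f_le: "\<And>x. x \<in> ?V \<Longrightarrow> f x \<le> ?p x"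
    and f_add: "\<And>x y. x \<in> ?V \<Longrightarrow> y \<in> ?V \<Longrightarrow> f (x + y) = f x + f y"
    and f_scale: "\<And>x r. x \<in> ?V \<Longrightarrow> f (r *\<^sub>R x) = r * f x" and fa: "f a = ?p a"
    using hahn_banach_sublinear[OF subspace_cp_span[OF b] cp_gauge_sublinear[OF b] IV[OF aI]] by metis
  have f_minus: "f (x - y) = f x - f y" if "x \<in> ?V" "y \<in> ?V" for x y
    using f_add[OF that(1) subspace_neg[OF subspace_cp_span[OF b] that(2)]] f_scale[OF that(2), of "- 1"] by simp
  have f_mono: "f x \<le> f y" if xy: "x \<preceq>\<^sub>f y" and y: "y \<in> ?I" for x y
  proof -
    have x: "x \<in> ?I" by (rule cp_ideal_hereditary[OF y xy])
    have "?p (x - y) \<le> 0" by (rule cp_gauge_le[OF _ y]) (use xy in simp_all)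
    then show ?thesis using f_le[OF cp_spanI[OF x y]] f_minus[OF IV[OF x] IV[OF y]] by simp
  qed
  have f0: "f 0 = 0" using f_scale[OF IV[OF I], of 0] by simp
  have "is_trace (\<lambda>x. if x \<in> ?I then ennreal (f x) else top)"
  proof (rule trace_of_ideal_functional[OF b])
    fix x assume x: "x \<in> ?I"
    have "0 \<preceq>\<^sub>f x" by (intro pos_le_fin_cp_le) (simp_all add: zero_pos_le cp_ideal_positives[OF x])
    then show "0 \<le> f x" using f_mono[OF _ x] f0 by fastforce
  next
    fix x assume x: "x * x\<^sup>\<star> \<in> ?I"
    have le: "x * x\<^sup>\<star> \<preceq>\<^sub>f x\<^sup>\<star> * x" "x\<^sup>\<star> * x \<preceq>\<^sub>f x * x\<^sup>\<star>"
      using mult_star_fin_cp_le[of x] mult_star_fin_cp_le[of "x\<^sup>\<star>"] by simp_all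
    then show "f (x * x\<^sup>\<star>) = f (x\<^sup>\<star> * x)"
      using cp_ideal_hereditary[OF x le(2)] x by (intro antisym f_mono)
  qed (simp_all add: f_add f_scale IV)
  from traces[OF this] have "ennreal (f a) \<le> ennreal (f b)" using aI cp_ideal_self[OF b] by simp
  moreover have "f b \<le> 1"
  proof -
    have "?p b \<le> 1" by (rule cp_gauge_le[OF _ I]) (simp_all add: fin_cp_le_refl b)
    then show ?thesis using f_le[OF IV[OF cp_ideal_self[OF b]]] by simp
  qed
  ultimately have "?p a \<le> 1" unfolding fa[symmetric]
    by (metis ennreal_1 ennreal_le_iff ennreal_leI order_trans zero_le_one)
  then have "?p a < t" using t by simp
  from cp_gauge_witness[OF IV[OF aI] this] obtain s z where
    s: "0 \<le> s" "s < t" "z \<in> ?I" "a + z \<preceq>\<^sub>f z + s *\<^sub>R b" by blast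
  show ?thesis by (rule fin_cp_le_cancel[OF s(4,3) a b s(1,2)])
qed

text \<open>
  For an arbitrary trace \<open>\<tau>\<close> with regularization \<open>\<tau>'\<close>, the hypothesis gives
  \<open>\<tau>((a - \<epsilon>')\<^sub>+) \<le> \<tau>'(a) \<le> \<tau>'(b) \<le> \<tau>(b)\<close>. Hence \<open>(a - \<epsilon>')\<^sub>+ \<preceq> tb\<close> for all \<open>t > 1\<close>. Cutting down once
  more gains a factor below \<open>1\<close> that removes \<open>t\<close>, and a third time produces a cut-down of \<open>b\<close> on the
  right.
\<close>

lemma cut_down_fin_cp_le_of_lsc_traces:
  fixes a b :: "'a::cstar_algebra"
  assumes a: "a \<in> positives" and b: "b \<in> positives"
    and traces: "\<And>\<tau>. \<tau> \<in> lsc_traces \<Longrightarrow> \<tau> a \<le> \<tau> b" and e: "0 < \<epsilon>"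
  shows "\<exists>\<delta>>0. cut_down a \<epsilon> \<preceq>\<^sub>f cut_down b \<delta>"
proof -
  define e' where "e' = \<epsilon> / 4"
  have e': "0 < e'" using e by (simp add: e'_def)
  let ?a1 = "cut_down a e'"
  let ?a2 = "cut_down ?a1 e'"
  let ?a3 = "cut_down ?a2 e'"
  have p1: "?a1 \<in> positives" by (simp add: cut_down_positives a less_imp_le e')
  have p2: "?a2 \<in> positives" by (simp add: cut_down_positives p1 less_imp_le e')
  have p3: "?a3 \<in> positives" by (simp add: cut_down_positives p2 less_imp_le e')
  have tr: "\<tau> ?a1 \<le> \<tau> b" if t: "is_trace \<tau>" for \<tau>
  proof -
    have "\<tau> ?a1 \<le> lsc_reg \<tau> a" by (rule lsc_reg_upper[OF e'])
    also have "\<dots> \<le> lsc_reg \<tau> b" by (rule traces[OF lsc_reg_lsc_trace[OF t]])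
    also have "\<dots> \<le> \<tau> b" by (rule lsc_reg_le[OF t b])
    finally show ?thesis .
  qed
  obtain \<eta> where \<eta>: "0 < \<eta>" "\<eta> < 1" "?a2 \<sqsubseteq> (1 - \<eta>) *\<^sub>R ?a1"
    using cut_down_pos_le_scaleR[OF p1 e'] by blast
  have "?a1 \<preceq>\<^sub>f (1 / (1 - \<eta>)) *\<^sub>R b"
    by (rule fin_cp_le_of_traces[OF p1 b _ tr]) (use \<eta> in simp_all)
  then have "(1 - \<eta>) *\<^sub>R ?a1 \<preceq>\<^sub>f (1 - \<eta>) *\<^sub>R ((1 / (1 - \<eta>)) *\<^sub>R b)" by (rule fin_cp_le_scaleR) (use \<eta> in simp)
  then have "(1 - \<eta>) *\<^sub>R ?a1 \<preceq>\<^sub>f b" using \<eta> by simp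
  then have "?a2 \<preceq>\<^sub>f b" by (rule pos_le_fin_cp_le_trans[OF p2 \<eta>(3)])
  then obtain \<delta> where \<delta>: "0 < \<delta>" "?a3 \<preceq>\<^sub>f cut_down b \<delta>" using fin_cp_le_cut_down e' by blast
  have "norm (a - ?a3) \<le> norm (a - ?a1) + norm (?a1 - ?a2) + norm (?a2 - ?a3)"
    using norm_triangle_ineq[of "a - ?a1" "?a1 - ?a2"] norm_triangle_ineq[of "a - ?a2" "?a2 - ?a3"] by simp
  also have "\<dots> \<le> e' + e' + e'"
    by (intro add_mono norm_diff_cut_down a p1 p2 less_imp_le e')
  also have "\<dots> < \<epsilon>" using e by (simp add: e'_def)
  finally have "cut_down a \<epsilon> \<preceq>\<^sub>f ?a3" by (rule cut_down_fin_cp_le_near[OF a p3])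
  then show ?thesis using \<delta> fin_cp_le_trans by blast
qed

lemma lsc_trace_le_of_cut_downs:
  fixes a b :: "'a::cstar_algebra"
  assumes a: "a \<in> positives" and b: "b \<in> positives" and \<tau>: "\<tau> \<in> lsc_traces"
    and le: "\<And>\<epsilon>. 0 < \<epsilon> \<Longrightarrow> \<exists>\<delta>>0. cut_down a \<epsilon> \<preceq>\<^sub>C\<^sub>P cut_down b \<delta>"
  shows "\<tau> a \<le> \<tau> b"
proof (rule lsc_trace_limit_le[OF \<tau>])
  have t: "is_trace \<tau>" using \<tau> by (simp add: lsc_traces_def)
  let ?e = "\<lambda>n. inverse (real (Suc n))"
  fix n
  show "cut_down a (?e n) \<in> positives" by (rule cut_down_positives[OF a]) simp
  obtain \<delta> c where c: "0 < \<delta>" "c \<in> positives" "cut_down a (?e n) \<sim>\<^sub>C\<^sub>P c" "c \<sqsubseteq> cut_down b \<delta>"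
    using le[of "?e n"] unfolding cp_le_def pos_le_def by auto
  have "\<tau> (cut_down a (?e n)) = \<tau> c" by (rule cp_equiv_lsc_trace_eq[OF \<tau> c(3)])
  also have "\<dots> \<le> \<tau> b"
    by (intro trace_mono[OF t c(2)] pos_le_trans[OF c(4)] cut_down_pos_le b less_imp_le c(1))
  finally show "\<tau> (cut_down a (?e n)) \<le> \<tau> b" .
next
  have "(\<lambda>n. cut_down a (inverse (real (Suc n))) - a) \<longlonglongrightarrow> 0"
    by (rule Lim_null_comparison[OF always_eventually LIMSEQ_inverse_real_of_nat])
      (use norm_diff_cut_down[OF a] in \<open>simp add: norm_minus_commute\<close>)
  then show "(\<lambda>n. cut_down a (inverse (real (Suc n)))) \<longlonglongrightarrow> a" by (simp add: LIM_zero_iff)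
qed

section \<open>Equality on all lower semicontinuous traces\<close>

text \<open>
  The property that the construction of an equivalence hands on from one stage to the next.
\<close>

definition trace_eq :: "'a::cstar_algebra \<Rightarrow> 'a \<Rightarrow> bool" where
  "trace_eq a b \<longleftrightarrow> a \<in> positives \<and> b \<in> positives \<and> (\<forall>\<tau>\<in>lsc_traces. \<tau> a = \<tau> b)"

lemma trace_eq_sym: "trace_eq a b \<Longrightarrow> trace_eq b a"
  by (auto simp: trace_eq_def)

lemma scaleR_pos_le_remainder:
  assumes "c \<sqsubseteq> (1 - \<eta>) *\<^sub>R a" shows "\<eta> *\<^sub>R a \<sqsubseteq> a - c"
  using assms by (simp add: pos_le_def algebra_simps)

text \<open>
  After removing a part \<open>c \<le> (1 - \<eta>)a\<close>, at least \<open>\<eta>a\<close> is left, so an infinite value cannot be lost.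
\<close>

lemma lsc_trace_remainder_top:
  assumes t: "is_trace \<tau>" and a: "a \<in> positives" and "0 < \<eta>" "c \<sqsubseteq> (1 - \<eta>) *\<^sub>R a" "\<tau> a = top"
  shows "\<tau> (a - c) = top"
proof -
  have "\<tau> (\<eta> *\<^sub>R a) \<le> \<tau> (a - c)"
    using assms by (intro trace_mono[OF t] positives_scaleR scaleR_pos_le_remainder) simp_all
  moreover have "\<tau> (\<eta> *\<^sub>R a) = top" using assms by (simp add: trace_scaleR[OF t a] ennreal_mult_top)
  ultimately show ?thesis by (simp add: top_unique)
qed

text \<open>
  Remove from \<open>a\<close> its cut-down and from \<open>b\<close> an equivalent part that lies below a cut-down of \<open>b\<close>. The
  traces of the remainders still agree: where the removed part has finite trace it can be subtracted,
  and where it has infinite trace both remainders have infinite trace, because each keeps a proportion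
  of the original element.
\<close>

lemma trace_eq_split:
  assumes eq: "trace_eq a b" and e: "0 < \<epsilon>"
  shows "\<exists>xs. norm (a - lsum xs) \<le> \<epsilon> \<and> rsum xs \<sqsubseteq> b \<and> trace_eq (a - lsum xs) (b - rsum xs)"
proof -
  have a: "a \<in> positives" and b: "b \<in> positives" using eq by (simp_all add: trace_eq_def)
  have "\<tau> a \<le> \<tau> b" if "\<tau> \<in> lsc_traces" for \<tau> using eq that by (auto simp: trace_eq_def)
  then obtain \<delta> where \<delta>: "0 < \<delta>" "cut_down a \<epsilon> \<preceq>\<^sub>f cut_down b \<delta>"
    using cut_down_fin_cp_le_of_lsc_traces[OF a b _ e] by blast
  then obtain xs where xs: "cut_down a \<epsilon> = lsum xs" "rsum xs \<sqsubseteq> cut_down b \<delta>" by (auto simp: fin_cp_le_def)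
  \<comment> \<open>the slack on both sides keeps the remainders comparable with \<open>a\<close> and \<open>b\<close>\<close>
  obtain \<eta>1 where \<eta>1: "0 < \<eta>1" "\<eta>1 < 1" "lsum xs \<sqsubseteq> (1 - \<eta>1) *\<^sub>R a"
    using cut_down_pos_le_scaleR[OF a e] unfolding xs(1) by blast
  obtain \<eta>2 where \<eta>2: "0 < \<eta>2" "\<eta>2 < 1" "cut_down b \<delta> \<sqsubseteq> (1 - \<eta>2) *\<^sub>R b"
    using cut_down_pos_le_scaleR[OF b \<delta>(1)] by blast
  have la: "lsum xs \<sqsubseteq> a" using cut_down_pos_le[OF a less_imp_le[OF e]] by (simp add: xs(1))
  have rb: "rsum xs \<sqsubseteq> b" by (rule pos_le_trans[OF xs(2) cut_down_pos_le[OF b less_imp_le[OF \<delta>(1)]]])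
  have rb': "rsum xs \<sqsubseteq> (1 - \<eta>2) *\<^sub>R b" by (rule pos_le_trans[OF xs(2) \<eta>2(3)])
  have "\<tau> (a - lsum xs) = \<tau> (b - rsum xs)" if \<tau>: "\<tau> \<in> lsc_traces" for \<tau>
  proof -
    have t: "is_trace \<tau>" using \<tau> by (simp add: lsc_traces_def)
    have ab: "\<tau> a = \<tau> b" using eq \<tau> by (simp add: trace_eq_def)
    have 1: "\<tau> a = \<tau> (lsum xs) + \<tau> (a - lsum xs)" by (rule trace_diff[OF t lsum_positives la])
    have 2: "\<tau> b = \<tau> (lsum xs) + \<tau> (b - rsum xs)"
      using trace_diff[OF t rsum_positives rb] by (simp add: trace_lsum[OF t])
    show ?thesis
    proof (cases "\<tau> (lsum xs) = top")
      case True
      then have "\<tau> a = top" "\<tau> b = top" using 1 2 by simp_all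
      then show ?thesis
        using lsc_trace_remainder_top[OF t a \<eta>1(1,3)] lsc_trace_remainder_top[OF t b \<eta>2(1) rb'] by simp
    next
      case False
      have "\<tau> (lsum xs) + \<tau> (a - lsum xs) = \<tau> (lsum xs) + \<tau> (b - rsum xs)" 
        unfolding 1[symmetric] 2[symmetric] by (rule ab)
      then have "\<tau> (lsum xs) = \<infinity> \<or> \<tau> (a - lsum xs) = \<tau> (b - rsum xs)"
        by (rule ennreal_add_left_cancel[THEN iffD1])
      then show ?thesis using False by simp
    qed
  qed
  then have "trace_eq (a - lsum xs) (b - rsum xs)" using la rb by (simp add: trace_eq_def pos_le_def)
  moreover have "norm (a - lsum xs) \<le> \<epsilon>" using norm_diff_cut_down[OF a less_imp_le[OF e]] by (simp add: xs(1))
  ultimately show ?thesis using rb by blast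
qed

lemma trace_eq_split_both:
  assumes eq: "trace_eq a b" and e: "0 < \<epsilon>"
  shows "\<exists>xs. norm (a - lsum xs) \<le> \<epsilon> \<and> norm (b - rsum xs) \<le> \<epsilon> \<and> trace_eq (a - lsum xs) (b - rsum xs)"
proof -
  obtain xs where xs: "norm (a - lsum xs) \<le> \<epsilon>" "trace_eq (a - lsum xs) (b - rsum xs)"
    using trace_eq_split[OF eq e] by blast
  obtain ys where ys: "norm ((b - rsum xs) - lsum ys) \<le> \<epsilon>" "rsum ys \<sqsubseteq> a - lsum xs"
    "trace_eq ((b - rsum xs) - lsum ys) ((a - lsum xs) - rsum ys)"
    using trace_eq_split[OF trace_eq_sym[OF xs(2)] e] by blast
  have "norm ((a - lsum xs) - rsum ys) \<le> norm (a - lsum xs)"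
  proof (rule norm_mono_positives)
    show "(a - lsum xs) - rsum ys \<in> positives" using ys(2) by (simp add: pos_le_def)
  qed (simp add: rsum_positives)
  then show ?thesis
    using xs(1) ys trace_eq_sym[OF ys(3)]
    by (intro exI[of _ "xs @ map star ys"]) (simp add: lsum_map_star rsum_map_star diff_diff_eq)
qed

text \<open>
  Partial sums of the rearranged series lie between partial sums of the iterated one and \<open>a\<close>, and the
  norm is monotone on positive elements.
\<close>

lemma positive_double_series:
  fixes q :: "nat \<times> nat \<Rightarrow> 'a::cstar_algebra"
  assumes q: "\<And>e. q e \<in> positives" and q0: "\<And>i j. l i \<le> j \<Longrightarrow> q (i, j) = 0"
    and s: "(\<lambda>i. \<Sum>j<l i. q (i, j)) sums a"
  shows "(\<lambda>k. q (prod_decode k)) sums a"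
proof -
  define E where "E n = Sigma {..<n} (\<lambda>i. {..<l i})" for n
  have finE: "finite (E n)" for n by (simp add: E_def)
  have sumE: "(\<Sum>i<n. \<Sum>j<l i. q (i, j)) = sum q (E n)" for n
    unfolding E_def by (simp add: sum.Sigma)
  have rowp: "(\<Sum>j<l i. q (i, j)) \<in> positives" for i
  proof -
    have "(\<Sum>j<m. q (i, j)) \<in> positives" for m by (induction m) (simp_all add: q positives_add)
    then show ?thesis .
  qed
  have E_le: "sum q (E n) \<sqsubseteq> a" for n using partial_sum_pos_le[OF rowp s, of n] by (simp add: sumE)
  have sump: "sum q F \<in> positives" if "finite F" for F
    using that by induction (simp_all add: q positives_add)
  have mono: "sum q F \<sqsubseteq> sum q G" if "finite G" "F \<subseteq> G" for F G
    using sump[of "G - F"] that by (simp add: pos_le_def sum_diff)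
  have S: "(\<Sum>k<K. q (prod_decode k)) = sum q (prod_decode ` {..<K})" for K
    by (simp add: sum.reindex inj_prod_decode)
  have upper: "sum q (prod_decode ` {..<K}) \<sqsubseteq> a" for K
  proof -
    let ?D = "prod_decode ` {..<K}"
    obtain M where M: "fst ` ?D \<subseteq> {..<M}" using finite_nat_bounded[of "fst ` ?D"] by auto
    have "sum q ?D = sum q (?D \<inter> E M)"
    proof (rule sum.mono_neutral_right)
      show "\<forall>e\<in>?D - ?D \<inter> E M. q e = 0"
      proof
        fix e assume e: "e \<in> ?D - ?D \<inter> E M"
        obtain i j where ij: "e = (i, j)" by (cases e)
        have "fst e \<in> fst ` ?D" using e by (intro imageI) simp
        then have "i < M" using M ij by auto
        then have "l i \<le> j" using e unfolding ij E_def by auto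
        then show "q e = 0" using q0 ij by simp
      qed
    qed auto
    also have "\<dots> \<sqsubseteq> sum q (E M)" by (rule mono[OF finE]) auto
    also have "\<dots> \<sqsubseteq> a" by (rule E_le)
    finally show ?thesis .
  qed
  have "(\<lambda>K. \<Sum>k<K. q (prod_decode k)) \<longlonglongrightarrow> a"
  proof (rule LIMSEQ_I)
    fix e :: real assume "0 < e"
    then obtain n where n: "norm (sum q (E n) - a) < e"
      using LIMSEQ_D[OF s[unfolded sums_def sumE]] by blast
    obtain K0 where K0: "prod_encode ` E n \<subseteq> {..<K0}" using finite_nat_bounded[of "prod_encode ` E n"] finE by auto
    have "norm ((\<Sum>k<K. q (prod_decode k)) - a) < e" if K: "K0 \<le> K" for K
    proof -
      have "E n \<subseteq> prod_decode ` {..<K}"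
      proof
        fix x assume "x \<in> E n"
        then have "prod_encode x < K" using K0 K by force
        then show "x \<in> prod_decode ` {..<K}" by (intro image_eqI[of _ _ "prod_encode x"]) simp_all
      qed
      then have "sum q (E n) \<sqsubseteq> sum q (prod_decode ` {..<K})" by (intro mono) simp_all
      then have "norm (a - sum q (prod_decode ` {..<K})) \<le> norm (a - sum q (E n))"
        using upper[of K] by (intro norm_mono_positives) (simp_all add: pos_le_def)
      then show ?thesis using n by (simp add: S norm_minus_commute)
    qed
    then show "\<exists>K0. \<forall>K\<ge>K0. norm ((\<Sum>k<K. q (prod_decode k)) - a) < e" by blast
  qed
  then show ?thesis by (simp add: sums_def)
qed

lemma sums_lsum_flatten:
  assumes "(\<lambda>i. lsum (xs i)) sums a"
    and y: "y = (\<lambda>k. case prod_decode k of (i, j) \<Rightarrow> if j < length (xs i) then xs i ! j else 0)"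
  shows "(\<lambda>k. y k * (y k)\<^sup>\<star>) sums a"
proof -
  define z where "z = (\<lambda>(i, j). if j < length (xs i) then xs i ! j else 0)"
  have "(\<lambda>k. z (prod_decode k) * (z (prod_decode k))\<^sup>\<star>) sums a"
  proof (rule positive_double_series[where l = "\<lambda>i. length (xs i)" and q = "\<lambda>e. z e * (z e)\<^sup>\<star>"])
    have "(\<Sum>j<length (xs i). z (i, j) * (z (i, j))\<^sup>\<star>) = lsum (xs i)" for i
      unfolding lsum_def sum_list_sum_nth by (rule sum.cong) (auto simp: z_def)
    then show "(\<lambda>i. \<Sum>j<length (xs i). z (i, j) * (z (i, j))\<^sup>\<star>) sums a" using assms(1) by simp
  qed (simp_all add: positives_mult_star z_def)
  then show ?thesis unfolding y by (simp add: z_def)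
qed

lemma cp_equiv_of_sums:
  assumes a: "(\<lambda>i. lsum (xs i)) sums a" and b: "(\<lambda>i. rsum (xs i)) sums b"
  shows "a \<sim>\<^sub>C\<^sub>P b"
proof -
  define y where "y = (\<lambda>k. case prod_decode k of (i, j) \<Rightarrow> if j < length (xs i) then xs i ! j else 0)"
  have "(\<lambda>k. (y k)\<^sup>\<star> * ((y k)\<^sup>\<star>)\<^sup>\<star>) sums b"
  proof (rule sums_lsum_flatten)
    show "(\<lambda>i. lsum (map star (xs i))) sums b" using b by (simp add: lsum_map_star)
  qed (auto simp: y_def fun_eq_iff split: prod.split)
  then show ?thesis unfolding cp_equiv_def using sums_lsum_flatten[OF a y_def] by auto
qed

text \<open>
  Splitting off equivalent parts again and again, with remainders bounded by \<open>1/(n + 1)\<close> on both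
  sides, exhausts \<open>a\<close> and \<open>b\<close> by series of pairwise equivalent elements. Concatenating the finitely
  many witnesses of each stage gives one sequence for \<open>a\<close> and \<open>b\<close>.
\<close>

lemma cp_equiv_of_trace_eq:
  fixes a b :: "'a::cstar_algebra"
  assumes eq: "trace_eq a b"
  shows "a \<sim>\<^sub>C\<^sub>P b"
proof -
  let ?R = "\<lambda>n (r :: 'a \<times> 'a) r' xs. r' = (fst r - lsum xs, snd r - rsum xs) \<and>
    norm (fst r') \<le> inverse (real (Suc n)) \<and> norm (snd r') \<le> inverse (real (Suc n))"
  have "\<exists>f. \<forall>n. (trace_eq (fst (f n)) (snd (f n)) \<and> (n = 0 \<longrightarrow> f n = (a, b))) \<and>
      (\<exists>xs. ?R n (f n) (f (Suc n)) xs)"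
  proof (rule dependent_nat_choice)
    show "\<exists>r. trace_eq (fst r) (snd r) \<and> ((0::nat) = 0 \<longrightarrow> r = (a, b))"
      using eq by (intro exI[of _ "(a, b)"]) simp
    fix r and n :: nat assume "trace_eq (fst r) (snd r) \<and> (n = 0 \<longrightarrow> r = (a, b))"
    then obtain xs where xs: "norm (fst r - lsum xs) \<le> inverse (real (Suc n))"
      "norm (snd r - rsum xs) \<le> inverse (real (Suc n))" "trace_eq (fst r - lsum xs) (snd r - rsum xs)"
      using trace_eq_split_both[of "fst r" "snd r" "inverse (real (Suc n))"] by auto
    then show "\<exists>r'. (trace_eq (fst r') (snd r') \<and> (Suc n = 0 \<longrightarrow> r' = (a, b))) \<and> (\<exists>xs. ?R n r r' xs)"
      by (intro exI[of _ "(fst r - lsum xs, snd r - rsum xs)"]) auto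
  qed
  then obtain f where f0: "f 0 = (a, b)" and fS: "\<And>n. \<exists>xs. ?R n (f n) (f (Suc n)) xs" by blast
  then obtain xs where xs: "\<And>n. ?R n (f n) (f (Suc n)) (xs n)" by metis
  have rem: "(\<Sum>i<n. lsum (xs i)) = a - fst (f n)" "(\<Sum>i<n. rsum (xs i)) = b - snd (f n)" for n
    by (induction n) (use f0 xs in simp_all)
  have L: "(\<lambda>n. fst (f (Suc n))) \<longlonglongrightarrow> 0" "(\<lambda>n. snd (f (Suc n))) \<longlonglongrightarrow> 0"
    using xs by (intro Lim_null_comparison[OF always_eventually LIMSEQ_inverse_real_of_nat]; simp)+
  have "(\<lambda>n. a - fst (f n)) \<longlonglongrightarrow> a - 0" "(\<lambda>n. b - snd (f n)) \<longlonglongrightarrow> b - 0"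
    by (intro tendsto_diff tendsto_const LIMSEQ_imp_Suc[OF L(1)] LIMSEQ_imp_Suc[OF L(2)])+
  then show ?thesis by (intro cp_equiv_of_sums[of xs]) (simp_all add: sums_def rem)
qed

theorem theorem1:
  fixes a b :: "'a::cstar_algebra"
  assumes "a \<in> positives" and "b \<in> positives"
  shows "((\<forall>\<tau>\<in>lsc_traces. \<tau> a \<le> \<tau> b) \<longleftrightarrow>
            (\<forall>\<epsilon>>0. \<exists>\<delta>>0. cut_down a \<epsilon> \<preceq>\<^sub>C\<^sub>P cut_down b \<delta>)) \<and>
         ((\<forall>\<tau>\<in>lsc_traces. \<tau> a = \<tau> b) \<longleftrightarrow> a \<sim>\<^sub>C\<^sub>P b)"
proof (intro conjI iffI allI impI ballI)
  fix \<epsilon> :: real assume "\<forall>\<tau>\<in>lsc_traces. \<tau> a \<le> \<tau> b" "0 < \<epsilon>"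
  then show "\<exists>\<delta>>0. cut_down a \<epsilon> \<preceq>\<^sub>C\<^sub>P cut_down b \<delta>"
    using cut_down_fin_cp_le_of_lsc_traces[OF assms] fin_cp_le_imp_cp_le by blast
next
  fix \<tau> :: "'a \<Rightarrow> ennreal"
  assume "\<forall>\<epsilon>>0. \<exists>\<delta>>0. cut_down a \<epsilon> \<preceq>\<^sub>C\<^sub>P cut_down b \<delta>" "\<tau> \<in> lsc_traces"
  then show "\<tau> a \<le> \<tau> b" using lsc_trace_le_of_cut_downs[OF assms] by blast
next
  assume "\<forall>\<tau>\<in>lsc_traces. \<tau> a = \<tau> b"
  then show "a \<sim>\<^sub>C\<^sub>P b" using assms by (intro cp_equiv_of_trace_eq) (simp add: trace_eq_def)
next
  fix \<tau> :: "'a \<Rightarrow> ennreal" assume "a \<sim>\<^sub>C\<^sub>P b" "\<tau> \<in> lsc_traces"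
  then show "\<tau> a = \<tau> b" by (rule cp_equiv_lsc_trace_eq[rotated])
qed

end
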